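(* Let $(\hat v^*,\hat z^*,u_0)\in [Y^*]^2\times B^*\times Y^*\times U$, with $\hat v^*=(\hat v_1^*,\hat v_2^*,\hat v_0^* )\in [Y^*]^2\times B^*$, $\hat z^*\in Y^*$, $u_0\in U$, be such that $$\delta J_1^*(\hat v^*,\hat z^*,u_0)=\mathbf 0 .$$ Then $\delta J(u_0)=\mathbf 0$, $\hat v^*\in A^*$, and $$J(u_0)=\inf_{u\in U}\left\{J(u)+\frac K2\int_\Omega |u-u_0|^2\,dx\right\}=J^*(\hat v^*,\hat z^* )=\sup_{v^*\in A^*} J^*(v^*,\hat z^* ).$$
   Context: $\Omega\subset\mathbb R^3$ is an open, bounded, connected set with regular (Lipschitz) boundary. $\alpha,\beta,\gamma>0$ are constants, $U=W_0^{1,2}(\Omega)$, $Y=Y^*=L^2(\Omega)$, $f\in L^2(\Omega)$, and $K>0$ is a constant with $K\gg\gamma$ ($K$ large relative to $\gamma$). The primal functional $J:U\to\mathbb R$ is $$J(u)=\frac\gamma2\int_\Omega\nabla u\cdot\nabla u\,dx+\frac\alpha2\int_\Omega(u^2-\beta)^2\,dx-\langle u,f\rangle_{L^2}.$$ Put $$B^*=\{v_0^*\in Y^*:\ 2v_0^*+K>K/2\ \text{ in }\Omega\},$$ $$A^*=\{v^*=(v_1^*,v_2^*,v_0^* )\in[Y^*]^2\times B^*:\ v_1^*+v_2^*-f=0\ \text{ in }\Omega\}.$$ Polar functionals: $$G_1^*(v_1^*+z^* )=\sup_{u\in U}\Big\{\langle u,v_1^*+z^*\rangle_{L^2}-\frac\gamma2\int_\Omega\nabla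 u\cdot\nabla u\,dx\Big\}=\frac12\int_\Omega[(-\gamma\nabla^2)^{-1}(v_1^*+z^* )](v_1^*+z^* )\,dx,$$ where $(-\gamma\nabla^2)^{-1}$ is the inverse of $-\gamma$ times the Laplacian with homogeneous Dirichlet boundary conditions. With $G_2(u,v)=\frac\alpha2\int_\Omega(u^2-\beta+v)^2\,dx+\frac K2\int_\Omega u^2\,dx$, for $v_0^*\in B^*$, $$G_2^*(v_2^*,v_0^* )=\sup_{(u,v)\in U\times Y}\{\langle u,v_2^*\rangle_{L^2}+\langle v,v_0^*\rangle_{L^2}-G_2(u,v)\}=\frac12\int_\Omega\frac{(v_2^* )^2}{2v_0^*+K}\,dx+\frac1{2\alpha}\int_\Omega(v_0^* )^2\,dx+\beta\int_\Omega v_0^*\,dx,$$ $$F^*(z^* )=\sup_{u\in U}\Big\{\langle u,z^*\rangle_{L^2}-\frac K2\int_\Omega u^2\,dx\Big\}=\frac1{2K}\int_\Omega(z^* )^2\,dx.$$ Dual functionals, for $v^*=(v_1^*,v_2^*,v_0^* )\in[Y^*]^2\times B^*$, $z^*\in Y^*$, $u\in U$: $$J^*(v^*,z^* )=-G_1^*(v_1^*+z^* )-G_2^*(v_2^*,v_0^* )+F^*(z^* ),$$ $$J_1^*(v^*,z^*,u)=J^*(v^*,z^* )+\langle u,v_1^*+v_2^*-f\rangle_{L^2}.$$ $\delta$ denotes the first (Gâteaux) variation; $\delta J_1^*(\hat v^*,\hat z^*,u_0)=\mathbf 0$ means that the first variations of $J_1^*$ with respect to each of $v_1^*,v_2^*,v_0^*,z^*,u$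 vanish at that point. *)

theory Defs
  imports "HOL-Analysis.Analysis"
begin

text \<open>
  Elements of \<open>L\<^sup>2\<close> and of the Sobolev spaces are represented by functions on all of
  \<open>\<real>\<^sup>3\<close>; only their values almost everywhere in \<open>\<Omega>\<close> matter.
\<close>

definition L2 :: "(real^3) set \<Rightarrow> (real^3 \<Rightarrow> real) set" where
  "L2 \<Omega> = {u. u \<in> borel_measurable (lebesgue_on \<Omega>) \<and>
               integrable (lebesgue_on \<Omega>) (\<lambda>x. (u x)\<^sup>2)}"

definition L2_inner :: "(real^3) set \<Rightarrow> (real^3 \<Rightarrow> real) \<Rightarrow> (real^3 \<Rightarrow> real) \<Rightarrow> real" where
  "L2_inner \<Omega> u v = (\<integral>x. u x * v x \<partial>lebesgue_on \<Omega>)"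

text \<open>
  Near each boundary point, after a rigid motion, the set is the part of the ball lying
  strictly above the graph of a Lipschitz function of two variables.
\<close>

definition lipschitz_boundary :: "(real^3) set \<Rightarrow> bool" where
  "lipschitz_boundary \<Omega> \<longleftrightarrow>
     (\<forall>p\<in>frontier \<Omega>. \<exists>r>0. \<exists>T :: real^3 \<Rightarrow> real^3. \<exists>g :: real^2 \<Rightarrow> real. \<exists>L.
        orthogonal_transformation T \<and> L-lipschitz_on UNIV g \<and>
        \<Omega> \<inter> ball p r =
          {x \<in> ball p r. T (x - p) $ 3 > g (vector [T (x - p) $ 1, T (x - p) $ 2])})"

definition partial_deriv :: "3 \<Rightarrow> (real^3 \<Rightarrow> real) \<Rightarrow> real^3 \<Rightarrow> real" where
  "partial_deriv i \<phi> x = frechet_derivative \<phi> (at x) (axis i 1)"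

primrec C_class :: "nat \<Rightarrow> (real^3 \<Rightarrow> real) \<Rightarrow> bool" where
  "C_class 0 \<phi> \<longleftrightarrow> continuous_on UNIV \<phi>"
| "C_class (Suc k) \<phi> \<longleftrightarrow>
     (\<forall>x. \<phi> differentiable at x) \<and> (\<forall>i. C_class k (partial_deriv i \<phi>))"

definition test_functions :: "(real^3) set \<Rightarrow> (real^3 \<Rightarrow> real) set" where
  "test_functions \<Omega> =
     {\<phi>. (\<forall>k. C_class k \<phi>) \<and> compact (closure {x. \<phi> x \<noteq> 0}) \<and> closure {x. \<phi> x \<noteq> 0} \<subseteq> \<Omega>}"

definition is_weak_gradient ::
  "(real^3) set \<Rightarrow> (real^3 \<Rightarrow> real) \<Rightarrow> (real^3 \<Rightarrow> real^3) \<Rightarrow> bool" where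
  "is_weak_gradient \<Omega> u g \<longleftrightarrow>
     (\<forall>i. (\<lambda>x. g x $ i) \<in> L2 \<Omega>) \<and>
     (\<forall>\<phi>\<in>test_functions \<Omega>. \<forall>i.
        L2_inner \<Omega> u (partial_deriv i \<phi>) = - L2_inner \<Omega> (\<lambda>x. g x $ i) \<phi>)"

definition W12 :: "(real^3) set \<Rightarrow> (real^3 \<Rightarrow> real) set" where
  "W12 \<Omega> = {u \<in> L2 \<Omega>. \<exists>g. is_weak_gradient \<Omega> u g}"

text \<open>The weak gradient is unique up to null sets, so integrals do not depend on the choice.\<close>

definition weak_gradient :: "(real^3) set \<Rightarrow> (real^3 \<Rightarrow> real) \<Rightarrow> real^3 \<Rightarrow> real^3" where
  "weak_gradient \<Omega> u = (SOME g. is_weak_gradient \<Omega> u g)"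

definition dirichlet_integral :: "(real^3) set \<Rightarrow> (real^3 \<Rightarrow> real) \<Rightarrow> real" where
  "dirichlet_integral \<Omega> u =
     (\<integral>x. weak_gradient \<Omega> u x \<bullet> weak_gradient \<Omega> u x \<partial>lebesgue_on \<Omega>)"

definition W12_norm :: "(real^3) set \<Rightarrow> (real^3 \<Rightarrow> real) \<Rightarrow> real" where
  "W12_norm \<Omega> u = sqrt (L2_inner \<Omega> u u + dirichlet_integral \<Omega> u)"

definition W012 :: "(real^3) set \<Rightarrow> (real^3 \<Rightarrow> real) set" where
  "W012 \<Omega> = {u \<in> W12 \<Omega>. \<exists>\<phi> :: nat \<Rightarrow> real^3 \<Rightarrow> real.
      (\<forall>n. \<phi> n \<in> test_functions \<Omega>) \<and> (\<lambda>n. W12_norm \<Omega> (\<lambda>x. \<phi> n x - u x)) \<longlonglongrightarrow> 0}"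

definition J :: "(real^3) set \<Rightarrow> real \<Rightarrow> real \<Rightarrow> real \<Rightarrow> (real^3 \<Rightarrow> real) \<Rightarrow> (real^3 \<Rightarrow> real) \<Rightarrow> real" where
  "J \<Omega> \<alpha> \<beta> \<gamma> f u =
     \<gamma> / 2 * dirichlet_integral \<Omega> u
     + \<alpha> / 2 * (\<integral>x. ((u x)\<^sup>2 - \<beta>)\<^sup>2 \<partial>lebesgue_on \<Omega>) - L2_inner \<Omega> u f"

definition G2 :: "(real^3) set \<Rightarrow> real \<Rightarrow> real \<Rightarrow> real \<Rightarrow> (real^3 \<Rightarrow> real) \<Rightarrow> (real^3 \<Rightarrow> real) \<Rightarrow> real" where
  "G2 \<Omega> \<alpha> \<beta> K u v =
     \<alpha> / 2 * (\<integral>x. ((u x)\<^sup>2 - \<beta> + v x)\<^sup>2 \<partial>lebesgue_on \<Omega>)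
     + K / 2 * (\<integral>x. (u x)\<^sup>2 \<partial>lebesgue_on \<Omega>)"

definition Bstar :: "(real^3) set \<Rightarrow> real \<Rightarrow> (real^3 \<Rightarrow> real) set" where
  "Bstar \<Omega> K = {v0 \<in> L2 \<Omega>. AE x in lebesgue_on \<Omega>. 2 * v0 x + K > K / 2}"

definition Astar ::
  "(real^3) set \<Rightarrow> real \<Rightarrow> (real^3 \<Rightarrow> real)
    \<Rightarrow> ((real^3 \<Rightarrow> real) \<times> (real^3 \<Rightarrow> real) \<times> (real^3 \<Rightarrow> real)) set" where
  "Astar \<Omega> K f = {(v1, v2, v0). v1 \<in> L2 \<Omega> \<and> v2 \<in> L2 \<Omega> \<and> v0 \<in> Bstar \<Omega> K \<and>
     (AE x in lebesgue_on \<Omega>. v1 x + v2 x - f x = 0)}"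

text \<open>
  The suprema below are real-valued: for bounded \<open>\<Omega>\<close>, positive \<open>\<alpha>\<close>, \<open>\<gamma>\<close>, \<open>K\<close>,
  arguments in \<open>L\<^sup>2\<close> and \<open>v0\<close> in \<open>Bstar \<Omega> K\<close>, the sets involved are nonempty and bounded above.
\<close>

definition G1star :: "(real^3) set \<Rightarrow> real \<Rightarrow> (real^3 \<Rightarrow> real) \<Rightarrow> real" where
  "G1star \<Omega> \<gamma> w = (SUP u\<in>W012 \<Omega>. L2_inner \<Omega> u w - \<gamma> / 2 * dirichlet_integral \<Omega> u)"

definition G2star ::
  "(real^3) set \<Rightarrow> real \<Rightarrow> real \<Rightarrow> real \<Rightarrow> (real^3 \<Rightarrow> real) \<Rightarrow> (real^3 \<Rightarrow> real) \<Rightarrow> real" where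
  "G2star \<Omega> \<alpha> \<beta> K v2 v0 =
     (SUP (u, v)\<in>W012 \<Omega> \<times> L2 \<Omega>. L2_inner \<Omega> u v2 + L2_inner \<Omega> v v0 - G2 \<Omega> \<alpha> \<beta> K u v)"

definition Fstar :: "(real^3) set \<Rightarrow> real \<Rightarrow> (real^3 \<Rightarrow> real) \<Rightarrow> real" where
  "Fstar \<Omega> K z =
     (SUP u\<in>W012 \<Omega>. L2_inner \<Omega> u z - K / 2 * (\<integral>x. (u x)\<^sup>2 \<partial>lebesgue_on \<Omega>))"

definition Jstar ::
  "(real^3) set \<Rightarrow> real \<Rightarrow> real \<Rightarrow> real \<Rightarrow> real
    \<Rightarrow> (real^3 \<Rightarrow> real) \<Rightarrow> (real^3 \<Rightarrow> real) \<Rightarrow> (real^3 \<Rightarrow> real) \<Rightarrow> (real^3 \<Rightarrow> real) \<Rightarrow> real" where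
  "Jstar \<Omega> \<alpha> \<beta> \<gamma> K v1 v2 v0 z =
     - G1star \<Omega> \<gamma> (\<lambda>x. v1 x + z x) - G2star \<Omega> \<alpha> \<beta> K v2 v0 + Fstar \<Omega> K z"

definition J1star ::
  "(real^3) set \<Rightarrow> real \<Rightarrow> real \<Rightarrow> real \<Rightarrow> real \<Rightarrow> (real^3 \<Rightarrow> real)
    \<Rightarrow> (real^3 \<Rightarrow> real) \<Rightarrow> (real^3 \<Rightarrow> real) \<Rightarrow> (real^3 \<Rightarrow> real) \<Rightarrow> (real^3 \<Rightarrow> real)
    \<Rightarrow> (real^3 \<Rightarrow> real) \<Rightarrow> real" where
  "J1star \<Omega> \<alpha> \<beta> \<gamma> K f v1 v2 v0 z u =
     Jstar \<Omega> \<alpha> \<beta> \<gamma> K v1 v2 v0 z + L2_inner \<Omega> u (\<lambda>x. v1 x + v2 x - f x)"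

text \<open>
  Vanishing of the first (Gateaux) variation at \<open>v\<close> of a functional with domain \<open>S\<close>.  The
  variation is taken in the directions along which the functional is defined on both sides
  of \<open>v\<close>.  When \<open>S\<close> is a linear space these are all directions in \<open>S\<close>; the restriction
  matters only for \<open>Bstar\<close>, which is not open in \<open>L\<^sup>2\<close> (its interior is empty if \<open>\<Omega>\<close> is open
  and nonempty).
\<close>

definition first_variation_vanishes ::
  "(real^3 \<Rightarrow> real) set \<Rightarrow> ((real^3 \<Rightarrow> real) \<Rightarrow> real) \<Rightarrow> (real^3 \<Rightarrow> real) \<Rightarrow> bool" where
  "first_variation_vanishes S F v \<longleftrightarrow>
     (\<forall>\<phi>. (\<forall>\<^sub>F t in nhds 0. (\<lambda>x. v x + t * \<phi> x) \<in> S) \<longrightarrow>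
          ((\<lambda>t. F (\<lambda>x. v x + t * \<phi> x)) has_real_derivative 0) (at 0))"

end

theory Submission
  imports Defs
begin

text \<open>
  The dual functional is assembled from the conjugates \<open>G\<^sub>1\<^sup>*\<close>, \<open>G\<^sub>2\<^sup>*\<close>, \<open>F\<^sup>*\<close> of convex functionals of
  \<open>u\<close>. Stationarity in \<open>v\<^sub>1\<close>, \<open>z\<close> and \<open>v\<^sub>2\<close> says that these conjugates have the derivative \<open>u\<^sub>0\<close> at
  \<open>v\<^sub>1 + z\<close>, at \<open>z\<close> and at \<open>v\<^sub>2\<close>. Where the conjugate of a lower semicontinuous convex functional is
  differentiable, the derivative attains its supremum (\<open>conjugate_attained_at_derivative\<close>), so \<open>u\<^sub>0\<close> maximizes all three expressions, and
  the Euler-Lagrange equations are, for every \<open>\<phi>\<close> in the Sobolev space,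
  \<open>\<langle>\<phi>, v\<^sub>1 + z\<rangle> = \<gamma> \<integral> \<nabla>u\<^sub>0 \<bullet> \<nabla>\<phi>\<close>, \<open>z = K u\<^sub>0\<close> and \<open>\<langle>\<phi>, v\<^sub>2\<rangle> = \<langle>\<phi>, (2 v\<^sub>0 + K) u\<^sub>0\<rangle>\<close>.
  Stationarity in \<open>u\<close> is the constraint \<open>v\<^sub>1 + v\<^sub>2 = f\<close>, and stationarity in \<open>v\<^sub>0\<close> is
  \<open>v\<^sub>0 = \<alpha> (u\<^sub>0\<^sup>2 - \<beta>)\<close> (\<open>v0_eq\<close>). In the sum of these relations the terms with \<open>K\<close> cancel, which leaves
  the vanishing of the first variation of \<open>J\<close> at \<open>u\<^sub>0\<close>; inserting the attained values gives
  \<open>J(u\<^sub>0) = J\<^sup>*(v, z)\<close> (\<open>no_duality_gap\<close>).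

  For the extremal characterizations, the Fenchel inequalities on the constraint set together with
  \<open>z = K u\<^sub>0\<close> give \<open>J\<^sup>*(w, z) \<le> J(u) + K/2 \<integral> |u - u\<^sub>0|\<^sup>2\<close> for every feasible \<open>w\<close> and every \<open>u\<close>
  (\<open>Jstar_le_proximal\<close>). Taking \<open>u = u\<^sub>0\<close> gives the supremum and \<open>w = v\<close> gives the infimum.

  The analysis behind this consists of three facts about functions on \<open>\<Omega>\<close>. Test functions separate
  the points of \<open>L\<^sup>2\<close> (\<open>fundamental_lemma\<close>), which makes weak gradients unique and turns weak
  identities into pointwise ones. The Poincare inequality bounds the set of values whose supremum is
  \<open>G\<^sub>1\<^sup>*\<close>. The embedding of the Sobolev space into \<open>L\<^sup>4\<close> (\<open>W012_square_L2\<close>) makes the quartic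
  term finite and lets the substitution \<open>s = u\<^sup>2 - \<beta> + v\<close> decouple the variables of \<open>G\<^sub>2\<close>.
\<close>

section \<open>Square-integrable functions\<close>

lemma L2_D:
  assumes "u \<in> L2 \<Omega>"
  shows L2_measurable: "u \<in> borel_measurable (lebesgue_on \<Omega>)"
    and L2_integrable_square: "integrable (lebesgue_on \<Omega>) (\<lambda>x. (u x)\<^sup>2)"
  using assms by (auto simp: L2_def)

lemma L2_mult_integrable:
  assumes "u \<in> L2 \<Omega>" "v \<in> L2 \<Omega>"
  shows "integrable (lebesgue_on \<Omega>) (\<lambda>x. u x * v x)"
proof (rule Bochner_Integration.integrable_bound)
  show "integrable (lebesgue_on \<Omega>) (\<lambda>x. (u x)\<^sup>2 + (v x)\<^sup>2)"
    using assms by (auto simp: L2_def)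
  show "(\<lambda>x. u x * v x) \<in> borel_measurable (lebesgue_on \<Omega>)"
    using assms by (auto simp: L2_def)
  have "\<bar>a * b\<bar> \<le> a\<^sup>2 + b\<^sup>2" for a b :: real
  proof -
    have "2 * \<bar>a * b\<bar> \<le> a\<^sup>2 + b\<^sup>2"
      using zero_le_power2[of "\<bar>a\<bar> - \<bar>b\<bar>"] by (simp add: power2_diff abs_mult)
    then show ?thesis by linarith
  qed
  then show "AE x in lebesgue_on \<Omega>. norm (u x * v x) \<le> norm ((u x)\<^sup>2 + (v x)\<^sup>2)"
    by auto
qed

lemma L2_add:
  assumes "u \<in> L2 \<Omega>" "v \<in> L2 \<Omega>"
  shows "(\<lambda>x. u x + v x) \<in> L2 \<Omega>"
proof -
  have "integrable (lebesgue_on \<Omega>) (\<lambda>x. (u x)\<^sup>2 + 2 * (u x * v x) + (v x)\<^sup>2)"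
    using assms L2_mult_integrable[OF assms] by (auto simp: L2_def)
  then have "integrable (lebesgue_on \<Omega>) (\<lambda>x. (u x + v x)\<^sup>2)"
    by (simp add: power2_sum algebra_simps)
  then show ?thesis using assms by (auto simp: L2_def)
qed

lemma L2_scale:
  assumes "u \<in> L2 \<Omega>"
  shows "(\<lambda>x. c * u x) \<in> L2 \<Omega>"
  using assms by (auto simp: L2_def power_mult_distrib)

lemma L2_diff:
  assumes "u \<in> L2 \<Omega>" "v \<in> L2 \<Omega>"
  shows "(\<lambda>x. u x - v x) \<in> L2 \<Omega>"
  using L2_add[OF assms(1) L2_scale[OF assms(2), of "-1"]] by simp

lemma L2_sum:
  assumes "\<And>i. i \<in> I \<Longrightarrow> u i \<in> L2 \<Omega>"
  shows "(\<lambda>x. \<Sum>i\<in>I. u i x) \<in> L2 \<Omega>"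
  using assms
proof (induction I rule: infinite_finite_induct)
  case (insert i I)
  then have "(\<lambda>x. u i x + (\<Sum>i\<in>I. u i x)) \<in> L2 \<Omega>" by (intro L2_add) auto
  with insert show ?case by simp
qed (auto simp: L2_def)

lemma L2_bounded_mult:
  assumes u: "u \<in> L2 \<Omega>" and "b \<in> borel_measurable (lebesgue_on \<Omega>)"
    and "\<And>x. \<bar>b x\<bar> \<le> C"
  shows "(\<lambda>x. b x * u x) \<in> L2 \<Omega>"
proof -
  have "integrable (lebesgue_on \<Omega>) (\<lambda>x. (b x * u x)\<^sup>2)"
  proof (rule Bochner_Integration.integrable_bound)
    show "integrable (lebesgue_on \<Omega>) (\<lambda>x. C\<^sup>2 * (u x)\<^sup>2)" using u by (auto simp: L2_def)
    show "(\<lambda>x. (b x * u x)\<^sup>2) \<in> borel_measurable (lebesgue_on \<Omega>)"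
      using assms by (auto simp: L2_def)
    have "(b x)\<^sup>2 \<le> C\<^sup>2" for x
      using assms(3)[of x] by (metis abs_ge_zero power2_abs power_mono)
    then show "AE x in lebesgue_on \<Omega>. norm ((b x * u x)\<^sup>2) \<le> norm (C\<^sup>2 * (u x)\<^sup>2)"
      by (simp add: power_mult_distrib mult_right_mono)
  qed
  then show ?thesis using assms by (auto simp: L2_def)
qed

lemma L2_const:
  assumes "bounded \<Omega>" "open \<Omega>"
  shows "(\<lambda>x. c) \<in> L2 \<Omega>"
proof -
  have "emeasure lebesgue \<Omega> < \<infinity>"
    using fmeasurableD2[OF lmeasurable_open[OF assms]] by (simp add: top.not_eq_extremum)
  then have "finite_measure (lebesgue_on \<Omega>)"
    using assms by (intro finite_measureI) (auto simp: emeasure_restrict_space)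
  then show ?thesis by (simp add: L2_def finite_measure.integrable_const)
qed

lemma L2_integrable:
  assumes "bounded \<Omega>" "open \<Omega>" "u \<in> L2 \<Omega>"
  shows "integrable (lebesgue_on \<Omega>) u"
  using L2_mult_integrable[OF assms(3) L2_const[OF assms(1,2), of 1]] by simp

lemma L2_inner_commute: "L2_inner \<Omega> u v = L2_inner \<Omega> v u"
  by (simp add: L2_inner_def mult.commute)

lemma L2_inner_add_left:
  assumes "u \<in> L2 \<Omega>" "v \<in> L2 \<Omega>" "w \<in> L2 \<Omega>"
  shows "L2_inner \<Omega> (\<lambda>x. u x + v x) w = L2_inner \<Omega> u w + L2_inner \<Omega> v w"
  using assms by (simp add: L2_inner_def distrib_right L2_mult_integrable)

lemma L2_inner_scale_left: "L2_inner \<Omega> (\<lambda>x. c * u x) w = c * L2_inner \<Omega> u w"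
  by (simp add: L2_inner_def mult.assoc)

lemma L2_inner_diff_left:
  assumes "u \<in> L2 \<Omega>" "v \<in> L2 \<Omega>" "w \<in> L2 \<Omega>"
  shows "L2_inner \<Omega> (\<lambda>x. u x - v x) w = L2_inner \<Omega> u w - L2_inner \<Omega> v w"
  using assms by (simp add: L2_inner_def left_diff_distrib L2_mult_integrable)

lemma L2_inner_add_right:
  assumes "u \<in> L2 \<Omega>" "v \<in> L2 \<Omega>" "w \<in> L2 \<Omega>"
  shows "L2_inner \<Omega> w (\<lambda>x. u x + v x) = L2_inner \<Omega> w u + L2_inner \<Omega> w v"
  using L2_inner_add_left[OF assms] by (simp add: L2_inner_commute)

lemma L2_inner_scale_right: "L2_inner \<Omega> w (\<lambda>x. c * u x) = c * L2_inner \<Omega> w u"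
  using L2_inner_scale_left by (simp add: L2_inner_commute)

lemma L2_inner_diff_right:
  assumes "u \<in> L2 \<Omega>" "v \<in> L2 \<Omega>" "w \<in> L2 \<Omega>"
  shows "L2_inner \<Omega> w (\<lambda>x. u x - v x) = L2_inner \<Omega> w u - L2_inner \<Omega> w v"
  using L2_inner_diff_left[OF assms] by (simp add: L2_inner_commute)

lemma L2_inner_cong_AE:
  assumes "u \<in> L2 \<Omega>" "u' \<in> L2 \<Omega>" "w \<in> L2 \<Omega>" "AE x in lebesgue_on \<Omega>. u x = u' x"
  shows "L2_inner \<Omega> u w = L2_inner \<Omega> u' w"
  unfolding L2_inner_def using assms by (intro integral_cong_AE) (auto simp: L2_def)

lemma L2_inner_self: "L2_inner \<Omega> u u = (\<integral>x. (u x)\<^sup>2 \<partial>lebesgue_on \<Omega>)"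
  by (simp add: L2_inner_def power2_eq_square)

lemma L2_inner_self_nonneg: "0 \<le> L2_inner \<Omega> u u"
  by (simp add: L2_inner_self)

lemma L2_inner_self_add_scale:
  assumes "u \<in> L2 \<Omega>" "v \<in> L2 \<Omega>"
  shows "L2_inner \<Omega> (\<lambda>x. u x + t * v x) (\<lambda>x. u x + t * v x)
    = L2_inner \<Omega> u u + 2 * t * L2_inner \<Omega> u v + t\<^sup>2 * L2_inner \<Omega> v v"
  using assms L2_scale[OF assms(2), of t] L2_add[OF assms(1) L2_scale[OF assms(2), of t]]
  by (simp add: L2_inner_add_left L2_inner_add_right L2_inner_scale_left L2_inner_scale_right
      power2_eq_square L2_inner_commute[of \<Omega> v u] algebra_simps)

text \<open>
  A nonnegative quadratic polynomial has a nonpositive discriminant.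
\<close>

lemma quadratic_form_Cauchy_Schwarz:
  fixes a b c :: real
  assumes nonneg: "\<And>t. 0 \<le> a + 2 * t * b + t\<^sup>2 * c" and "0 \<le> c"
  shows "b\<^sup>2 \<le> a * c"
proof (cases "c = 0")
  case True
  have "b = 0"
  proof (rule ccontr)
    assume "b \<noteq> 0"
    with nonneg[of "- (a + 1) / (2 * b)"] True show False by (simp add: field_simps)
  qed
  with True show ?thesis by simp
next
  case False
  then have "0 < c" using assms(2) by simp
  have "0 \<le> (a + 2 * (- b / c) * b + (- b / c)\<^sup>2 * c) * c"
    using nonneg[of "- b / c"] \<open>0 < c\<close> by simp
  also have "\<dots> = a * c - b\<^sup>2" using \<open>0 < c\<close> by (simp add: field_simps power2_eq_square)
  finally show ?thesis by simp
qed

lemma L2_Cauchy_Schwarz: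
  assumes "u \<in> L2 \<Omega>" "v \<in> L2 \<Omega>"
  shows "(L2_inner \<Omega> u v)\<^sup>2 \<le> L2_inner \<Omega> u u * L2_inner \<Omega> v v"
proof (rule quadratic_form_Cauchy_Schwarz)
  fix t
  show "0 \<le> L2_inner \<Omega> u u + 2 * t * L2_inner \<Omega> u v + t\<^sup>2 * L2_inner \<Omega> v v"
    using L2_inner_self_nonneg[of \<Omega> "\<lambda>x. u x + t * v x"]
    unfolding L2_inner_self_add_scale[OF assms] .
qed (rule L2_inner_self_nonneg)

section \<open>Smooth functions\<close>

lemma partial_deriv_eq:
  assumes "(\<phi> has_derivative \<phi>') (at x)"
  shows "partial_deriv i \<phi> x = \<phi>' (axis i 1)"
  unfolding partial_deriv_def using frechet_derivative_at[OF assms] by simp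

lemma partial_deriv_add:
  assumes "\<phi> differentiable at x" "\<psi> differentiable at x"
  shows "partial_deriv i (\<lambda>x. \<phi> x + \<psi> x) x = partial_deriv i \<phi> x + partial_deriv i \<psi> x"
proof -
  obtain f g where d: "(\<phi> has_derivative f) (at x)" "(\<psi> has_derivative g) (at x)"
    using assms by (auto simp: differentiable_def)
  show ?thesis
    using partial_deriv_eq[OF has_derivative_add[OF d]] d[THEN partial_deriv_eq] by simp
qed

lemma partial_deriv_mult:
  assumes "\<phi> differentiable at x" "\<psi> differentiable at x"
  shows "partial_deriv i (\<lambda>x. \<phi> x * \<psi> x) x = \<phi> x * partial_deriv i \<psi> x + partial_deriv i \<phi> x * \<psi> x"
proof -
  obtain f g where d: "(\<phi> has_derivative f) (at x)" "(\<psi> has_derivative g) (at x)"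
    using assms by (auto simp: differentiable_def)
  show ?thesis
    using partial_deriv_eq[OF has_derivative_mult[OF d]] d[THEN partial_deriv_eq] by simp
qed

lemma C_class_SucD: "C_class (Suc k) \<phi> \<Longrightarrow> C_class k \<phi>"
proof (induction k arbitrary: \<phi>)
  case 0
  then show ?case
    by (auto simp: continuous_at_imp_continuous_on differentiable_imp_continuous_within)
next
  case (Suc k)
  then show ?case by (metis C_class.simps(2))
qed

lemma C_class_const: "C_class k (\<lambda>_. c)"
proof (induction k arbitrary: c)
  case (Suc k)
  have "partial_deriv i (\<lambda>_. c) = (\<lambda>_. 0)" for i
    using partial_deriv_eq[OF has_derivative_const] by fastforce
  with Suc show ?case by simp
qed simp

lemma C_class_add:
  "C_class k \<phi> \<Longrightarrow> C_class k \<psi> \<Longrightarrow> C_class k (\<lambda>x. \<phi> x + \<psi> x)"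
proof (induction k arbitrary: \<phi> \<psi>)
  case 0
  then show ?case by (simp add: continuous_on_add)
next
  case (Suc k)
  have "partial_deriv i (\<lambda>x. \<phi> x + \<psi> x) = (\<lambda>x. partial_deriv i \<phi> x + partial_deriv i \<psi> x)" for i
    using Suc.prems partial_deriv_add by fastforce
  with Suc show ?case by (simp add: differentiable_add)
qed

lemma C_class_mult:
  "C_class k \<phi> \<Longrightarrow> C_class k \<psi> \<Longrightarrow> C_class k (\<lambda>x. \<phi> x * \<psi> x)"
proof (induction k arbitrary: \<phi> \<psi>)
  case 0
  then show ?case by (simp add: continuous_on_mult)
next
  case (Suc k)
  have "partial_deriv i (\<lambda>x. \<phi> x * \<psi> x)
      = (\<lambda>x. \<phi> x * partial_deriv i \<psi> x + partial_deriv i \<phi> x * \<psi> x)" for i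
    using Suc.prems partial_deriv_mult by fastforce
  moreover have "C_class k \<phi>" "C_class k \<psi>"
    using Suc.prems by (blast intro: C_class_SucD)+
  ultimately show ?case
    using Suc by (simp add: differentiable_mult C_class_add)
qed

lemma C_class_prod:
  assumes "\<And>i. i \<in> I \<Longrightarrow> C_class k (\<phi> i)"
  shows "C_class k (\<lambda>x. \<Prod>i\<in>I. \<phi> i x)"
  using assms by (induction I rule: infinite_finite_induct) (auto intro: C_class_const C_class_mult)

text \<open>
  The sequence \<open>d\<close> lists a function of one variable together with all its derivatives; in this
  form the induction on the differentiability class needs no notation for higher derivatives.
\<close>

lemma C_class_coordinate_profile:
  fixes d :: "nat \<Rightarrow> real \<Rightarrow> real"
  assumes "\<And>n t. (d n has_real_derivative d (Suc n) t) (at t)"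
  shows "C_class k (\<lambda>x. d n (m * x $ i + c))"
proof (induction k arbitrary: n)
  case 0
  have "continuous_on UNIV (d n)"
    using assms by (auto intro!: DERIV_continuous_on)
  then show ?case
    by (auto intro!: continuous_intros continuous_on_compose2[of UNIV "d n"])
next
  case (Suc k)
  have der: "((\<lambda>x. d n (m * x $ i + c)) has_derivative
      (\<lambda>h. d (Suc n) (m * x $ i + c) * (m * h $ i))) (at x)" for x :: "real^3"
  proof -
    have "((\<lambda>x. m * x $ i + c) has_derivative (\<lambda>h. m * h $ i)) (at x)"
      by (auto intro!: derivative_eq_intros bounded_linear.has_derivative[OF bounded_linear_vec_nth]
          has_derivative_ident)
    from has_derivative_compose[OF this assms[THEN has_field_derivative_imp_has_derivative]]
    show ?thesis by (simp add: mult.commute)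
  qed
  have "partial_deriv j (\<lambda>x. d n (m * x $ i + c))
      = (\<lambda>x. (m * axis j 1 $ i) * d (Suc n) (m * x $ i + c))" for j
    using partial_deriv_eq[OF der] by (simp add: fun_eq_iff)
  moreover have "(\<lambda>x. d n (m * x $ i + c)) differentiable at x" for x :: "real^3"
    using der differentiable_def by blast
  moreover have "C_class k (\<lambda>x. (m * axis j 1 $ i) * d (Suc n) (m * x $ i + c))" for j
    by (rule C_class_mult[OF C_class_const Suc])
  ultimately show ?case unfolding C_class.simps by metis
qed

text \<open>
  The functions \<open>p (1/t) exp (-1/t)\<close>, continued by zero to \<open>t \<le> 0\<close>, are closed under
  differentiation; this is why \<open>exp (-1/t)\<close> continued by zero is smooth.
\<close>

definition flat :: "real poly \<Rightarrow> real \<Rightarrow> real" where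
  "flat p t = (if t > 0 then poly p (1 / t) * exp (- 1 / t) else 0)"

lemma tendsto_poly_times_exp_minus: "((\<lambda>y. poly p y * exp (- y)) \<longlongrightarrow> (0::real)) at_top"
proof -
  have "((\<lambda>y. \<Sum>i\<le>degree p. coeff p i * (y ^ i / exp y)) \<longlongrightarrow> (\<Sum>i\<le>degree p. coeff p i * 0)) at_top"
    by (intro tendsto_intros tendsto_power_div_exp_0)
  then show ?thesis
    by (simp add: poly_altdef sum_distrib_right exp_minus divide_inverse mult.assoc)
qed

lemma flat_has_derivative:
  "(flat p has_real_derivative flat ([:0, 0, 1:] * (p - pderiv p)) t) (at t)"
proof -
  consider "t > 0" | "t < 0" | "t = 0" by linarith
  then show ?thesis
  proof cases
    case 1
    have "((\<lambda>t. poly p (1 / t) * exp (- 1 / t)) has_real_derivative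
        flat ([:0, 0, 1:] * (p - pderiv p)) t) (at t)"
      using 1 by (auto intro!: derivative_eq_intros poly_DERIV[THEN DERIV_chain2]
          simp: flat_def field_simps power2_eq_square)
    then show ?thesis
      by (rule has_field_derivative_transform_within_open[of _ _ _ "{0<..}"]) (use 1 in \<open>auto simp: flat_def\<close>)
  next
    case 2
    have "((\<lambda>t. 0) has_real_derivative flat ([:0, 0, 1:] * (p - pderiv p)) t) (at t)"
      using 2 by (auto simp: flat_def)
    then show ?thesis
      by (rule has_field_derivative_transform_within_open[of _ _ _ "{..<0}"]) (use 2 in \<open>auto simp: flat_def\<close>)
  next
    case 3
    have "((\<lambda>h. flat p h / h) \<longlongrightarrow> 0) (at_right 0)"
    proof (rule Lim_transform_eventually)
      show "((\<lambda>h. poly ([:0, 1:] * p) (inverse h) * exp (- inverse h)) \<longlongrightarrow> 0) (at_right (0::real))"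
        by (rule filterlim_compose[OF tendsto_poly_times_exp_minus filterlim_inverse_at_top_right])
      show "\<forall>\<^sub>F h in at_right 0. poly ([:0, 1:] * p) (inverse h) * exp (- inverse h) = flat p h / h"
        using eventually_at_right_less[of 0]
        by eventually_elim (simp add: flat_def field_simps)
    qed
    moreover have "((\<lambda>h. flat p h / h) \<longlongrightarrow> 0) (at_left 0)"
    proof (rule Lim_transform_eventually)
      show "((\<lambda>h::real. 0::real) \<longlongrightarrow> 0) (at_left 0)" by simp
      have "\<forall>\<^sub>F h in at_left (0::real). h < 0" by (simp add: eventually_at_filter)
      then show "\<forall>\<^sub>F h in at_left 0. 0 = flat p h / h"
        by eventually_elim (simp add: flat_def)
    qed
    ultimately have "((\<lambda>h. flat p h / h) \<longlongrightarrow> 0) (at 0)"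
      by (simp add: filterlim_split_at)
    then show ?thesis using 3 by (simp add: DERIV_def flat_def)
  qed
qed

definition bump_profile :: "real \<Rightarrow> real" where
  "bump_profile = flat 1"

lemma bump_profile_eq: "bump_profile t = (if t > 0 then exp (- 1 / t) else 0)"
  by (simp add: bump_profile_def flat_def)

lemma C_class_bump_profile: "C_class k (\<lambda>x. bump_profile (m * x $ i + c))"
proof -
  define P where "P n = ((\<lambda>p. [:0, 0, 1:] * (p - pderiv p)) ^^ n) (1 :: real poly)" for n
  have "C_class k (\<lambda>x. flat (P 0) (m * x $ i + c))"
    by (rule C_class_coordinate_profile[of "\<lambda>n. flat (P n)"])
      (use flat_has_derivative in \<open>simp add: P_def\<close>)
  then show ?thesis by (simp add: P_def bump_profile_def)
qed

lemma bump_profile_bounds: "0 \<le> bump_profile t" "bump_profile t \<le> 1"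
  by (auto simp: bump_profile_eq)

lemma bump_profile_scaled_tendsto:
  "(\<lambda>n. bump_profile (real n * t)) \<longlonglongrightarrow> (if t > 0 then 1 else 0)"
proof (cases "t > 0")
  case True
  have "(\<lambda>n. exp (- (1 / t) * (1 / real n))) \<longlonglongrightarrow> exp (- (1 / t) * 0)"
    by (intro tendsto_intros lim_1_over_n)
  moreover have "\<forall>\<^sub>F n in sequentially. exp (- (1 / t) * (1 / real n)) = bump_profile (real n * t)"
    using eventually_gt_at_top[of 0] by eventually_elim (use True in \<open>simp add: bump_profile_eq\<close>)
  ultimately show ?thesis using True by (simp add: tendsto_cong)
next
  case False
  then have "bump_profile (real n * t) = 0" for n
    by (simp add: bump_profile_eq zero_less_mult_iff)
  with False show ?thesis by simp
qed

text \<open>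
  The functions \<open>exp (-1/(n t))\<close> tend to the indicator of \<open>t > 0\<close>; hence these products tend to the
  indicator of the open box as \<open>n\<close> grows.
\<close>

definition box_bump :: "real^3 \<Rightarrow> real^3 \<Rightarrow> nat \<Rightarrow> real^3 \<Rightarrow> real" where
  "box_bump a b n x =
    (\<Prod>i\<in>UNIV. bump_profile (real n * (x $ i - a $ i)) * bump_profile (real n * (b $ i - x $ i)))"

lemma box_bump_bounds: "0 \<le> box_bump a b n x" "box_bump a b n x \<le> 1"
  unfolding box_bump_def
  by (auto intro!: prod_nonneg prod_le_1 mult_nonneg_nonneg mult_le_one simp: bump_profile_bounds)

lemma box_bump_tendsto: "(\<lambda>n. box_bump a b n x) \<longlonglongrightarrow> indicator (box a b) x"
proof -
  have "(\<lambda>n. box_bump a b n x) \<longlonglongrightarrow>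
      (\<Prod>i\<in>UNIV. (if x $ i - a $ i > 0 then 1 else 0) * (if b $ i - x $ i > 0 then 1 else 0))"
    unfolding box_bump_def by (intro tendsto_prod tendsto_mult bump_profile_scaled_tendsto)
  also have "(\<Prod>i\<in>UNIV. (if x $ i - a $ i > 0 then 1 else 0) * (if b $ i - x $ i > 0 then 1 else 0))
      = (indicator (box a b) x :: real)"
    by (auto simp: indicator_def mem_box_cart prod_zero_iff intro!: prod.neutral) 
  finally show ?thesis .
qed

lemma box_bump_test_function:
  assumes "cbox a b \<subseteq> \<Omega>"
  shows "box_bump a b n \<in> test_functions \<Omega>"
proof -
  have "C_class k (\<lambda>x. bump_profile (real n * (x $ i - a $ i)))" for k i
    using C_class_bump_profile[of k "real n" i "- real n * a $ i"] by (simp add: right_diff_distrib)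
  moreover have "C_class k (\<lambda>x. bump_profile (real n * (b $ i - x $ i)))" for k i
    using C_class_bump_profile[of k "- real n" i "real n * b $ i"] by (simp add: right_diff_distrib)
  ultimately have smooth: "C_class k (box_bump a b n)" for k
    unfolding box_bump_def[abs_def] by (intro C_class_prod C_class_mult)
  have supp: "closure {x. box_bump a b n x \<noteq> 0} \<subseteq> cbox a b"
  proof (rule closure_minimal)
    have "a $ i \<le> x $ i \<and> x $ i \<le> b $ i" if "box_bump a b n x \<noteq> 0" for x i
    proof -
      have "bump_profile (real n * (x $ i - a $ i)) \<noteq> 0" "bump_profile (real n * (b $ i - x $ i)) \<noteq> 0"
        using that by (auto simp: box_bump_def)
      then show ?thesis by (auto simp: bump_profile_eq zero_less_mult_iff split: if_splits)
    qed
    then show "{x. box_bump a b n x \<noteq> 0} \<subseteq> cbox a b"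
      by (auto simp: mem_box_cart)
  qed (rule closed_cbox)
  have "compact (closure {x. box_bump a b n x \<noteq> 0})"
    using bounded_subset[OF bounded_cbox supp] by (auto simp: compact_eq_bounded_closed)
  then show ?thesis
    using assms smooth supp by (auto simp: test_functions_def)
qed

section \<open>The fundamental lemma of the calculus of variations\<close>

text \<open>
  Functions supported in \<open>\<Omega>\<close> may be integrated over the whole space, where translation invariance
  and Fubini's theorem are available.
\<close>

lemma lebesgue_on_lborel:
  fixes h :: "real^3 \<Rightarrow> real"
  assumes "open \<Omega>" and h: "h \<in> borel_measurable borel" and supp: "\<And>x. x \<notin> \<Omega> \<Longrightarrow> h x = 0"
  shows integral_lebesgue_on_lborel: "integral\<^sup>L (lebesgue_on \<Omega>) h = integral\<^sup>L lborel h"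
    and integrable_lebesgue_on_lborel: "integrable (lebesgue_on \<Omega>) h \<longleftrightarrow> integrable lborel h"
proof -
  have ind: "(\<lambda>x. indicator \<Omega> x *\<^sub>R h x) = h"
    using supp by (auto simp: indicator_def fun_eq_iff)
  have \<Omega>: "\<Omega> \<inter> space lebesgue \<in> sets lebesgue" using assms by simp
  show "integral\<^sup>L (lebesgue_on \<Omega>) h = integral\<^sup>L lborel h"
    unfolding integral_restrict_space[OF \<Omega>] ind using h by (intro integral_completion) simp
  show "integrable (lebesgue_on \<Omega>) h \<longleftrightarrow> integrable lborel h"
    unfolding integrable_restrict_space[OF \<Omega>] ind using h by (intro integrable_completion) simp
qed

lemma borel_measurable_lebesgue_on:
  "(h :: real^3 \<Rightarrow> real) \<in> borel_measurable borel \<Longrightarrow> h \<in> borel_measurable (lebesgue_on \<Omega>)"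
  by (intro measurable_restrict_space1 measurable_completion) simp

text \<open>
  Boxes generate the Borel sets and are stable under intersection, so by Dynkin's argument the
  integral vanishes over every Borel set; the total integral serves the complements.
\<close>

lemma AE_zero_if_box_integrals_zero:
  fixes h :: "real^3 \<Rightarrow> real"
  assumes h: "integrable lborel h"
    and boxes: "\<And>a b. (\<integral>x. indicator (box a b) x * h x \<partial>lborel) = 0"
    and total: "integral\<^sup>L lborel h = 0"
  shows "AE x in lborel. h x = 0"
proof (rule sigma_finite_measure.density_zero[OF sigma_finite_lborel h])
  let ?G = "range (\<lambda>(a, b). box a b) :: (real^3) set set"
  have int: "set_integrable lborel A h" if "A \<in> sets borel" for A
    using integrable_mult_indicator[OF _ h, of A] that by (simp add: set_integrable_def)
  have borel: "sets borel = sigma_sets UNIV ?G"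
    by (subst borel_eq_box) (auto simp: sets_measure_of)
  fix A :: "(real^3) set" assume "A \<in> sets lborel"
  then have A: "A \<in> sigma_sets UNIV ?G" by (simp add: borel)
  have "Int_stable ?G" "?G \<subseteq> Pow UNIV" by (auto simp: Int_stable_def box_Int_box)
  then show "set_lebesgue_integral lborel A h = 0"
    using A
  proof (induction rule: sigma_sets_induct_disjoint)
    case (basic A)
    then show ?case using boxes by (auto simp: set_lebesgue_integral_def)
  next
    case empty
    show ?case by (simp add: set_lebesgue_integral_def)
  next
    case (compl A)
    have "A \<in> sets borel" using compl(1) borel by simp
    have "set_lebesgue_integral lborel (UNIV - A) h
        = (\<integral>x. h x - indicator A x * h x \<partial>lborel)"
      unfolding set_lebesgue_integral_def
      by (rule Bochner_Integration.integral_cong) (auto simp: indicator_def)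
    also have "\<dots> = 0"
      using compl(2) int[OF \<open>A \<in> sets borel\<close>] h total
      by (simp add: set_lebesgue_integral_def set_integrable_def)
    finally show ?case .
  next
    case (union A)
    have "A i \<in> sets borel" for i using union(2) borel by auto
    then have "set_lebesgue_integral lborel (\<Union>i. A i) h = (\<Sum>i. set_lebesgue_integral lborel (A i) h)"
      using union(1) by (intro lebesgue_integral_countable_add int) (auto simp: disjoint_family_on_def)
    with union(3) show ?case by simp
  qed
qed

text \<open>
  The bumps on a box converge boundedly to its indicator, so orthogonality to them gives vanishing
  integrals over all open boxes whose closure lies in \<open>\<Omega>\<close>. Countably many of the closures cover \<open>\<Omega>\<close>, and
  their boundaries are null sets.
\<close>

theorem fundamental_lemma:
  assumes "open \<Omega>" "bounded \<Omega>" and g: "g \<in> L2 \<Omega>"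
    and orth: "\<And>\<phi>. \<phi> \<in> test_functions \<Omega> \<Longrightarrow> L2_inner \<Omega> g \<phi> = 0"
  shows "AE x in lebesgue_on \<Omega>. g x = 0"
proof -
  have \<Omega>: "\<Omega> \<in> sets lebesgue" using assms by simp
  have intg: "integrable (lebesgue_on \<Omega>) g" by (rule L2_integrable) fact+
  have box_zero: "(\<integral>x. indicator (box a b) x * g x \<partial>lebesgue_on \<Omega>) = 0" if "cbox a b \<subseteq> \<Omega>" for a b
  proof -
    have [measurable]: "box_bump a b n \<in> borel_measurable (lebesgue_on \<Omega>)" for n
    proof -
      have "continuous_on UNIV (box_bump a b n)"
        using box_bump_test_function[OF that, of n] unfolding test_functions_def
        by (metis (mono_tags, lifting) C_class.simps(1) mem_Collect_eq)
      then show ?thesis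
        by (intro borel_measurable_lebesgue_on borel_measurable_continuous_onI)
    qed
    have [measurable]: "g \<in> borel_measurable (lebesgue_on \<Omega>)" using g by (simp add: L2_def)
    have [measurable]: "box a b \<in> sets lebesgue" by simp
    have "(\<lambda>n. \<integral>x. box_bump a b n x * g x \<partial>lebesgue_on \<Omega>)
        \<longlonglongrightarrow> (\<integral>x. indicator (box a b) x * g x \<partial>lebesgue_on \<Omega>)"
    proof (rule integral_dominated_convergence)
      show "integrable (lebesgue_on \<Omega>) (\<lambda>x. \<bar>g x\<bar>)" using intg by simp
      show "AE x in lebesgue_on \<Omega>. (\<lambda>n. box_bump a b n x * g x) \<longlonglongrightarrow> indicator (box a b) x * g x"
        by (intro AE_I2 tendsto_mult box_bump_tendsto tendsto_const)
      show "AE x in lebesgue_on \<Omega>. norm (box_bump a b n x * g x) \<le> \<bar>g x\<bar>" for n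
        using box_bump_bounds by (auto simp: abs_mult intro!: mult_left_le_one_le)
      show "(\<lambda>x. indicator (box a b) x * g x) \<in> borel_measurable (lebesgue_on \<Omega>)"
        by (rule borel_measurable_times[OF borel_measurable_lebesgue_on L2_measurable[OF g]]) simp
    qed measurable
    moreover have "(\<integral>x. box_bump a b n x * g x \<partial>lebesgue_on \<Omega>) = 0" for n
      using orth[OF box_bump_test_function[OF that]] by (simp add: L2_inner_def mult.commute)
    ultimately show ?thesis by (simp add: LIMSEQ_const_iff)
  qed
  \<comment> \<open>The box integrals concern Borel sets; \<open>h\<close> is a Borel representative of \<open>g\<close> cut off to the box.\<close>
  have AE_box: "AE x in lebesgue. x \<in> box a b \<longrightarrow> g x = 0" if sub: "cbox a b \<subseteq> \<Omega>" for a b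
  proof -
    define h0 where "h0 x = indicator (box a b) x * g x" for x
    have h0_eq: "(\<lambda>x. indicator \<Omega> x *\<^sub>R (indicator A x * g x)) = (\<lambda>x. indicator A x * g x)" if "A \<subseteq> box a b" for A
      using that sub box_subset_cbox[of a b] by (auto simp: indicator_def fun_eq_iff)
    have "integrable (lebesgue_on \<Omega>) h0"
      unfolding h0_def
    proof (rule Bochner_Integration.integrable_bound[OF intg])
      show "(\<lambda>x. indicator (box a b) x * g x) \<in> borel_measurable (lebesgue_on \<Omega>)"
        by (rule borel_measurable_times[OF borel_measurable_lebesgue_on L2_measurable[OF g]]) simp
    qed (simp add: indicator_def)
    then have h0: "integrable lebesgue h0"
      using \<Omega> h0_eq[OF order_refl] by (simp add: integrable_restrict_space h0_def[abs_def])
    obtain h where h[measurable]: "h \<in> borel_measurable lborel" and h0h: "AE x in lborel. h0 x = h x"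
      using completion_ex_borel_measurable_real[of h0 lborel] h0 by auto
    have h0h': "AE x in lebesgue. h0 x = h x" by (rule AE_completion[OF h0h])
    have inth: "integrable lborel h"
    proof -
      have "integrable lebesgue h"
        by (rule integrable_cong_AE_imp[OF h0 measurable_completion[OF h] h0h'])
      then show ?thesis by (simp add: integrable_completion)
    qed
    have zero: "(\<integral>x. indicator (box c d) x * h x \<partial>lborel) = 0" for c d
    proof -
      obtain e f where ef: "box c d \<inter> box a b = box e f" using box_Int_box[of c d a b] by blast
      have "(\<integral>x. indicator (box c d) x * h x \<partial>lborel) = (\<integral>x. indicator (box c d) x * h x \<partial>lebesgue)"
        by (rule integral_completion[symmetric]) simp
      also have "\<dots> = (\<integral>x. indicator (box c d) x * h0 x \<partial>lebesgue)"
      proof (rule integral_cong_AE)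
        have ind: "(indicator (box c d) :: _ \<Rightarrow> real) \<in> borel_measurable lebesgue"
          by (rule borel_measurable_indicator) simp
        show "(\<lambda>x. indicator (box c d) x * h x) \<in> borel_measurable lebesgue"
          by (rule borel_measurable_times[OF ind measurable_completion[OF h]])
        show "(\<lambda>x. indicator (box c d) x * h0 x) \<in> borel_measurable lebesgue"
          by (rule borel_measurable_times[OF ind borel_measurable_integrable[OF h0]])
      qed (use h0h' in \<open>auto elim: eventually_mono\<close>)
      also have "\<dots> = (\<integral>x. indicator (box e f) x * g x \<partial>lebesgue)"
        unfolding ef[symmetric] h0_def by (simp add: indicator_inter_arith mult.assoc)
      also have "\<dots> = (\<integral>x. indicator (box e f) x * g x \<partial>lebesgue_on \<Omega>)"
        using \<Omega> h0_eq[of "box e f"] inf_le2[of "box c d" "box a b"] ef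
        by (simp add: integral_restrict_space)
      also have "\<dots> = 0"
      proof (cases "box e f = {}")
        case False
        have "closure (box e f) \<subseteq> cbox a b"
          using ef box_subset_cbox[of a b] by (intro closure_minimal closed_cbox) auto
        then show ?thesis using box_zero sub closure_box[OF False] by auto
      qed simp
      finally show ?thesis .
    qed
    have "integral\<^sup>L lborel h = 0"
    proof -
      have "integral\<^sup>L lborel h = integral\<^sup>L lebesgue h"
        by (rule integral_completion[symmetric]) simp
      also have "\<dots> = integral\<^sup>L lebesgue h0"
        by (rule integral_cong_AE[OF measurable_completion[OF h] borel_measurable_integrable[OF h0]])
          (use h0h' in \<open>auto elim: eventually_mono\<close>)
      also have "\<dots> = (\<integral>x. indicator (box a b) x * g x \<partial>lebesgue_on \<Omega>)"
        using \<Omega> h0_eq[of "box a b"] by (auto simp: integral_restrict_space h0_def[abs_def])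
      also have "\<dots> = 0" by (rule box_zero[OF sub])
      finally show ?thesis .
    qed
    from AE_zero_if_box_integrals_zero[OF inth zero this]
    have "AE x in lebesgue. h x = 0" by (rule AE_completion)
    with h0h' show ?thesis by eventually_elim (auto simp: h0_def indicator_def)
  qed
  have cover: "AE x in lebesgue. x \<in> cbox a b \<longrightarrow> g x = 0" if "cbox a b \<subseteq> \<Omega>" for a b
  proof -
    have "cbox a b - box a b \<in> null_sets lebesgue"
      using negligible_frontier_interval by (simp add: negligible_iff_null_sets)
    from AE_not_in[OF this] AE_box[OF that] show ?thesis by eventually_elim auto
  qed
  obtain \<D> where \<D>: "countable \<D>" "\<D> \<subseteq> Pow \<Omega>" "\<And>X. X \<in> \<D> \<Longrightarrow> \<exists>a b. X = cbox a b" "\<Union>\<D> = \<Omega>"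
    using open_countable_Union_open_cbox[OF \<open>open \<Omega>\<close>] by auto
  have "AE x in lebesgue. x \<in> X \<longrightarrow> g x = 0" if "X \<in> \<D>" for X
  proof -
    from \<D>(3)[OF that] obtain a b where "X = cbox a b" by auto
    with cover[of a b] \<D>(2) that show ?thesis by auto
  qed
  then have "AE x in lebesgue. \<forall>X\<in>\<D>. x \<in> X \<longrightarrow> g x = 0"
    by (intro iffD2[OF AE_ball_countable[OF \<D>(1)]] ballI)
  then have *: "AE x in lebesgue. x \<in> \<Omega> \<longrightarrow> g x = 0"
  proof (rule eventually_mono)
    fix x assume "\<forall>X\<in>\<D>. x \<in> X \<longrightarrow> g x = 0"
    then show "x \<in> \<Omega> \<longrightarrow> g x = 0" unfolding \<D>(4)[symmetric] by blast
  qed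
  have "\<Omega> \<inter> space lebesgue \<in> sets lebesgue" using \<Omega> by simp
  from iffD2[OF AE_restrict_space_iff[OF this] *] show ?thesis .
qed

section \<open>Integration by parts\<close>

lemma C1_D:
  assumes "C_class (Suc 0) \<psi>"
  shows C1_differentiable: "\<psi> differentiable at x"
    and C1_continuous: "continuous_on UNIV \<psi>"
    and C1_continuous_partial: "continuous_on UNIV (partial_deriv i \<psi>)"
  using assms C_class_SucD[of 0 \<psi>] by auto

lemma has_derivative_along_axis:
  assumes "\<psi> differentiable at (x + s *\<^sub>R axis i 1)"
  shows "((\<lambda>s. \<psi> (x + s *\<^sub>R axis i 1)) has_real_derivative partial_deriv i \<psi> (x + s *\<^sub>R axis i 1)) (at s)"
proof -
  let ?D = "frechet_derivative \<psi> (at (x + s *\<^sub>R axis i 1))"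
  have D: "(\<psi> has_derivative ?D) (at (x + s *\<^sub>R axis i 1))"
    using assms by (simp add: frechet_derivative_works)
  have line: "((\<lambda>s. x + s *\<^sub>R axis i 1) has_derivative (\<lambda>h. h *\<^sub>R axis i 1)) (at s)"
    by (auto intro!: derivative_eq_intros)
  have "((\<lambda>s. \<psi> (x + s *\<^sub>R axis i 1)) has_derivative (\<lambda>h. ?D (h *\<^sub>R axis i 1))) (at s)"
    by (rule has_derivative_compose[OF line D])
  moreover have "?D (h *\<^sub>R axis i 1) = partial_deriv i \<psi> (x + s *\<^sub>R axis i 1) * h" for h
    using linear_scale[OF has_derivative_linear[OF D]] by (simp add: partial_deriv_def)
  ultimately show ?thesis by (simp add: has_field_derivative_def)
qed

lemma partial_deriv_outside_support:
  assumes "x \<notin> closure {x. \<psi> x \<noteq> 0}"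
  shows "partial_deriv i \<psi> x = 0"
proof -
  have "(\<psi> has_derivative (\<lambda>_. 0)) (at x)"
  proof (rule has_derivative_transform_within_open[OF has_derivative_const])
    show "open (- closure {x. \<psi> x \<noteq> 0})" by auto
    show "x \<in> - closure {x. \<psi> x \<noteq> 0}" using assms by simp
    fix y assume "y \<in> - closure {x. \<psi> x \<noteq> 0}"
    then show "0 = \<psi> y" using closure_subset[of "{x. \<psi> x \<noteq> 0}"] by auto
  qed
  from partial_deriv_eq[OF this] show ?thesis by simp
qed

lemma compact_support_bounded:
  fixes h :: "real^3 \<Rightarrow> real"
  assumes "continuous_on UNIV h" "compact S" "\<And>x. x \<notin> S \<Longrightarrow> h x = 0"
  obtains C where "0 \<le> C" "\<And>x. \<bar>h x\<bar> \<le> C"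
proof -
  have "compact (h ` S)"
    using assms by (meson compact_continuous_image continuous_on_subset subset_UNIV)
  then obtain C where C: "\<And>x. x \<in> S \<Longrightarrow> \<bar>h x\<bar> \<le> C"
    using compact_imp_bounded[of "h ` S"] by (auto simp: bounded_iff)
  have "\<bar>h x\<bar> \<le> max C 0" for x
    using C[of x] assms(3)[of x] by (cases "x \<in> S") (auto simp: max.coboundedI1)
  then show thesis using that[of "max C 0"] by simp
qed

lemma compact_support_integrable:
  fixes h :: "real^3 \<Rightarrow> real"
  assumes "continuous_on UNIV h" "compact S" "\<And>x. x \<notin> S \<Longrightarrow> h x = 0"
  shows "integrable lborel h"
proof -
  obtain C where C: "0 \<le> C" "\<And>x. \<bar>h x\<bar> \<le> C" using compact_support_bounded[OF assms] by blast
  show ?thesis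
  proof (rule Bochner_Integration.integrable_bound)
    show "integrable lborel (\<lambda>x. C * indicator S x)"
      using emeasure_compact_finite[OF assms(2)] compact_imp_closed[OF assms(2)]
      by (intro integrable_mult_right integrable_real_indicator) auto
    show "h \<in> borel_measurable lborel"
      using borel_measurable_continuous_onI[OF assms(1)] by simp
    show "AE x in lborel. norm (h x) \<le> norm (C * indicator S x)"
      using C assms(3) by (auto simp: indicator_def)
  qed
qed

text \<open>
  The difference quotients of \<open>\<psi>\<close> have integral zero because Lebesgue measure is translation
  invariant, and they converge boundedly to the partial derivative.
\<close>

lemma integral_partial_deriv_zero:
  assumes C1: "C_class (Suc 0) \<psi>" and compact: "compact (closure {x. \<psi> x \<noteq> 0})"
  shows "(\<integral>x. partial_deriv i \<psi> x \<partial>lborel) = 0"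
proof -
  let ?S = "closure {x. \<psi> x \<noteq> 0}"
  define q where "q n x = (\<psi> (x + inverse (real (Suc n)) *\<^sub>R axis i 1) - \<psi> x) / inverse (real (Suc n))"
    for n x
  have zero: "\<psi> x = 0" if "x \<notin> ?S" for x
    using that closure_subset[of "{x. \<psi> x \<noteq> 0}"] by auto
  have int\<psi>: "integrable lborel \<psi>"
    by (rule compact_support_integrable[OF C1_continuous[OF C1] compact zero])
  obtain C where C: "0 \<le> C" "\<And>x. \<bar>partial_deriv i \<psi> x\<bar> \<le> C"
    using compact_support_bounded[OF C1_continuous_partial[OF C1] compact partial_deriv_outside_support]
    by blast
  obtain R where R: "\<And>x. x \<in> ?S \<Longrightarrow> norm x \<le> R"
    using compact_imp_bounded[OF compact] by (auto simp: bounded_iff)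
  have int_shift: "integrable lborel (\<lambda>x. \<psi> (x + c))"
    and shift: "(\<integral>x. \<psi> (x + c) \<partial>lborel) = integral\<^sup>L lborel \<psi>" for c
  proof -
    have meas: "\<psi> \<in> borel_measurable borel"
      using C1_continuous[OF C1] by (rule borel_measurable_continuous_onI)
    have eq: "\<psi> (x + c) = \<psi> (c + x)" for x by (simp add: add.commute)
    have "integrable (distr lborel borel ((+) c)) \<psi>" using int\<psi> by (simp add: lborel_distr_plus)
    then show "integrable lborel (\<lambda>x. \<psi> (x + c))"
      unfolding eq using meas by (subst (asm) integrable_distr_eq) auto
    have "integral\<^sup>L lborel \<psi> = integral\<^sup>L (distr lborel borel ((+) c)) \<psi>" by (simp add: lborel_distr_plus)
    also have "\<dots> = (\<integral>x. \<psi> (x + c) \<partial>lborel)"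
      unfolding eq using meas by (subst integral_distr) auto
    finally show "(\<integral>x. \<psi> (x + c) \<partial>lborel) = integral\<^sup>L lborel \<psi>" ..
  qed
  have q_zero: "integral\<^sup>L lborel (q n) = 0" for n
    unfolding q_def using int_shift int\<psi> shift by simp
  have q_bound: "\<bar>q n x\<bar> \<le> C * indicator (cball 0 (R + 1)) x" for n x
  proof -
    let ?h = "inverse (real (Suc n))"
    have h: "0 < ?h" "?h \<le> 1" by (auto simp: inverse_le_1_iff)
    show ?thesis
    proof (cases "x \<in> cball 0 (R + 1)")
      case True
      obtain s where "0 < s" "s < ?h"
        "\<psi> (x + ?h *\<^sub>R axis i 1) - \<psi> (x + 0 *\<^sub>R axis i 1)
          = (?h - 0) * partial_deriv i \<psi> (x + s *\<^sub>R axis i 1)"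
        using MVT2[OF h(1) has_derivative_along_axis[OF C1_differentiable[OF C1]]] by blast
      then have "q n x = partial_deriv i \<psi> (x + s *\<^sub>R axis i 1)"
        using h by (simp add: q_def)
      with C True show ?thesis by simp
    next
      case False
      have "norm (x + ?h *\<^sub>R axis i 1) \<ge> norm x - norm (?h *\<^sub>R axis i 1 :: real^3)"
        using norm_triangle_ineq4[of "x + ?h *\<^sub>R axis i 1" "?h *\<^sub>R axis i 1"] by simp
      moreover have "norm (?h *\<^sub>R axis i 1 :: real^3) \<le> 1" using h by simp
      moreover have "norm x > R + 1" using False by (simp add: dist_norm)
      ultimately have "\<not> norm (x + ?h *\<^sub>R axis i 1) \<le> R" "\<not> norm x \<le> R" by linarith+
      then have "x + ?h *\<^sub>R axis i 1 \<notin> ?S" "x \<notin> ?S"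
        using R[of x] R[of "x + ?h *\<^sub>R axis i 1"] by argo+
      then have "\<psi> (x + ?h *\<^sub>R axis i 1) = 0" "\<psi> x = 0" by (blast intro: zero)+
      then show ?thesis using False by (simp add: q_def)
    qed
  qed
  have "(\<lambda>n. integral\<^sup>L lborel (q n)) \<longlonglongrightarrow> (\<integral>x. partial_deriv i \<psi> x \<partial>lborel)"
  proof (rule integral_dominated_convergence)
    show "partial_deriv i \<psi> \<in> borel_measurable lborel"
      using borel_measurable_continuous_onI[OF C1_continuous_partial[OF C1]] by simp
    show "q n \<in> borel_measurable lborel" for n
      unfolding q_def[abs_def] using int_shift int\<psi>
      by (intro borel_measurable_divide borel_measurable_diff borel_measurable_integrable) auto
    show "integrable lborel (\<lambda>x. C * indicator (cball 0 (R + 1)) x)"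
      using emeasure_compact_finite[OF compact_cball]
      by (intro integrable_mult_right integrable_real_indicator) auto
    show "AE x in lborel. norm (q n x) \<le> C * indicator (cball 0 (R + 1)) x" for n
      using q_bound by simp
    show "AE x in lborel. (\<lambda>n. q n x) \<longlonglongrightarrow> partial_deriv i \<psi> x"
    proof (rule AE_I2)
      fix x
      have "((\<lambda>s. \<psi> (x + s *\<^sub>R axis i 1)) has_real_derivative partial_deriv i \<psi> (x + 0 *\<^sub>R axis i 1)) (at 0)"
        by (rule has_derivative_along_axis[OF C1_differentiable[OF C1]])
      then have lim: "((\<lambda>h. (\<psi> (x + h *\<^sub>R axis i 1) - \<psi> x) / h) \<longlongrightarrow> partial_deriv i \<psi> x) (at 0)"
        by (simp add: DERIV_def)
      show "(\<lambda>n. q n x) \<longlonglongrightarrow> partial_deriv i \<psi> x"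
        unfolding q_def
        by (rule filterlim_compose[OF lim])
          (auto simp: filterlim_at LIMSEQ_inverse_real_of_nat simp del: of_nat_Suc)
    qed
  qed
  then show ?thesis by (simp add: q_zero LIMSEQ_const_iff)
qed

section \<open>Test functions\<close>

lemma test_function_D:
  assumes "\<phi> \<in> test_functions \<Omega>"
  shows test_function_C_class: "C_class k \<phi>"
    and test_function_compact: "compact (closure {x. \<phi> x \<noteq> 0})"
    and test_function_outside: "x \<notin> \<Omega> \<Longrightarrow> \<phi> x = 0"
    and test_function_continuous: "continuous_on UNIV \<phi>"
    and test_function_borel: "\<phi> \<in> borel_measurable borel"
proof -
  show C: "C_class k \<phi>" for k using assms by (auto simp: test_functions_def)
  show "compact (closure {x. \<phi> x \<noteq> 0})" using assms by (auto simp: test_functions_def)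
  show "\<phi> x = 0" if "x \<notin> \<Omega>"
    using assms that closure_subset[of "{x. \<phi> x \<noteq> 0}"] by (auto simp: test_functions_def)
  show "continuous_on UNIV \<phi>" using C[of 0] by simp
  then show "\<phi> \<in> borel_measurable borel" by (rule borel_measurable_continuous_onI)
qed

lemma compact_closure_if_subset: "compact S \<Longrightarrow> closure A \<subseteq> S \<Longrightarrow> compact (closure A)"
  by (metis closed_closure closed_Int_compact inf.absorb1)

lemma test_functions_if_support:
  assumes "\<phi> \<in> test_functions \<Omega>" "\<And>k. C_class k \<psi>" "\<And>x. x \<notin> closure {x. \<phi> x \<noteq> 0} \<Longrightarrow> \<psi> x = 0"
  shows "\<psi> \<in> test_functions \<Omega>"
proof -
  have sub: "closure {x. \<psi> x \<noteq> 0} \<subseteq> closure {x. \<phi> x \<noteq> 0}"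
    by (rule closure_minimal) (use assms(3) in auto)
  moreover have "compact (closure {x. \<psi> x \<noteq> 0})"
    using test_function_compact[OF assms(1)] sub by (rule compact_closure_if_subset)
  ultimately show ?thesis using assms by (auto simp: test_functions_def)
qed

lemma test_functions_partial_deriv:
  assumes "\<phi> \<in> test_functions \<Omega>"
  shows "partial_deriv i \<phi> \<in> test_functions \<Omega>"
proof (rule test_functions_if_support[OF assms])
  show "C_class k (partial_deriv i \<phi>)" for k
    using test_function_C_class[OF assms, of "Suc k"] by simp
qed (rule partial_deriv_outside_support)

lemma test_functions_add_scale:
  assumes "\<phi> \<in> test_functions \<Omega>" "\<psi> \<in> test_functions \<Omega>"
  shows "(\<lambda>x. \<phi> x + c * \<psi> x) \<in> test_functions \<Omega>"
proof -
  let ?S = "closure {x. \<phi> x \<noteq> 0} \<union> closure {x. \<psi> x \<noteq> 0}"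
  have sub: "closure {x. \<phi> x + c * \<psi> x \<noteq> 0} \<subseteq> ?S"
    unfolding closure_Un[symmetric] by (rule closure_mono) auto
  have "compact ?S" using assms by (intro compact_Un test_function_compact)
  then have "compact (closure {x. \<phi> x + c * \<psi> x \<noteq> 0})"
    by (rule compact_closure_if_subset[OF _ sub])
  moreover have "C_class k (\<lambda>x. \<phi> x + c * \<psi> x)" for k
    by (intro C_class_add C_class_mult C_class_const test_function_C_class[OF assms(1)]
        test_function_C_class[OF assms(2)])
  ultimately show ?thesis using assms sub by (auto simp: test_functions_def)
qed

lemma test_functions_zero: "(\<lambda>x. 0) \<in> test_functions \<Omega>"
  by (simp add: test_functions_def C_class_const)

lemma test_function_mult_integrable:
  assumes "\<phi> \<in> test_functions \<Omega>" "continuous_on UNIV h"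
  shows "integrable lborel (\<lambda>x. h x * \<phi> x)"
proof (rule compact_support_integrable)
  show "continuous_on UNIV (\<lambda>x. h x * \<phi> x)"
    using assms test_function_continuous by (intro continuous_on_mult)
  show "h x * \<phi> x = 0" if "x \<notin> closure {x. \<phi> x \<noteq> 0}" for x
    using that closure_subset[of "{x. \<phi> x \<noteq> 0}"] by auto
qed (rule test_function_compact[OF assms(1)])

lemma test_function_L2:
  assumes "open \<Omega>" "\<phi> \<in> test_functions \<Omega>"
  shows "\<phi> \<in> L2 \<Omega>"
proof -
  have "integrable lborel (\<lambda>x. (\<phi> x)\<^sup>2)"
    using test_function_mult_integrable[OF assms(2) test_function_continuous[OF assms(2)]]
    by (simp add: power2_eq_square)
  then have "integrable (lebesgue_on \<Omega>) (\<lambda>x. (\<phi> x)\<^sup>2)"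
    using assms test_function_borel[OF assms(2)] test_function_outside[OF assms(2)]
    by (subst integrable_lebesgue_on_lborel) auto
  then show ?thesis
    using test_function_borel[OF assms(2)] by (simp add: L2_def borel_measurable_lebesgue_on)
qed

lemma L2_inner_test_lborel:
  assumes "open \<Omega>" "\<phi> \<in> test_functions \<Omega>" "\<psi> \<in> test_functions \<Omega>"
  shows "L2_inner \<Omega> \<phi> \<psi> = (\<integral>x. \<phi> x * \<psi> x \<partial>lborel)"
  unfolding L2_inner_def
  using assms test_function_borel test_function_outside
  by (intro integral_lebesgue_on_lborel) (auto intro!: borel_measurable_times)

lemma test_function_integration_by_parts:
  assumes "open \<Omega>" and \<phi>: "\<phi> \<in> test_functions \<Omega>" and \<psi>: "\<psi> \<in> test_functions \<Omega>"
  shows "L2_inner \<Omega> \<phi> (partial_deriv i \<psi>) = - L2_inner \<Omega> (partial_deriv i \<phi>) \<psi>"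
proof -
  note d\<phi> = test_functions_partial_deriv[OF \<phi>, of i] and d\<psi> = test_functions_partial_deriv[OF \<psi>, of i]
  have C: "C_class (Suc 0) (\<lambda>x. \<phi> x * \<psi> x)"
    by (intro C_class_mult test_function_C_class[OF \<phi>] test_function_C_class[OF \<psi>])
  have "closure {x. \<phi> x * \<psi> x \<noteq> 0} \<subseteq> closure {x. \<phi> x \<noteq> 0}" by (rule closure_mono) auto
  then have "compact (closure {x. \<phi> x * \<psi> x \<noteq> 0})"
    by (rule compact_closure_if_subset[OF test_function_compact[OF \<phi>]])
  from integral_partial_deriv_zero[OF C this]
  have "(\<integral>x. partial_deriv i (\<lambda>x. \<phi> x * \<psi> x) x \<partial>lborel) = 0" .
  moreover have "partial_deriv i (\<lambda>x. \<phi> x * \<psi> x) x = \<phi> x * partial_deriv i \<psi> x + partial_deriv i \<phi> x * \<psi> x" for x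
    using C1_differentiable[OF test_function_C_class[OF \<phi>]] C1_differentiable[OF test_function_C_class[OF \<psi>]]
    by (rule partial_deriv_mult)
  moreover have "integrable lborel (\<lambda>x. \<phi> x * partial_deriv i \<psi> x)"
    by (rule test_function_mult_integrable[OF d\<psi> test_function_continuous[OF \<phi>]])
  moreover have "integrable lborel (\<lambda>x. partial_deriv i \<phi> x * \<psi> x)"
    by (rule test_function_mult_integrable[OF \<psi> test_function_continuous[OF d\<phi>]])
  ultimately show ?thesis
    using L2_inner_test_lborel[OF assms(1) \<phi> d\<psi>] L2_inner_test_lborel[OF assms(1) d\<phi> \<psi>] by simp
qed

section \<open>Weak gradients and the Dirichlet form\<close>

text \<open>
  The symmetric bilinear form that polarizes the Dirichlet integral.
\<close>

definition grad_form :: "(real^3) set \<Rightarrow> (real^3 \<Rightarrow> real) \<Rightarrow> (real^3 \<Rightarrow> real) \<Rightarrow> real" where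
  "grad_form \<Omega> u v = (\<Sum>i\<in>UNIV. L2_inner \<Omega> (\<lambda>x. weak_gradient \<Omega> u x $ i) (\<lambda>x. weak_gradient \<Omega> v x $ i))"

lemma weak_gradient_unique:
  assumes "open \<Omega>" "bounded \<Omega>" and g: "is_weak_gradient \<Omega> u g" and g': "is_weak_gradient \<Omega> u g'"
  shows "AE x in lebesgue_on \<Omega>. g x $ i = g' x $ i"
proof -
  have L2: "(\<lambda>x. g x $ i) \<in> L2 \<Omega>" "(\<lambda>x. g' x $ i) \<in> L2 \<Omega>"
    using g g' by (auto simp: is_weak_gradient_def)
  have "AE x in lebesgue_on \<Omega>. g x $ i - g' x $ i = 0"
  proof (rule fundamental_lemma[OF assms(1,2)])
    fix \<phi> assume "\<phi> \<in> test_functions \<Omega>"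
    then show "L2_inner \<Omega> (\<lambda>x. g x $ i - g' x $ i) \<phi> = 0"
      using g g' L2 test_function_L2[OF assms(1)] by (simp add: L2_inner_diff_left is_weak_gradient_def)
  qed (rule L2_diff[OF L2])
  then show ?thesis by simp
qed

lemma W12_D:
  assumes "u \<in> W12 \<Omega>"
  shows W12_L2: "u \<in> L2 \<Omega>"
    and weak_gradient_L2: "(\<lambda>x. weak_gradient \<Omega> u x $ i) \<in> L2 \<Omega>"
    and is_weak_gradient: "is_weak_gradient \<Omega> u (weak_gradient \<Omega> u)"
proof -
  show "u \<in> L2 \<Omega>" using assms by (simp add: W12_def)
  have "\<exists>g. is_weak_gradient \<Omega> u g" using assms by (simp add: W12_def)
  then show "is_weak_gradient \<Omega> u (weak_gradient \<Omega> u)"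
    unfolding weak_gradient_def by (rule someI_ex)
  then show "(\<lambda>x. weak_gradient \<Omega> u x $ i) \<in> L2 \<Omega>" by (simp add: is_weak_gradient_def)
qed

lemma grad_form_eq:
  assumes "open \<Omega>" "bounded \<Omega>" "u \<in> W12 \<Omega>" "v \<in> W12 \<Omega>"
    and g: "is_weak_gradient \<Omega> u g" and k: "is_weak_gradient \<Omega> v k"
  shows "grad_form \<Omega> u v = (\<Sum>i\<in>UNIV. L2_inner \<Omega> (\<lambda>x. g x $ i) (\<lambda>x. k x $ i))"
  unfolding grad_form_def
proof (rule sum.cong)
  fix i :: 3
  have gk: "(\<lambda>x. g x $ i) \<in> L2 \<Omega>" "(\<lambda>x. k x $ i) \<in> L2 \<Omega>"
    using g k by (auto simp: is_weak_gradient_def)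
  have "L2_inner \<Omega> (\<lambda>x. weak_gradient \<Omega> u x $ i) (\<lambda>x. weak_gradient \<Omega> v x $ i)
      = L2_inner \<Omega> (\<lambda>x. g x $ i) (\<lambda>x. weak_gradient \<Omega> v x $ i)"
    by (rule L2_inner_cong_AE[OF weak_gradient_L2[OF assms(3)] gk(1) weak_gradient_L2[OF assms(4)]
          weak_gradient_unique[OF assms(1,2) is_weak_gradient[OF assms(3)] g]])
  also have "\<dots> = L2_inner \<Omega> (\<lambda>x. g x $ i) (\<lambda>x. k x $ i)"
    unfolding L2_inner_commute[of \<Omega> "\<lambda>x. g x $ i"]
    by (rule L2_inner_cong_AE[OF weak_gradient_L2[OF assms(4)] gk(2) gk(1)
          weak_gradient_unique[OF assms(1,2) is_weak_gradient[OF assms(4)] k]])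
  finally show "L2_inner \<Omega> (\<lambda>x. weak_gradient \<Omega> u x $ i) (\<lambda>x. weak_gradient \<Omega> v x $ i)
      = L2_inner \<Omega> (\<lambda>x. g x $ i) (\<lambda>x. k x $ i)" .
qed simp

lemma is_weak_gradient_add_scale:
  assumes "open \<Omega>" "u \<in> L2 \<Omega>" "v \<in> L2 \<Omega>" "is_weak_gradient \<Omega> u g" "is_weak_gradient \<Omega> v k"
  shows "is_weak_gradient \<Omega> (\<lambda>x. u x + c * v x) (\<lambda>x. g x + c *\<^sub>R k x)"
  unfolding is_weak_gradient_def
proof (intro conjI ballI allI)
  have gk: "(\<lambda>x. g x $ i) \<in> L2 \<Omega>" "(\<lambda>x. k x $ i) \<in> L2 \<Omega>" for i
    using assms by (auto simp: is_weak_gradient_def)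
  show "(\<lambda>x. (g x + c *\<^sub>R k x) $ i) \<in> L2 \<Omega>" for i
    using gk by (simp add: L2_add L2_scale)
  fix \<phi> and i :: 3 assume \<phi>: "\<phi> \<in> test_functions \<Omega>"
  have L2: "\<phi> \<in> L2 \<Omega>" "partial_deriv i \<phi> \<in> L2 \<Omega>"
    using \<phi> assms(1) by (auto intro: test_function_L2 test_functions_partial_deriv)
  show "L2_inner \<Omega> (\<lambda>x. u x + c * v x) (partial_deriv i \<phi>) = - L2_inner \<Omega> (\<lambda>x. (g x + c *\<^sub>R k x) $ i) \<phi>"
    using assms \<phi> L2 gk
    by (simp add: L2_inner_add_left L2_inner_scale_left L2_scale is_weak_gradient_def)
qed

lemma W12_add_scale:
  assumes "open \<Omega>" "u \<in> W12 \<Omega>" "v \<in> W12 \<Omega>"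
  shows "(\<lambda>x. u x + c * v x) \<in> W12 \<Omega>"
  using is_weak_gradient_add_scale[OF assms(1) W12_L2 W12_L2 is_weak_gradient is_weak_gradient]
    assms L2_add[OF W12_L2 L2_scale[OF W12_L2]]
  unfolding W12_def by blast

lemma test_function_weak_gradient:
  assumes "open \<Omega>" "\<phi> \<in> test_functions \<Omega>"
  shows "is_weak_gradient \<Omega> \<phi> (\<lambda>x. \<chi> i. partial_deriv i \<phi> x)"
  using assms test_function_integration_by_parts test_function_L2 test_functions_partial_deriv
  by (simp add: is_weak_gradient_def)

lemma test_function_W12:
  assumes "open \<Omega>" "\<phi> \<in> test_functions \<Omega>"
  shows "\<phi> \<in> W12 \<Omega>"
  using assms test_function_weak_gradient test_function_L2 by (auto simp: W12_def)

lemma grad_form_commute: "grad_form \<Omega> u v = grad_form \<Omega> v u"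
  by (simp add: grad_form_def L2_inner_commute)

lemma grad_form_add_scale_left:
  assumes "open \<Omega>" "bounded \<Omega>" "u \<in> W12 \<Omega>" "v \<in> W12 \<Omega>" "w \<in> W12 \<Omega>"
  shows "grad_form \<Omega> (\<lambda>x. u x + c * v x) w = grad_form \<Omega> u w + c * grad_form \<Omega> v w"
proof -
  have "grad_form \<Omega> (\<lambda>x. u x + c * v x) w = (\<Sum>i\<in>UNIV. L2_inner \<Omega>
      (\<lambda>x. (weak_gradient \<Omega> u x + c *\<^sub>R weak_gradient \<Omega> v x) $ i) (\<lambda>x. weak_gradient \<Omega> w x $ i))"
    using assms
    by (intro grad_form_eq W12_add_scale is_weak_gradient_add_scale is_weak_gradient W12_L2)
  also have "\<dots> = grad_form \<Omega> u w + c * grad_form \<Omega> v w"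
    using assms by (simp add: grad_form_def L2_inner_add_left L2_inner_scale_left weak_gradient_L2 L2_scale
        sum.distrib sum_distrib_left)
  finally show ?thesis .
qed

lemma dirichlet_integral_eq_grad_form:
  assumes "u \<in> W12 \<Omega>"
  shows "dirichlet_integral \<Omega> u = grad_form \<Omega> u u"
  using assms unfolding dirichlet_integral_def grad_form_def L2_inner_def inner_vec_def
  by (simp add: L2_mult_integrable weak_gradient_L2)

lemma dirichlet_integral_nonneg: "0 \<le> dirichlet_integral \<Omega> u"
  by (simp add: dirichlet_integral_def)

lemma dirichlet_integral_add_scale:
  assumes "open \<Omega>" "bounded \<Omega>" "u \<in> W12 \<Omega>" "v \<in> W12 \<Omega>"
  shows "dirichlet_integral \<Omega> (\<lambda>x. u x + t * v x)
    = dirichlet_integral \<Omega> u + 2 * t * grad_form \<Omega> u v + t\<^sup>2 * dirichlet_integral \<Omega> v"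
proof -
  note W = W12_add_scale[OF assms(1,3,4)]
  let ?w = "\<lambda>x. u x + t * v x"
  have "grad_form \<Omega> ?w ?w = grad_form \<Omega> u ?w + t * grad_form \<Omega> v ?w"
    by (rule grad_form_add_scale_left[OF assms W])
  moreover have "grad_form \<Omega> u ?w = grad_form \<Omega> u u + t * grad_form \<Omega> u v"
    using grad_form_add_scale_left[OF assms assms(3), of t]
    unfolding grad_form_commute[of \<Omega> ?w] grad_form_commute[of \<Omega> v u] .
  moreover have "grad_form \<Omega> v ?w = grad_form \<Omega> u v + t * grad_form \<Omega> v v"
    using grad_form_add_scale_left[OF assms assms(4), of t]
    unfolding grad_form_commute[of \<Omega> ?w] .
  ultimately show ?thesis
    using assms W by (simp add: dirichlet_integral_eq_grad_form power2_eq_square algebra_simps)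
qed

lemma dirichlet_form_Cauchy_Schwarz:
  assumes "open \<Omega>" "bounded \<Omega>" "u \<in> W12 \<Omega>" "v \<in> W12 \<Omega>"
  shows "(grad_form \<Omega> u v)\<^sup>2 \<le> dirichlet_integral \<Omega> u * dirichlet_integral \<Omega> v"
  using dirichlet_integral_add_scale[OF assms] dirichlet_integral_nonneg
  by (intro quadratic_form_Cauchy_Schwarz) metis+

definition laplacian :: "(real^3 \<Rightarrow> real) \<Rightarrow> real^3 \<Rightarrow> real" where
  "laplacian \<phi> x = (\<Sum>i\<in>UNIV. partial_deriv i (partial_deriv i \<phi>) x)"

lemma laplacian_L2:
  assumes "open \<Omega>" "\<phi> \<in> test_functions \<Omega>"
  shows "laplacian \<phi> \<in> L2 \<Omega>"
  unfolding laplacian_def[abs_def] using assms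
  by (intro L2_sum test_function_L2 test_functions_partial_deriv)

text \<open>
  One integration by parts turns the Dirichlet form into a pairing in \<open>L\<^sup>2\<close> that is defined for all
  of \<open>L\<^sup>2\<close>; this is where subgradients of the Dirichlet integral in \<open>L\<^sup>2\<close> come from.
\<close>

lemma grad_form_test_function:
  assumes "open \<Omega>" "bounded \<Omega>" "u \<in> W12 \<Omega>" "\<phi> \<in> test_functions \<Omega>"
  shows "grad_form \<Omega> u \<phi> = - L2_inner \<Omega> u (laplacian \<phi>)"
proof -
  have int: "integrable (lebesgue_on \<Omega>) (\<lambda>x. u x * partial_deriv i (partial_deriv i \<phi>) x)" for i
    using assms by (intro L2_mult_integrable test_function_L2 test_functions_partial_deriv W12_L2)
  have "grad_form \<Omega> u \<phi> = (\<Sum>i\<in>UNIV. L2_inner \<Omega> (\<lambda>x. weak_gradient \<Omega> u x $ i)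
      (\<lambda>x. (\<chi> i. partial_deriv i \<phi> x) $ i))"
    by (rule grad_form_eq[OF assms(1-3) test_function_W12[OF assms(1,4)]
          is_weak_gradient[OF assms(3)] test_function_weak_gradient[OF assms(1,4)]])
  also have "\<dots> = (\<Sum>i\<in>UNIV. - L2_inner \<Omega> u (partial_deriv i (partial_deriv i \<phi>)))"
    using is_weak_gradient[OF assms(3)] test_functions_partial_deriv[OF assms(4)]
    by (simp add: is_weak_gradient_def)
  also have "\<dots> = - L2_inner \<Omega> u (laplacian \<phi>)"
    using int by (simp add: L2_inner_def laplacian_def sum_distrib_left sum_negf)
  finally show ?thesis .
qed

lemma dirichlet_integral_test_function:
  assumes "open \<Omega>" "bounded \<Omega>" "\<phi> \<in> test_functions \<Omega>"
  shows "dirichlet_integral \<Omega> \<phi> = (\<Sum>i\<in>UNIV. \<integral>x. (partial_deriv i \<phi> x)\<^sup>2 \<partial>lborel)"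
proof -
  note W = test_function_W12[OF assms(1,3)] and wg = test_function_weak_gradient[OF assms(1,3)]
  show ?thesis
    using grad_form_eq[OF assms(1,2) W W wg wg] assms test_functions_partial_deriv[OF assms(3)]
    by (simp add: dirichlet_integral_eq_grad_form[OF W] L2_inner_test_lborel power2_eq_square)
qed

section \<open>The space of functions vanishing on the boundary\<close>

text \<open>
  The two parts of the norm are treated separately, because each is a quadratic form with its own
  Cauchy-Schwarz inequality.
\<close>

lemma W12_norm_tendsto_zero_iff:
  "(\<lambda>n. W12_norm \<Omega> (u n)) \<longlonglongrightarrow> 0
    \<longleftrightarrow> (\<lambda>n. L2_inner \<Omega> (u n) (u n)) \<longlonglongrightarrow> 0 \<and> (\<lambda>n. dirichlet_integral \<Omega> (u n)) \<longlonglongrightarrow> 0"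
  (is "?L \<longleftrightarrow> ?A \<and> ?B")
proof
  have nonneg: "0 \<le> L2_inner \<Omega> (u n) (u n)" "0 \<le> dirichlet_integral \<Omega> (u n)" for n
    by (rule L2_inner_self_nonneg dirichlet_integral_nonneg)+
  assume ?L
  then have "(\<lambda>n. (W12_norm \<Omega> (u n))\<^sup>2) \<longlonglongrightarrow> 0\<^sup>2" by (rule tendsto_power)
  then have sum: "(\<lambda>n. L2_inner \<Omega> (u n) (u n) + dirichlet_integral \<Omega> (u n)) \<longlonglongrightarrow> 0"
    using nonneg by (simp add: W12_norm_def)
  show "?A \<and> ?B"
  proof
    show ?A by (rule Lim_null_comparison[OF _ sum]) (simp add: nonneg)
    show ?B by (rule Lim_null_comparison[OF _ sum]) (simp add: nonneg)
  qed
next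
  assume "?A \<and> ?B"
  then have "(\<lambda>n. sqrt (L2_inner \<Omega> (u n) (u n) + dirichlet_integral \<Omega> (u n))) \<longlonglongrightarrow> sqrt (0 + 0)"
    by (intro tendsto_intros) auto
  then show ?L by (simp add: W12_norm_def)
qed

lemma W012_iff:
  "u \<in> W012 \<Omega> \<longleftrightarrow> u \<in> W12 \<Omega> \<and> (\<exists>\<phi>. (\<forall>n. \<phi> n \<in> test_functions \<Omega>) \<and>
    (\<lambda>n. L2_inner \<Omega> (\<lambda>x. \<phi> n x - u x) (\<lambda>x. \<phi> n x - u x)) \<longlonglongrightarrow> 0 \<and>
    (\<lambda>n. dirichlet_integral \<Omega> (\<lambda>x. \<phi> n x - u x)) \<longlonglongrightarrow> 0)"
  unfolding W012_def W12_norm_tendsto_zero_iff by simp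

lemma W012_W12: "u \<in> W012 \<Omega> \<Longrightarrow> u \<in> W12 \<Omega>"
  by (simp add: W012_iff)

lemma W012_L2: "u \<in> W012 \<Omega> \<Longrightarrow> u \<in> L2 \<Omega>"
  by (simp add: W012_W12 W12_L2)

lemma test_function_W012:
  assumes "open \<Omega>" "bounded \<Omega>" "\<phi> \<in> test_functions \<Omega>"
  shows "\<phi> \<in> W012 \<Omega>"
proof -
  have "dirichlet_integral \<Omega> (\<lambda>x. 0) = 0"
    using dirichlet_integral_test_function[OF assms(1,2) test_functions_zero]
      partial_deriv_eq[OF has_derivative_const] by simp
  then show ?thesis
    unfolding W012_iff using test_function_W12[OF assms(1,3)] assms(3)
    by (intro conjI exI[of _ "\<lambda>n. \<phi>"]) (auto simp: L2_inner_def)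
qed

lemma tendsto_zero_if_square_le:
  fixes m r :: "nat \<Rightarrow> real"
  assumes "\<And>n. (m n)\<^sup>2 \<le> r n" "r \<longlonglongrightarrow> 0"
  shows "m \<longlonglongrightarrow> 0"
proof -
  have "(\<lambda>n. (m n)\<^sup>2) \<longlonglongrightarrow> 0"
    using assms(2) by (rule Lim_null_comparison[rotated]) (simp add: assms(1))
  then have "(\<lambda>n. sqrt ((m n)\<^sup>2)) \<longlonglongrightarrow> sqrt 0" by (rule tendsto_real_sqrt)
  then show ?thesis by (simp add: tendsto_rabs_zero_iff)
qed

lemma W012_add_scale:
  assumes "open \<Omega>" "bounded \<Omega>" "u \<in> W012 \<Omega>" "v \<in> W012 \<Omega>"
  shows "(\<lambda>x. u x + c * v x) \<in> W012 \<Omega>"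
proof -
  obtain \<phi> \<psi> where
    \<phi>: "\<And>n. \<phi> n \<in> test_functions \<Omega>" "(\<lambda>n. L2_inner \<Omega> (\<lambda>x. \<phi> n x - u x) (\<lambda>x. \<phi> n x - u x)) \<longlonglongrightarrow> 0"
      "(\<lambda>n. dirichlet_integral \<Omega> (\<lambda>x. \<phi> n x - u x)) \<longlonglongrightarrow> 0" and
    \<psi>: "\<And>n. \<psi> n \<in> test_functions \<Omega>" "(\<lambda>n. L2_inner \<Omega> (\<lambda>x. \<psi> n x - v x) (\<lambda>x. \<psi> n x - v x)) \<longlonglongrightarrow> 0"
      "(\<lambda>n. dirichlet_integral \<Omega> (\<lambda>x. \<psi> n x - v x)) \<longlonglongrightarrow> 0"
    using assms by (auto simp: W012_iff)
  let ?a = "\<lambda>n x. \<phi> n x - u x" and ?b = "\<lambda>n x. \<psi> n x - v x"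
  have W: "u \<in> W12 \<Omega>" "v \<in> W12 \<Omega>" using assms by (auto simp: W012_W12)
  have aW: "?a n \<in> W12 \<Omega>" for n
    using W12_add_scale[OF assms(1) test_function_W12[OF assms(1) \<phi>(1)] W(1), of n "-1"] by simp
  have bW: "?b n \<in> W12 \<Omega>" for n
    using W12_add_scale[OF assms(1) test_function_W12[OF assms(1) \<psi>(1)] W(2), of n "-1"] by simp
  have eq: "(\<lambda>x. (\<phi> n x + c * \<psi> n x) - (u x + c * v x)) = (\<lambda>x. ?a n x + c * ?b n x)" for n
    by (simp add: fun_eq_iff algebra_simps)
  have "(\<lambda>n. L2_inner \<Omega> (?a n) (?b n)) \<longlonglongrightarrow> 0"
    by (rule tendsto_zero_if_square_le[OF L2_Cauchy_Schwarz[OF W12_L2[OF aW] W12_L2[OF bW]]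
          tendsto_mult_zero[OF \<phi>(2) \<psi>(2)]])
  then have "(\<lambda>n. L2_inner \<Omega> (?a n) (?a n) + 2 * c * L2_inner \<Omega> (?a n) (?b n)
      + c\<^sup>2 * L2_inner \<Omega> (?b n) (?b n)) \<longlonglongrightarrow> 0 + 2 * c * 0 + c\<^sup>2 * 0"
    by (intro tendsto_intros \<phi> \<psi>)
  then have 1: "(\<lambda>n. L2_inner \<Omega> (\<lambda>x. ?a n x + c * ?b n x) (\<lambda>x. ?a n x + c * ?b n x)) \<longlonglongrightarrow> 0"
    using aW bW by (simp add: L2_inner_self_add_scale W12_L2)
  have "(\<lambda>n. grad_form \<Omega> (?a n) (?b n)) \<longlonglongrightarrow> 0"
    by (rule tendsto_zero_if_square_le[OF dirichlet_form_Cauchy_Schwarz[OF assms(1,2) aW bW]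
          tendsto_mult_zero[OF \<phi>(3) \<psi>(3)]])
  then have "(\<lambda>n. dirichlet_integral \<Omega> (?a n) + 2 * c * grad_form \<Omega> (?a n) (?b n)
      + c\<^sup>2 * dirichlet_integral \<Omega> (?b n)) \<longlonglongrightarrow> 0 + 2 * c * 0 + c\<^sup>2 * 0"
    by (intro tendsto_intros \<phi> \<psi>)
  then have 2: "(\<lambda>n. dirichlet_integral \<Omega> (\<lambda>x. ?a n x + c * ?b n x)) \<longlonglongrightarrow> 0"
    using aW bW assms(1,2) by (simp add: dirichlet_integral_add_scale)
  show ?thesis
    unfolding W012_iff using W12_add_scale[OF assms(1) W] test_functions_add_scale[OF \<phi>(1) \<psi>(1)] 1 2
    by (intro conjI exI[of _ "\<lambda>n x. \<phi> n x + c * \<psi> n x"]) (auto simp: eq)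
qed

section \<open>The Poincare inequality\<close>

lemma C_class_coordinate: "C_class k (\<lambda>x. x $ i)"
proof -
  define d :: "nat \<Rightarrow> real \<Rightarrow> real"
    where "d n t = (if n = 0 then t else if n = 1 then 1 else 0)" for n t
  have "d n = (if n = 0 then (\<lambda>t. t) else if n = 1 then (\<lambda>_. 1) else (\<lambda>_. 0))" for n
    by (auto simp: d_def fun_eq_iff)
  then have "(d n has_real_derivative d (Suc n) t) (at t)" for n t
    by (auto simp: d_def)
  then have "C_class k (\<lambda>x. d 0 (1 * x $ i + 0))" by (rule C_class_coordinate_profile)
  then show ?thesis by (simp add: d_def)
qed

lemma partial_deriv_coordinate: "partial_deriv i (\<lambda>x. x $ i) x = 1"
  by (subst partial_deriv_eq[OF bounded_linear.has_derivative[OF bounded_linear_vec_nth has_derivative_ident]])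
    (simp add: axis_def)

text \<open>
  The derivative of \<open>x\<^sub>1 \<phi>\<^sup>2\<close> in the first direction integrates to zero, whence
  \<open>\<integral> \<phi>\<^sup>2 = - 2 \<integral> x\<^sub>1 \<phi> \<partial>\<^sub>1\<phi> \<le> 1/2 \<integral> \<phi>\<^sup>2 + 2 R\<^sup>2 \<integral> (\<partial>\<^sub>1\<phi>)\<^sup>2\<close>.
\<close>

lemma Poincare_test_function:
  assumes "open \<Omega>" "bounded \<Omega>" and \<phi>: "\<phi> \<in> test_functions \<Omega>" and R: "\<And>x. x \<in> \<Omega> \<Longrightarrow> norm x \<le> R"
  shows "L2_inner \<Omega> \<phi> \<phi> \<le> 4 * R\<^sup>2 * dirichlet_integral \<Omega> \<phi>"
proof -
  let ?d = "partial_deriv 1 \<phi>"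
  note d\<phi> = test_functions_partial_deriv[OF \<phi>, of 1]
  note cont = test_function_continuous[OF \<phi>] test_function_continuous[OF d\<phi>]
  let ?\<psi> = "\<lambda>x. x $ 1 * (\<phi> x * \<phi> x)"
  have C: "C_class (Suc 0) ?\<psi>"
    by (intro C_class_mult C_class_coordinate test_function_C_class[OF \<phi>])
  have "closure {x. ?\<psi> x \<noteq> 0} \<subseteq> closure {x. \<phi> x \<noteq> 0}" by (rule closure_mono) auto
  then have cpt: "compact (closure {x. ?\<psi> x \<noteq> 0})"
    by (rule compact_closure_if_subset[OF test_function_compact[OF \<phi>]])
  have diff: "\<phi> differentiable at x" for x by (rule C1_differentiable[OF test_function_C_class[OF \<phi>]])
  have der: "partial_deriv 1 ?\<psi> x = \<phi> x * \<phi> x + 2 * x $ 1 * \<phi> x * ?d x" for x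
    using partial_deriv_mult[OF C1_differentiable[OF C_class_coordinate[of _ 1]] differentiable_mult[OF diff diff], where i=1]
      partial_deriv_mult[OF diff diff, where i=1]
    by (simp add: partial_deriv_coordinate algebra_simps)
  have i1: "integrable lborel (\<lambda>x. \<phi> x * \<phi> x)"
    by (rule test_function_mult_integrable[OF \<phi> cont(1)])
  have i2: "integrable lborel (\<lambda>x. (2 * x $ 1 * ?d x) * \<phi> x)"
    by (rule test_function_mult_integrable[OF \<phi>]) (intro continuous_intros cont)
  have i3: "integrable lborel (\<lambda>x. ?d x * ?d x)"
    by (rule test_function_mult_integrable[OF d\<phi> cont(2)])
  have "0 = (\<integral>x. \<phi> x * \<phi> x + (2 * x $ 1 * ?d x) * \<phi> x \<partial>lborel)"
    using integral_partial_deriv_zero[OF C cpt, of 1] unfolding der by (simp add: mult_ac)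
  then have "(\<integral>x. \<phi> x * \<phi> x \<partial>lborel) = (\<integral>x. - ((2 * x $ 1 * ?d x) * \<phi> x) \<partial>lborel)"
    using i1 i2 by simp
  also have "\<dots> \<le> (\<integral>x. 1 / 2 * (\<phi> x * \<phi> x) + 2 * R\<^sup>2 * (?d x * ?d x) \<partial>lborel)"
  proof (rule integral_mono)
    fix x
    show "- ((2 * x $ 1 * ?d x) * \<phi> x) \<le> 1 / 2 * (\<phi> x * \<phi> x) + 2 * R\<^sup>2 * (?d x * ?d x)"
    proof (cases "x \<in> \<Omega>")
      case True
      have "\<bar>x $ 1\<bar> \<le> R" using R[OF True] component_le_norm_cart[of x 1] by linarith
      then have "(x $ 1)\<^sup>2 \<le> R\<^sup>2" by (metis abs_ge_zero power2_abs power_mono)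
      then have "(x $ 1)\<^sup>2 * (?d x)\<^sup>2 \<le> R\<^sup>2 * (?d x)\<^sup>2" by (rule mult_right_mono) simp
      moreover have "0 \<le> (\<phi> x + 2 * (x $ 1 * ?d x))\<^sup>2" by simp
      ultimately show ?thesis by (simp add: power2_eq_square algebra_simps)
    qed (simp add: test_function_outside[OF \<phi>])
  qed (use i1 i2 i3 in auto)
  also have "\<dots> = 1 / 2 * (\<integral>x. \<phi> x * \<phi> x \<partial>lborel) + 2 * R\<^sup>2 * (\<integral>x. ?d x * ?d x \<partial>lborel)"
    using i1 i3 by simp
  finally have "(\<integral>x. \<phi> x * \<phi> x \<partial>lborel) \<le> 4 * R\<^sup>2 * (\<integral>x. (?d x)\<^sup>2 \<partial>lborel)"
    by (simp add: power2_eq_square)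
  also have "\<dots> \<le> 4 * R\<^sup>2 * dirichlet_integral \<Omega> \<phi>"
    unfolding dirichlet_integral_test_function[OF assms(1-3)]
    by (intro mult_left_mono member_le_sum) auto
  finally show ?thesis by (simp add: L2_inner_test_lborel[OF assms(1) \<phi> \<phi>])
qed

section \<open>Fourth powers of test functions\<close>

definition vec3 :: "real \<Rightarrow> real \<Rightarrow> real \<Rightarrow> real^3" where
  "vec3 x y z = x *\<^sub>R axis 1 1 + y *\<^sub>R axis 2 1 + z *\<^sub>R axis 3 1"

lemma vec3_nth [simp]: "vec3 x y z $ 1 = x" "vec3 x y z $ 2 = y" "vec3 x y z $ 3 = z"
  by (simp_all add: vec3_def axis_def)

lemma vec3_lines:
  "vec3 x y z = vec3 0 y z + x *\<^sub>R axis 1 1"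
  "vec3 x y z = vec3 x 0 z + y *\<^sub>R axis 2 1"
  "vec3 x y z = vec3 x y 0 + z *\<^sub>R axis 3 1"
  by (simp_all add: vec3_def)

lemma measurable_vec3 [measurable (raw)]:
  assumes "f \<in> borel_measurable M" "g \<in> borel_measurable M" "h \<in> borel_measurable M"
  shows "(\<lambda>p. vec3 (f p) (g p) (h p)) \<in> borel_measurable M"
  unfolding vec3_def using assms by (intro borel_measurable_add borel_measurable_scaleR) auto

lemma lborel_vec3:
  "lborel = distr (lborel \<Otimes>\<^sub>M (lborel \<Otimes>\<^sub>M lborel)) borel (\<lambda>p. vec3 (fst p) (fst (snd p)) (snd (snd p)))"
  (is "_ = distr ?N borel ?V")
proof (rule lborel_eqI)
  fix l u :: "real^3" assume le: "\<And>b. b \<in> Basis \<Longrightarrow> l \<bullet> b \<le> u \<bullet> b"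
  have le': "l $ i \<le> u $ i" for i
    using le[of "axis i 1"] by (auto simp: inner_axis Basis_vec_def)
  have V: "?V \<in> ?N \<rightarrow>\<^sub>M borel" by measurable
  have "?V -` box l u \<inter> space ?N
      = {l $ 1 <..< u $ 1} \<times> ({l $ 2 <..< u $ 2} \<times> {l $ 3 <..< u $ 3})"
    by (auto simp: mem_box_cart forall_3 space_pair_measure)
  moreover have times: "emeasure ?N (A \<times> (B \<times> C)) = emeasure lborel A * (emeasure lborel B * emeasure lborel C)"
    if "A \<in> sets borel" "B \<in> sets borel" "C \<in> sets borel" for A B C
  proof -
    have "B \<times> C \<in> sets (lborel \<Otimes>\<^sub>M lborel)" using that by simp
    then have "emeasure ?N (A \<times> (B \<times> C)) = emeasure lborel A * emeasure (lborel \<Otimes>\<^sub>M lborel) (B \<times> C)"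
      unfolding lborel_prod[where 'a=real and 'b=real] using that
      by (intro lborel.emeasure_pair_measure_Times) simp_all
    also have "emeasure (lborel \<Otimes>\<^sub>M lborel) (B \<times> C) = emeasure lborel B * emeasure lborel C"
      using that by (intro lborel.emeasure_pair_measure_Times) simp_all
    finally show ?thesis .
  qed
  ultimately have "emeasure (distr ?N borel ?V) (box l u)
      = emeasure lborel {l $ 1 <..< u $ 1} * (emeasure lborel {l $ 2 <..< u $ 2} * emeasure lborel {l $ 3 <..< u $ 3})"
    using V by (simp only: emeasure_distr borel_open open_box) (rule times, simp_all)
  also have "\<dots> = ennreal (u $ 1 - l $ 1) * (ennreal (u $ 2 - l $ 2) * ennreal (u $ 3 - l $ 3))"
    by (simp only: emeasure_lborel_Ioo le')
  also have "\<dots> = ennreal ((u $ 1 - l $ 1) * ((u $ 2 - l $ 2) * (u $ 3 - l $ 3)))"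
    using le' by (simp only: ennreal_mult diff_ge_0_iff_ge mult_nonneg_nonneg)
  also have "(u $ 1 - l $ 1) * ((u $ 2 - l $ 2) * (u $ 3 - l $ 3)) = (\<Prod>i\<in>UNIV. u $ i - l $ i)"
    unfolding UNIV_3 by simp
  also have "(\<Prod>i\<in>UNIV. u $ i - l $ i) = (\<Prod>b\<in>Basis. (u - l) \<bullet> b)"
  proof -
    have Basis: "(Basis :: (real^3) set) = range (\<lambda>i. axis i 1)" by (auto simp: Basis_vec_def)
    have inj: "inj (\<lambda>i. axis i 1 :: real^3)" by (simp add: inj_def axis_eq_axis)
    show ?thesis unfolding Basis prod.reindex[OF inj] by (simp add: inner_axis)
  qed
  finally show "emeasure (distr ?N borel ?V) (box l u) = (\<Prod>b\<in>Basis. (u - l) \<bullet> b)" .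
qed simp

lemma nn_integral_vec3:
  assumes [measurable]: "f \<in> borel_measurable (borel :: (real^3) measure)"
  shows "(\<integral>\<^sup>+p. f p \<partial>lborel) = (\<integral>\<^sup>+x. \<integral>\<^sup>+y. \<integral>\<^sup>+z. f (vec3 x y z) \<partial>lborel \<partial>lborel \<partial>lborel)"
proof -
  have [measurable]: "f \<in> borel_measurable lborel" by simp
  have meas: "(\<lambda>p. f (vec3 (fst p) (fst (snd p)) (snd (snd p))))
      \<in> borel_measurable (lborel \<Otimes>\<^sub>M (lborel \<Otimes>\<^sub>M lborel))"
    by measurable
  have "(\<integral>\<^sup>+p. f p \<partial>lborel) = (\<integral>\<^sup>+p. f (vec3 (fst p) (fst (snd p)) (snd (snd p)))
      \<partial>(lborel \<Otimes>\<^sub>M (lborel \<Otimes>\<^sub>M lborel)))"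
    by (subst lborel_vec3) (simp add: nn_integral_distr)
  also have "\<dots> = (\<integral>\<^sup>+x. \<integral>\<^sup>+q. f (vec3 x (fst q) (snd q)) \<partial>(lborel \<Otimes>\<^sub>M lborel) \<partial>lborel)"
    using meas unfolding lborel_prod[where 'a=real and 'b=real]
    by (subst lborel.nn_integral_fst[symmetric]) simp_all
  also have "\<dots> = (\<integral>\<^sup>+x. \<integral>\<^sup>+y. \<integral>\<^sup>+z. f (vec3 x y z) \<partial>lborel \<partial>lborel \<partial>lborel)"
    by (subst lborel.nn_integral_fst[symmetric]) simp_all
  finally show ?thesis .
qed

text \<open>
  On a line \<open>\<phi>\<^sup>2\<close> vanishes far away, so it is recovered by integrating its derivative \<open>2 \<phi> \<partial>\<^sub>i\<phi>\<close>.
\<close>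

lemma square_le_line_integral:
  assumes \<phi>: "\<phi> \<in> test_functions \<Omega>"
  shows "ennreal ((\<phi> (p + t *\<^sub>R axis i 1))\<^sup>2)
    \<le> (\<integral>\<^sup>+s. ennreal \<bar>2 * \<phi> (p + s *\<^sub>R axis i 1) * partial_deriv i \<phi> (p + s *\<^sub>R axis i 1)\<bar> \<partial>lborel)"
proof -
  let ?l = "\<lambda>s. p + s *\<^sub>R axis i 1"
  let ?f = "\<lambda>s. 2 * \<phi> (?l s) * partial_deriv i \<phi> (?l s)"
  have "bounded {x. \<phi> x \<noteq> 0}"
    by (rule bounded_subset[OF compact_imp_bounded[OF test_function_compact[OF \<phi>]] closure_subset])
  then obtain R where R: "\<And>x. \<phi> x \<noteq> 0 \<Longrightarrow> norm x \<le> R"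
    by (auto simp: bounded_iff)
  \<comment> \<open>A point of the line before \<open>t\<close> and outside the ball of radius \<open>R\<close> that contains the support.\<close>
  define a where "a = min t (- (\<bar>R\<bar> + norm p + 1))"
  have at: "a \<le> t" by (simp add: a_def)
  have "norm (?l a) \<ge> norm (a *\<^sub>R axis i 1 :: real^3) - norm p"
    using norm_triangle_ineq4[of "?l a" p] by simp
  moreover have "norm (a *\<^sub>R axis i 1 :: real^3) \<ge> \<bar>R\<bar> + norm p + 1"
    by (simp add: a_def)
  ultimately have "\<not> norm (?l a) \<le> R" by linarith
  then have zero: "\<phi> (?l a) = 0" using R[of "?l a"] by argo
  have der: "((\<lambda>s. (\<phi> (?l s))\<^sup>2) has_real_derivative ?f s) (at s)" for s
    by (rule DERIV_cong[OF DERIV_power[OF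
          has_derivative_along_axis[OF C1_differentiable[OF test_function_C_class[OF \<phi>]]]]]) simp
  have line: "continuous_on UNIV (\<lambda>s. h (?l s))" if "continuous_on UNIV h" for h :: "real^3 \<Rightarrow> real"
    by (rule continuous_on_compose2[OF that]) (auto intro!: continuous_intros)
  have cont: "continuous_on UNIV ?f"
    by (intro continuous_on_mult continuous_on_const line test_function_continuous[OF \<phi>]
        test_function_continuous[OF test_functions_partial_deriv[OF \<phi>]])
  have bochner: "has_bochner_integral lborel (\<lambda>s. ?f s * indicator {a..t} s) ((\<phi> (?l t))\<^sup>2 - (\<phi> (?l a))\<^sup>2)"
    using at der cont
    by (intro has_bochner_integral_FTC_Icc_real) (auto simp: continuous_on_eq_continuous_at)
  then have int: "integrable lborel (\<lambda>s. ?f s * indicator {a..t} s)"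
    and eq: "(\<integral>s. ?f s * indicator {a..t} s \<partial>lborel) = (\<phi> (?l t))\<^sup>2"
    by (simp_all add: has_bochner_integral_iff zero)
  have "ennreal ((\<phi> (?l t))\<^sup>2) \<le> ennreal (\<integral>s. \<bar>?f s * indicator {a..t} s\<bar> \<partial>lborel)"
    unfolding eq[symmetric] by (intro ennreal_leI integral_mono integrable_abs int) auto
  also have "\<dots> = (\<integral>\<^sup>+s. ennreal \<bar>?f s * indicator {a..t} s\<bar> \<partial>lborel)"
    by (intro nn_integral_eq_integral[symmetric] integrable_abs int) auto
  also have "\<dots> \<le> (\<integral>\<^sup>+s. ennreal \<bar>?f s\<bar> \<partial>lborel)"
    by (intro nn_integral_mono ennreal_leI) (auto simp: indicator_def)
  finally show ?thesis .
qed

lemma ennreal_mult_le_squares: "(a :: ennreal) * b \<le> a\<^sup>2 + b\<^sup>2"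
proof (cases "a \<le> b")
  case True
  then have "a * b \<le> b * b" by (rule mult_right_mono) simp
  also have "\<dots> \<le> a\<^sup>2 + b\<^sup>2" by (simp add: power2_eq_square)
  finally show ?thesis .
next
  case False
  then have "a * b \<le> a * a" by (intro mult_left_mono) auto
  also have "\<dots> \<le> a\<^sup>2 + b\<^sup>2" by (simp add: power2_eq_square)
  finally show ?thesis .
qed

text \<open>
  On a slice \<open>x = const\<close> bound one factor \<open>\<phi>\<^sup>2\<close> by an integral along the second axis, which depends
  only on the third coordinate, and the other by an integral along the third axis, which depends only
  on the second coordinate. The integral of the product over the slice then factors into
  \<open>A\<^sub>2(x) A\<^sub>3(x)\<close> with \<open>A\<^sub>i = \<integral> |2 \<phi> \<partial>\<^sub>i\<phi>|\<close>, and Cauchy-Schwarz gives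
  \<open>A\<^sub>i\<^sup>2 \<le> 4 (\<integral> \<phi>\<^sup>2) (\<integral> (\<partial>\<^sub>i\<phi>)\<^sup>2)\<close> on the slice. The slice integral of \<open>\<phi>\<^sup>2\<close> is bounded uniformly in
  \<open>x\<close> by an integral along the first axis.
\<close>

lemma fourth_power_slicing:
  assumes \<phi>: "\<phi> \<in> test_functions \<Omega>"
  shows "(\<integral>\<^sup>+p. ennreal (\<phi> p ^ 4) \<partial>lborel)
    \<le> 4 * (\<integral>\<^sup>+p. ennreal \<bar>2 * \<phi> p * partial_deriv 1 \<phi> p\<bar> \<partial>lborel)
      * ((\<integral>\<^sup>+p. ennreal ((partial_deriv 2 \<phi> p)\<^sup>2) \<partial>lborel) + (\<integral>\<^sup>+p. ennreal ((partial_deriv 3 \<phi> p)\<^sup>2) \<partial>lborel))"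
proof -
  have [measurable]: "\<phi> \<in> borel_measurable borel" by (rule test_function_borel[OF \<phi>])
  have [measurable]: "partial_deriv i \<phi> \<in> borel_measurable borel" for i
    by (rule test_function_borel[OF test_functions_partial_deriv[OF \<phi>]])
  interpret Q: pair_sigma_finite "lborel :: real measure" "lborel \<Otimes>\<^sub>M lborel :: (real \<times> real) measure"
    by (simp add: pair_sigma_finite_def sigma_finite_lborel lborel_prod)
  define m where "m i p = ennreal \<bar>2 * \<phi> p * partial_deriv i \<phi> p\<bar>" for i p
  define e where "e i p = ennreal ((partial_deriv i \<phi> p)\<^sup>2)" for i p
  have [measurable]: "m i \<in> borel_measurable borel" "e i \<in> borel_measurable borel" for i
    unfolding m_def[abs_def] e_def[abs_def] by measurable
  define T where "T = (\<integral>\<^sup>+p. m 1 p \<partial>lborel)"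
  define N where "N x = (\<integral>\<^sup>+q. ennreal ((\<phi> (vec3 x (fst q) (snd q)))\<^sup>2) \<partial>(lborel \<Otimes>\<^sub>M lborel))" for x
  define A where "A i x = (\<integral>\<^sup>+q. m i (vec3 x (fst q) (snd q)) \<partial>(lborel \<Otimes>\<^sub>M lborel))" for i x
  define D where "D i x = (\<integral>\<^sup>+q. e i (vec3 x (fst q) (snd q)) \<partial>(lborel \<Otimes>\<^sub>M lborel))" for i x
  have line: "ennreal ((\<phi> (vec3 x y z))\<^sup>2) \<le> (\<integral>\<^sup>+s. m 1 (vec3 s y z) \<partial>lborel)"
    "ennreal ((\<phi> (vec3 x y z))\<^sup>2) \<le> (\<integral>\<^sup>+s. m 2 (vec3 x s z) \<partial>lborel)"
    "ennreal ((\<phi> (vec3 x y z))\<^sup>2) \<le> (\<integral>\<^sup>+s. m 3 (vec3 x y s) \<partial>lborel)" for x y z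
  proof -
    show "ennreal ((\<phi> (vec3 x y z))\<^sup>2) \<le> (\<integral>\<^sup>+s. m 1 (vec3 s y z) \<partial>lborel)"
      using square_le_line_integral[OF \<phi>, of "vec3 0 y z" x 1] vec3_lines(1)[symmetric]
      by (simp add: m_def)
    show "ennreal ((\<phi> (vec3 x y z))\<^sup>2) \<le> (\<integral>\<^sup>+s. m 2 (vec3 x s z) \<partial>lborel)"
      using square_le_line_integral[OF \<phi>, of "vec3 x 0 z" y 2] vec3_lines(2)[symmetric]
      by (simp add: m_def)
    show "ennreal ((\<phi> (vec3 x y z))\<^sup>2) \<le> (\<integral>\<^sup>+s. m 3 (vec3 x y s) \<partial>lborel)"
      using square_le_line_integral[OF \<phi>, of "vec3 x y 0" z 3] vec3_lines(3)[symmetric]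
      by (simp add: m_def)
  qed
  have NT: "N x \<le> T" for x
  proof -
    have "N x \<le> (\<integral>\<^sup>+q. \<integral>\<^sup>+s. m 1 (vec3 s (fst q) (snd q)) \<partial>lborel \<partial>(lborel \<Otimes>\<^sub>M lborel))"
      unfolding N_def by (intro nn_integral_mono line)
    also have "\<dots> = (\<integral>\<^sup>+s. \<integral>\<^sup>+q. m 1 (vec3 s (fst q) (snd q)) \<partial>(lborel \<Otimes>\<^sub>M lborel) \<partial>lborel)"
      by (rule Q.Fubini') measurable
    also have "\<dots> = T"
      unfolding T_def by (subst nn_integral_vec3) (simp_all add: lborel.nn_integral_fst[symmetric])
    finally show ?thesis .
  qed
  have A_sq: "(A i x)\<^sup>2 \<le> 4 * (T * D i x)" for i x
  proof -
    have "A i x = (\<integral>\<^sup>+q. ennreal (2 * \<bar>\<phi> (vec3 x (fst q) (snd q))\<bar>)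
        * ennreal \<bar>partial_deriv i \<phi> (vec3 x (fst q) (snd q))\<bar> \<partial>(lborel \<Otimes>\<^sub>M lborel))"
      unfolding A_def m_def by (simp add: ennreal_mult[symmetric] abs_mult del: ennreal_mult'')
    also have "\<dots>\<^sup>2 \<le> (\<integral>\<^sup>+q. (ennreal (2 * \<bar>\<phi> (vec3 x (fst q) (snd q))\<bar>))\<^sup>2 \<partial>(lborel \<Otimes>\<^sub>M lborel))
        * (\<integral>\<^sup>+q. (ennreal \<bar>partial_deriv i \<phi> (vec3 x (fst q) (snd q))\<bar>)\<^sup>2 \<partial>(lborel \<Otimes>\<^sub>M lborel))"
      by (rule Cauchy_Schwarz_nn_integral) measurable
    also have "(\<integral>\<^sup>+q. (ennreal (2 * \<bar>\<phi> (vec3 x (fst q) (snd q))\<bar>))\<^sup>2 \<partial>(lborel \<Otimes>\<^sub>M lborel)) = 4 * N x"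
      unfolding N_def by (subst nn_integral_cmult[symmetric])
        (simp_all add: ennreal_power power_mult_distrib ennreal_mult)
    also have "(\<integral>\<^sup>+q. (ennreal \<bar>partial_deriv i \<phi> (vec3 x (fst q) (snd q))\<bar>)\<^sup>2 \<partial>(lborel \<Otimes>\<^sub>M lborel)) = D i x"
      unfolding D_def e_def by (simp add: ennreal_power)
    also have "4 * N x * D i x \<le> 4 * (T * D i x)"
      using mult_right_mono[OF NT[of x], of "D i x"] by (simp add: mult.assoc mult_left_mono)
    finally show ?thesis .
  qed
  have slice: "(\<integral>\<^sup>+y. \<integral>\<^sup>+z. ennreal (\<phi> (vec3 x y z) ^ 4) \<partial>lborel \<partial>lborel) \<le> 4 * T * (D 2 x + D 3 x)" for x
  proof -
    have "ennreal (\<phi> (vec3 x y z) ^ 4)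
        \<le> (\<integral>\<^sup>+s. m 2 (vec3 x s z) \<partial>lborel) * (\<integral>\<^sup>+s. m 3 (vec3 x y s) \<partial>lborel)" for y z
    proof -
      have "\<phi> (vec3 x y z) ^ 4 = (\<phi> (vec3 x y z))\<^sup>2 * (\<phi> (vec3 x y z))\<^sup>2"
        by (simp add: power_add[symmetric])
      then have "ennreal (\<phi> (vec3 x y z) ^ 4) = ennreal ((\<phi> (vec3 x y z))\<^sup>2) * ennreal ((\<phi> (vec3 x y z))\<^sup>2)"
        by (simp only: ennreal_mult[OF zero_le_power2 zero_le_power2])
      also have "\<dots> \<le> (\<integral>\<^sup>+s. m 2 (vec3 x s z) \<partial>lborel) * (\<integral>\<^sup>+s. m 3 (vec3 x y s) \<partial>lborel)"
        by (intro mult_mono line) auto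
      finally show ?thesis .
    qed
    then have "(\<integral>\<^sup>+y. \<integral>\<^sup>+z. ennreal (\<phi> (vec3 x y z) ^ 4) \<partial>lborel \<partial>lborel)
        \<le> (\<integral>\<^sup>+y. \<integral>\<^sup>+z. (\<integral>\<^sup>+s. m 2 (vec3 x s z) \<partial>lborel) * (\<integral>\<^sup>+s. m 3 (vec3 x y s) \<partial>lborel) \<partial>lborel \<partial>lborel)"
      by (intro nn_integral_mono)
    also have "\<dots> = (\<integral>\<^sup>+z. \<integral>\<^sup>+s. m 2 (vec3 x s z) \<partial>lborel \<partial>lborel) * (\<integral>\<^sup>+y. \<integral>\<^sup>+s. m 3 (vec3 x y s) \<partial>lborel \<partial>lborel)"
      by (simp add: nn_integral_multc nn_integral_cmult)
    also have "(\<integral>\<^sup>+z. \<integral>\<^sup>+s. m 2 (vec3 x s z) \<partial>lborel \<partial>lborel) = A 2 x"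
      unfolding A_def by (subst lborel_pair.nn_integral_snd[symmetric]) simp_all
    also have "(\<integral>\<^sup>+y. \<integral>\<^sup>+s. m 3 (vec3 x y s) \<partial>lborel \<partial>lborel) = A 3 x"
      unfolding A_def by (subst lborel.nn_integral_fst[symmetric]) simp_all
    also have "A 2 x * A 3 x \<le> (A 2 x)\<^sup>2 + (A 3 x)\<^sup>2" by (rule ennreal_mult_le_squares)
    also have "\<dots> \<le> 4 * (T * D 2 x) + 4 * (T * D 3 x)" by (intro add_mono A_sq)
    also have "\<dots> = 4 * T * (D 2 x + D 3 x)" by (simp add: distrib_left mult.assoc)
    finally show ?thesis .
  qed
  have D_int: "(\<integral>\<^sup>+x. D i x \<partial>lborel) = (\<integral>\<^sup>+p. e i p \<partial>lborel)" for i
    unfolding D_def by (subst nn_integral_vec3) (simp_all add: lborel.nn_integral_fst[symmetric])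
  have [measurable]: "D i \<in> borel_measurable borel" for i
    unfolding D_def[abs_def] by measurable
  have "(\<integral>\<^sup>+p. ennreal (\<phi> p ^ 4) \<partial>lborel)
      = (\<integral>\<^sup>+x. \<integral>\<^sup>+y. \<integral>\<^sup>+z. ennreal (\<phi> (vec3 x y z) ^ 4) \<partial>lborel \<partial>lborel \<partial>lborel)"
    by (rule nn_integral_vec3) simp
  also have "\<dots> \<le> (\<integral>\<^sup>+x. 4 * T * (D 2 x + D 3 x) \<partial>lborel)"
    by (intro nn_integral_mono slice)
  also have "\<dots> = 4 * T * ((\<integral>\<^sup>+x. D 2 x \<partial>lborel) + (\<integral>\<^sup>+x. D 3 x \<partial>lborel))"
    by (simp add: nn_integral_cmult nn_integral_add)
  finally show ?thesis by (simp add: D_int T_def m_def[abs_def] e_def[abs_def])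
qed

lemma fourth_power_test_function:
  assumes "open \<Omega>" "bounded \<Omega>" and \<phi>: "\<phi> \<in> test_functions \<Omega>"
  shows "(\<integral>\<^sup>+p. ennreal (\<phi> p ^ 4) \<partial>lebesgue_on \<Omega>)
    \<le> ennreal (4 * (L2_inner \<Omega> \<phi> \<phi> + dirichlet_integral \<Omega> \<phi>)\<^sup>2)"
proof -
  let ?E = "L2_inner \<Omega> \<phi> \<phi> + dirichlet_integral \<Omega> \<phi>"
  let ?I = "\<lambda>i. \<integral>x. (partial_deriv i \<phi> x)\<^sup>2 \<partial>lborel"
  note d\<phi> = test_functions_partial_deriv[OF \<phi>]
  have isq: "integrable lborel (\<lambda>x. (\<psi> x)\<^sup>2)" if "\<psi> \<in> test_functions \<Omega>" for \<psi>
    using test_function_mult_integrable[OF that test_function_continuous[OF that]]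
    by (simp add: power2_eq_square)
  have D: "dirichlet_integral \<Omega> \<phi> = ?I 1 + ?I 2 + ?I 3"
    unfolding dirichlet_integral_test_function[OF assms] by (simp add: sum_3)
  have L: "L2_inner \<Omega> \<phi> \<phi> = (\<integral>x. (\<phi> x)\<^sup>2 \<partial>lborel)"
    by (simp add: L2_inner_test_lborel[OF assms(1) \<phi> \<phi>] power2_eq_square)
  have nonneg: "0 \<le> ?I i" "0 \<le> L2_inner \<Omega> \<phi> \<phi>" for i by (auto simp: L2_inner_self_nonneg)
  have sq: "(\<integral>\<^sup>+p. ennreal ((partial_deriv i \<phi> p)\<^sup>2) \<partial>lborel) = ennreal (?I i)" for i
    by (intro nn_integral_eq_integral isq d\<phi>) auto
  have "(\<integral>\<^sup>+p. ennreal \<bar>2 * \<phi> p * partial_deriv 1 \<phi> p\<bar> \<partial>lborel)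
      \<le> (\<integral>\<^sup>+p. ennreal ((\<phi> p)\<^sup>2 + (partial_deriv 1 \<phi> p)\<^sup>2) \<partial>lborel)"
  proof (intro nn_integral_mono ennreal_leI)
    fix p
    show "\<bar>2 * \<phi> p * partial_deriv 1 \<phi> p\<bar> \<le> (\<phi> p)\<^sup>2 + (partial_deriv 1 \<phi> p)\<^sup>2"
      using zero_le_power2[of "\<bar>\<phi> p\<bar> - \<bar>partial_deriv 1 \<phi> p\<bar>"] by (simp add: power2_diff abs_mult)
  qed
  also have "\<dots> = ennreal (L2_inner \<Omega> \<phi> \<phi> + ?I 1)"
    unfolding L using isq[OF \<phi>] isq[OF d\<phi>]
    by (subst nn_integral_eq_integral) auto
  also have "\<dots> \<le> ennreal ?E" using nonneg by (intro ennreal_leI) (simp add: D)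
  finally have T: "(\<integral>\<^sup>+p. ennreal \<bar>2 * \<phi> p * partial_deriv 1 \<phi> p\<bar> \<partial>lborel) \<le> ennreal ?E" .
  have "(\<integral>\<^sup>+p. ennreal (\<phi> p ^ 4) \<partial>lebesgue_on \<Omega>)
      = (\<integral>\<^sup>+p. ennreal (\<phi> p ^ 4) * indicator \<Omega> p \<partial>lebesgue)"
    using assms(1) by (intro nn_integral_restrict_space) simp
  also have "\<dots> = (\<integral>\<^sup>+p. ennreal (\<phi> p ^ 4) \<partial>lborel)"
    unfolding nn_integral_completion
    using test_function_outside[OF \<phi>] by (intro nn_integral_cong) (auto simp: indicator_def)
  also have "\<dots> \<le> 4 * ennreal ?E * (ennreal (?I 2) + ennreal (?I 3))"
    using fourth_power_slicing[OF \<phi>] unfolding sq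
    by (rule order_trans) (intro mult_mono mult_left_mono T, auto)
  also have "\<dots> \<le> 4 * ennreal ?E * ennreal ?E"
    using nonneg by (intro mult_left_mono) (auto simp: D ennreal_plus[symmetric] simp del: ennreal_plus intro!: ennreal_leI)
  also have "\<dots> = ennreal (4 * ?E\<^sup>2)"
  proof -
    have "0 \<le> ?E" using nonneg by (simp add: D)
    then have "ennreal (4 * ?E\<^sup>2) = ennreal 4 * (ennreal ?E * ennreal ?E)"
      by (simp only: power2_eq_square ennreal_mult mult_nonneg_nonneg zero_le_numeral)
    then show ?thesis by (simp only: ennreal_numeral mult.assoc)
  qed
  finally show ?thesis .
qed

section \<open>Inequalities on the Sobolev space\<close>

text \<open>
  Besides convergence of both quadratic forms, almost everywhere convergence is arranged by passing
  to a subsequence; Fatou's lemma below depends on it.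
\<close>

lemma W012_approximation:
  assumes "open \<Omega>" "bounded \<Omega>" "u \<in> W012 \<Omega>"
  obtains \<phi> where "\<And>n. \<phi> n \<in> test_functions \<Omega>"
    and "(\<lambda>n. L2_inner \<Omega> (\<phi> n) (\<phi> n)) \<longlonglongrightarrow> L2_inner \<Omega> u u"
    and "(\<lambda>n. dirichlet_integral \<Omega> (\<phi> n)) \<longlonglongrightarrow> dirichlet_integral \<Omega> u"
    and "AE x in lebesgue_on \<Omega>. (\<lambda>n. \<phi> n x) \<longlonglongrightarrow> u x"
proof -
  obtain \<phi> where \<phi>: "\<And>n. \<phi> n \<in> test_functions \<Omega>"
      "(\<lambda>n. L2_inner \<Omega> (\<lambda>x. \<phi> n x - u x) (\<lambda>x. \<phi> n x - u x)) \<longlonglongrightarrow> 0"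
      "(\<lambda>n. dirichlet_integral \<Omega> (\<lambda>x. \<phi> n x - u x)) \<longlonglongrightarrow> 0"
    using assms by (auto simp: W012_iff)
  let ?a = "\<lambda>n x. \<phi> n x - u x"
  have uW: "u \<in> W12 \<Omega>" by (rule W012_W12[OF assms(3)])
  have aW: "?a n \<in> W12 \<Omega>" for n
    using W12_add_scale[OF assms(1) test_function_W12[OF assms(1) \<phi>(1)] uW, of n "-1"] by simp
  have eq: "(\<lambda>x. u x + 1 * ?a n x) = \<phi> n" for n by (simp add: fun_eq_iff)
  have "(\<lambda>n. L2_inner \<Omega> u (?a n)) \<longlonglongrightarrow> 0"
    by (rule tendsto_zero_if_square_le[OF L2_Cauchy_Schwarz[OF W12_L2[OF uW] W12_L2[OF aW]]
          tendsto_mult_right_zero[OF \<phi>(2)]])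
  then have "(\<lambda>n. L2_inner \<Omega> u u + 2 * 1 * L2_inner \<Omega> u (?a n) + 1\<^sup>2 * L2_inner \<Omega> (?a n) (?a n))
      \<longlonglongrightarrow> L2_inner \<Omega> u u + 2 * 1 * 0 + 1\<^sup>2 * 0"
    by (intro tendsto_intros \<phi>)
  then have 1: "(\<lambda>n. L2_inner \<Omega> (\<phi> n) (\<phi> n)) \<longlonglongrightarrow> L2_inner \<Omega> u u"
    unfolding L2_inner_self_add_scale[OF W12_L2[OF uW] W12_L2[OF aW], symmetric] eq by simp
  have "(\<lambda>n. grad_form \<Omega> u (?a n)) \<longlonglongrightarrow> 0"
    by (rule tendsto_zero_if_square_le[OF dirichlet_form_Cauchy_Schwarz[OF assms(1,2) uW aW]
          tendsto_mult_right_zero[OF \<phi>(3)]])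
  then have "(\<lambda>n. dirichlet_integral \<Omega> u + 2 * 1 * grad_form \<Omega> u (?a n) + 1\<^sup>2 * dirichlet_integral \<Omega> (?a n))
      \<longlonglongrightarrow> dirichlet_integral \<Omega> u + 2 * 1 * 0 + 1\<^sup>2 * 0"
    by (intro tendsto_intros \<phi>)
  then have 2: "(\<lambda>n. dirichlet_integral \<Omega> (\<phi> n)) \<longlonglongrightarrow> dirichlet_integral \<Omega> u"
    unfolding dirichlet_integral_add_scale[OF assms(1,2) uW aW, symmetric] eq by simp
  have "\<exists>r. strict_mono r \<and> (AE x in lebesgue_on \<Omega>. (\<lambda>n. (?a (r n) x)\<^sup>2) \<longlonglongrightarrow> 0)"
  proof (rule tendsto_L1_AE_subseq)
    show "integrable (lebesgue_on \<Omega>) (\<lambda>x. (?a n x)\<^sup>2)" for n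
      by (rule L2_integrable_square[OF W12_L2[OF aW]])
    show "(\<lambda>n. \<integral>x. norm ((?a n x)\<^sup>2) \<partial>lebesgue_on \<Omega>) \<longlonglongrightarrow> 0"
      using \<phi>(2) by (simp add: L2_inner_self)
  qed
  then obtain r where r: "strict_mono r" "AE x in lebesgue_on \<Omega>. (\<lambda>n. (?a (r n) x)\<^sup>2) \<longlonglongrightarrow> 0"
    by blast
  from r(2) have 3: "AE x in lebesgue_on \<Omega>. (\<lambda>n. \<phi> (r n) x) \<longlonglongrightarrow> u x"
  proof (rule eventually_mono)
    fix x assume "(\<lambda>n. (?a (r n) x)\<^sup>2) \<longlonglongrightarrow> 0"
    then have "(\<lambda>n. sqrt ((?a (r n) x)\<^sup>2)) \<longlonglongrightarrow> sqrt 0" by (rule tendsto_real_sqrt)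
    then have "(\<lambda>n. ?a (r n) x) \<longlonglongrightarrow> 0" by (simp add: tendsto_rabs_zero_iff)
    then show "(\<lambda>n. \<phi> (r n) x) \<longlonglongrightarrow> u x" by (simp add: LIM_zero_iff)
  qed
  show thesis
    by (rule that[of "\<lambda>n. \<phi> (r n)"])
      (use \<phi>(1) 3 LIMSEQ_subseq_LIMSEQ[OF 1 r(1)] LIMSEQ_subseq_LIMSEQ[OF 2 r(1)] in \<open>auto simp: o_def\<close>)
qed

lemma Poincare:
  assumes "open \<Omega>" "bounded \<Omega>"
  obtains C where "C > 0" "\<And>u. u \<in> W012 \<Omega> \<Longrightarrow> L2_inner \<Omega> u u \<le> C * dirichlet_integral \<Omega> u"
proof -
  obtain R where R: "R > 0" "\<And>x. x \<in> \<Omega> \<Longrightarrow> norm x \<le> R"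
    using assms(2) by (auto simp: bounded_pos)
  have "L2_inner \<Omega> u u \<le> 4 * R\<^sup>2 * dirichlet_integral \<Omega> u" if u: "u \<in> W012 \<Omega>" for u
  proof -
    obtain \<phi> where \<phi>: "\<And>n. \<phi> n \<in> test_functions \<Omega>"
      "(\<lambda>n. L2_inner \<Omega> (\<phi> n) (\<phi> n)) \<longlonglongrightarrow> L2_inner \<Omega> u u"
      "(\<lambda>n. dirichlet_integral \<Omega> (\<phi> n)) \<longlonglongrightarrow> dirichlet_integral \<Omega> u"
      using W012_approximation[OF assms u] by metis
    show ?thesis
    proof (rule LIMSEQ_le[OF \<phi>(2) tendsto_mult[OF tendsto_const \<phi>(3)]])
      show "\<exists>N. \<forall>n\<ge>N. L2_inner \<Omega> (\<phi> n) (\<phi> n) \<le> 4 * R\<^sup>2 * dirichlet_integral \<Omega> (\<phi> n)"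
        using Poincare_test_function[OF assms \<phi>(1) R(2)] by blast
    qed
  qed
  with R(1) show thesis by (intro that[of "4 * R\<^sup>2"]) auto
qed

text \<open>
  The Sobolev embedding into \<open>L\<^sup>4\<close>: the fourth powers of the approximating test functions have bounded
  integrals, and by Fatou's lemma the bound passes to the limit.
\<close>

theorem W012_square_L2:
  assumes "open \<Omega>" "bounded \<Omega>" and u: "u \<in> W012 \<Omega>"
  shows "(\<lambda>x. (u x)\<^sup>2) \<in> L2 \<Omega>"
proof -
  obtain \<phi> where \<phi>: "\<And>n. \<phi> n \<in> test_functions \<Omega>"
    "(\<lambda>n. L2_inner \<Omega> (\<phi> n) (\<phi> n)) \<longlonglongrightarrow> L2_inner \<Omega> u u"
    "(\<lambda>n. dirichlet_integral \<Omega> (\<phi> n)) \<longlonglongrightarrow> dirichlet_integral \<Omega> u"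
    "AE x in lebesgue_on \<Omega>. (\<lambda>n. \<phi> n x) \<longlonglongrightarrow> u x"
    by (rule W012_approximation[OF assms]) (rule that)
  let ?M = "lebesgue_on \<Omega>"
  let ?E = "\<lambda>n. 4 * (L2_inner \<Omega> (\<phi> n) (\<phi> n) + dirichlet_integral \<Omega> (\<phi> n))\<^sup>2"
  have "?E \<longlonglongrightarrow> 4 * (L2_inner \<Omega> u u + dirichlet_integral \<Omega> u)\<^sup>2"
    by (intro tendsto_intros \<phi>)
  then have "convergent ?E" by (rule convergentI)
  then obtain B where B: "\<And>n. norm (?E n) \<le> B"
    using convergent_imp_Bseq[of ?E] unfolding Bseq_def by blast
  have um: "u \<in> borel_measurable ?M" by (rule L2_measurable[OF W012_L2[OF u]])
  have "(\<integral>\<^sup>+x. ennreal (u x ^ 4) \<partial>?M) = (\<integral>\<^sup>+x. liminf (\<lambda>n. ennreal (\<phi> n x ^ 4)) \<partial>?M)"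
  proof (rule nn_integral_cong_AE, rule eventually_mono[OF \<phi>(4)])
    fix x assume "(\<lambda>n. \<phi> n x) \<longlonglongrightarrow> u x"
    then have "(\<lambda>n. ennreal (\<phi> n x ^ 4)) \<longlonglongrightarrow> ennreal (u x ^ 4)"
      by (intro tendsto_ennrealI tendsto_power)
    then show "ennreal (u x ^ 4) = liminf (\<lambda>n. ennreal (\<phi> n x ^ 4))"
      by (intro lim_imp_Liminf[symmetric]) auto
  qed
  also have "\<dots> \<le> liminf (\<lambda>n. \<integral>\<^sup>+x. ennreal (\<phi> n x ^ 4) \<partial>?M)"
  proof (rule nn_integral_liminf)
    fix n
    have "\<phi> n \<in> borel_measurable ?M"
      by (rule borel_measurable_lebesgue_on[OF test_function_borel[OF \<phi>(1)]])
    then show "(\<lambda>x. ennreal (\<phi> n x ^ 4)) \<in> borel_measurable ?M" by simp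
  qed
  also have "\<dots> \<le> liminf (\<lambda>n::nat. ennreal B)"
  proof (rule Liminf_mono, rule always_eventually, rule allI)
    fix n
    have "(\<integral>\<^sup>+x. ennreal (\<phi> n x ^ 4) \<partial>?M) \<le> ennreal (?E n)"
      by (rule fourth_power_test_function[OF assms(1,2) \<phi>(1)])
    also have "\<dots> \<le> ennreal B" using B[of n] by (intro ennreal_leI) simp
    finally show "(\<integral>\<^sup>+x. ennreal (\<phi> n x ^ 4) \<partial>?M) \<le> ennreal B" .
  qed
  also have "\<dots> = ennreal B" by (simp add: Liminf_const)
  finally have fin: "(\<integral>\<^sup>+x. ennreal (u x ^ 4) \<partial>?M) < \<infinity>"
    by (simp add: order_le_less_trans)
  have "integrable ?M (\<lambda>x. u x ^ 4)"
  proof (rule integrableI_bounded)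
    show "(\<lambda>x. u x ^ 4) \<in> borel_measurable ?M" using um by simp
    show "(\<integral>\<^sup>+x. ennreal (norm (u x ^ 4)) \<partial>?M) < \<infinity>" using fin by (simp add: power_abs)
  qed
  moreover have "((u x)\<^sup>2)\<^sup>2 = u x ^ 4" for x by (simp add: power_mult[symmetric])
  ultimately show ?thesis using um by (simp add: L2_def)
qed

text \<open>
  Polarization of the previous result.
\<close>

lemma W012_mult_L2:
  assumes "open \<Omega>" "bounded \<Omega>" and u: "u \<in> W012 \<Omega>" and v: "v \<in> W012 \<Omega>"
  shows "(\<lambda>x. u x * v x) \<in> L2 \<Omega>"
proof -
  have "(\<lambda>x. u x + 1 * v x) \<in> W012 \<Omega>" by (rule W012_add_scale[OF assms])
  then have sum: "(\<lambda>x. (u x + 1 * v x)\<^sup>2) \<in> L2 \<Omega>" by (rule W012_square_L2[OF assms(1,2)])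
  have "(\<lambda>x. (1 / 2) * (((u x + 1 * v x)\<^sup>2 - (u x)\<^sup>2) - (v x)\<^sup>2)) \<in> L2 \<Omega>"
    by (rule L2_scale[OF L2_diff[OF L2_diff[OF sum W012_square_L2[OF assms(1-3)]]
          W012_square_L2[OF assms(1,2,4)]]])
  moreover have "(1 / 2) * (((u x + 1 * v x)\<^sup>2 - (u x)\<^sup>2) - (v x)\<^sup>2) = u x * v x" for x
    by (simp add: power2_sum)
  ultimately show ?thesis by simp
qed

section \<open>Convex conjugates\<close>

text \<open>
  The convex conjugate with respect to the pairing of \<open>L\<^sup>2\<close>, where \<open>P\<close> counts as infinite outside the
  Sobolev space.
\<close>

definition conjugate ::
  "(real^3) set \<Rightarrow> ((real^3 \<Rightarrow> real) \<Rightarrow> real) \<Rightarrow> (real^3 \<Rightarrow> real) \<Rightarrow> real" where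
  "conjugate \<Omega> P w = (SUP u\<in>W012 \<Omega>. L2_inner \<Omega> u w - P u)"

text \<open>
  Expand the square of the norm of \<open>w - 2 c u\<close>.
\<close>

lemma coercive_bound:
  assumes "u \<in> L2 \<Omega>" "w \<in> L2 \<Omega>" "0 < c" "c * L2_inner \<Omega> u u \<le> P u"
  shows "L2_inner \<Omega> u w - P u \<le> L2_inner \<Omega> w w / (4 * c)"
proof -
  have "0 \<le> L2_inner \<Omega> w w + 2 * (- 2 * c) * L2_inner \<Omega> w u + (- 2 * c)\<^sup>2 * L2_inner \<Omega> u u"
    unfolding L2_inner_self_add_scale[OF assms(2,1), symmetric] by (rule L2_inner_self_nonneg)
  then have "4 * c * (L2_inner \<Omega> u w - c * L2_inner \<Omega> u u) \<le> L2_inner \<Omega> w w"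
    by (simp add: L2_inner_commute[of \<Omega> w u] power2_eq_square algebra_simps)
  then have "L2_inner \<Omega> u w - c * L2_inner \<Omega> u u \<le> L2_inner \<Omega> w w / (4 * c)"
    using assms(3) by (simp add: field_simps)
  with assms(4) show ?thesis by linarith
qed

lemma conjugate_bdd_above:
  assumes "w \<in> L2 \<Omega>" "0 < c" "\<And>u. u \<in> W012 \<Omega> \<Longrightarrow> c * L2_inner \<Omega> u u \<le> P u"
  shows "bdd_above ((\<lambda>u. L2_inner \<Omega> u w - P u) ` W012 \<Omega>)"
  using assms coercive_bound[OF W012_L2] by (intro bdd_aboveI2) blast

lemma conjugate_upper:
  assumes "w \<in> L2 \<Omega>" "0 < c" "\<And>u. u \<in> W012 \<Omega> \<Longrightarrow> c * L2_inner \<Omega> u u \<le> P u" "u \<in> W012 \<Omega>"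
  shows "L2_inner \<Omega> u w - P u \<le> conjugate \<Omega> P w"
  unfolding conjugate_def by (rule cSUP_upper[OF assms(4) conjugate_bdd_above[OF assms(1-3)]])

text \<open>
  A maximizing sequence would converge weakly to the derivative, and lower semicontinuity of \<open>P\<close>
  would give the claim; here both steps are condensed into one inequality. Lower semicontinuity
  enters as a subgradient \<open>\<phi>\<close> of \<open>P\<close> at \<open>u\<^sub>0\<close> in \<open>L\<^sup>2\<close>, up to an error \<open>\<epsilon>\<close>. With
  \<open>\<psi> = w - \<phi>\<close> and \<open>t > 0\<close>, adding \<open>t\<close> times the subgradient inequality to the definition of the
  conjugate at \<open>w + t \<psi>\<close> gives
  \<open>(1 + t) P\<^sup>*(w) \<le> P\<^sup>*(w + t \<psi>) + t (\<langle>u\<^sub>0, w\<rangle> - P(u\<^sub>0) - \<langle>u\<^sub>0, \<psi>\<rangle> + \<epsilon>)\<close>.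
  Divide by \<open>t\<close> and let \<open>t\<close> and then \<open>\<epsilon>\<close> tend to zero.
\<close>

theorem conjugate_attained_at_derivative:
  assumes \<Omega>: "open \<Omega>" "bounded \<Omega>" and u0: "u0 \<in> W012 \<Omega>" and w: "w \<in> L2 \<Omega>"
    and c: "0 < c" "\<And>u. u \<in> W012 \<Omega> \<Longrightarrow> c * L2_inner \<Omega> u u \<le> P u"
    and deriv: "\<And>\<psi>. \<psi> \<in> L2 \<Omega> \<Longrightarrow>
      ((\<lambda>t. conjugate \<Omega> P (\<lambda>x. w x + t * \<psi> x)) has_real_derivative L2_inner \<Omega> u0 \<psi>) (at 0)"
    and subgradient: "\<And>\<epsilon>. 0 < \<epsilon> \<Longrightarrow> \<exists>\<phi>\<in>L2 \<Omega>. \<forall>u\<in>W012 \<Omega>.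
      P u0 + (L2_inner \<Omega> u \<phi> - L2_inner \<Omega> u0 \<phi>) - \<epsilon> \<le> P u"
  shows "conjugate \<Omega> P w = L2_inner \<Omega> u0 w - P u0"
proof (rule antisym)
  let ?a = "L2_inner \<Omega> u0 w - P u0"
  show "?a \<le> conjugate \<Omega> P w" by (rule conjugate_upper[OF w c u0])
  show "conjugate \<Omega> P w \<le> ?a"
  proof (rule field_le_epsilon)
    fix \<epsilon> :: real assume "0 < \<epsilon>"
    from subgradient[OF this] obtain \<phi> where \<phi>: "\<phi> \<in> L2 \<Omega>"
      and sub: "\<And>u. u \<in> W012 \<Omega> \<Longrightarrow> P u0 + (L2_inner \<Omega> u \<phi> - L2_inner \<Omega> u0 \<phi>) - \<epsilon> \<le> P u"
      by blast
    define \<psi> where "\<psi> x = w x - \<phi> x" for x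
    have \<psi>: "\<psi> \<in> L2 \<Omega>" unfolding \<psi>_def[abs_def] by (rule L2_diff[OF w \<phi>])
    have ip: "L2_inner \<Omega> u \<psi> = L2_inner \<Omega> u w - L2_inner \<Omega> u \<phi>" if "u \<in> W012 \<Omega>" for u
      unfolding \<psi>_def by (rule L2_inner_diff_right[OF w \<phi> W012_L2[OF that]])
    let ?P = "\<lambda>t. conjugate \<Omega> P (\<lambda>x. w x + t * \<psi> x)"
    let ?c = "?a - L2_inner \<Omega> u0 \<psi> + \<epsilon>"
    have quotient: "conjugate \<Omega> P w - ?c \<le> (?P t - ?P 0) / t" if "0 < t" for t
    proof -
      have wt: "(\<lambda>x. w x + t * \<psi> x) \<in> L2 \<Omega>" by (intro L2_add L2_scale w \<psi>)
      have "conjugate \<Omega> P w \<le> (?P t + t * ?c) / (1 + t)"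
        unfolding conjugate_def[of \<Omega> P w]
      proof (rule cSUP_least)
        show "W012 \<Omega> \<noteq> {}" using u0 by auto
        fix u assume u: "u \<in> W012 \<Omega>"
        have "L2_inner \<Omega> u w + t * L2_inner \<Omega> u \<psi> - P u \<le> ?P t"
          using conjugate_upper[OF wt c u] L2_inner_add_right[OF w L2_scale[OF \<psi>, of t] W012_L2[OF u]]
          by (simp add: L2_inner_scale_right)
        moreover have "t * (L2_inner \<Omega> u w - P u) \<le> t * (L2_inner \<Omega> u \<psi> + ?c)"
          using sub[OF u] ip[OF u] ip[OF u0] \<open>0 < t\<close> by (intro mult_left_mono) auto
        ultimately have "(1 + t) * (L2_inner \<Omega> u w - P u) \<le> ?P t + t * ?c"
          by (simp add: algebra_simps)
        then show "L2_inner \<Omega> u w - P u \<le> (?P t + t * ?c) / (1 + t)"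
          using \<open>0 < t\<close> by (simp add: field_simps)
      qed
      then have "t * (conjugate \<Omega> P w - ?c) \<le> ?P t - ?P 0"
        using \<open>0 < t\<close> by (simp add: field_simps)
      then show ?thesis using \<open>0 < t\<close> by (simp add: field_simps)
    qed
    have "((\<lambda>t. (?P t - ?P 0) / t) \<longlongrightarrow> L2_inner \<Omega> u0 \<psi>) (at 0)"
      using deriv[OF \<psi>] by (simp add: DERIV_def)
    then have "((\<lambda>t. (?P t - ?P 0) / t) \<longlongrightarrow> L2_inner \<Omega> u0 \<psi>) (at_right 0)"
      by (rule tendsto_within_subset) simp
    moreover have "\<forall>\<^sub>F t in at_right 0. conjugate \<Omega> P w - ?c \<le> (?P t - ?P 0) / t"
      using eventually_at_right_less[of "0::real"] by eventually_elim (rule quotient)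
    ultimately have "conjugate \<Omega> P w - ?c \<le> L2_inner \<Omega> u0 \<psi>"
      by (intro tendsto_lowerbound) auto
    then show "conjugate \<Omega> P w \<le> ?a + \<epsilon>" by simp
  qed
qed

lemma linear_le_quadratic_imp_zero:
  fixes p q :: real
  assumes "\<And>t. t * p \<le> t\<^sup>2 * q"
  shows "p = 0"
proof (rule ccontr)
  assume "p \<noteq> 0"
  \<comment> \<open>With this \<open>t\<close> the linear term is \<open>t\<^sup>2 d\<close>, and \<open>d > q\<close>.\<close>
  define d where "d = 1 + \<bar>q\<bar>"
  define t where "t = p / d"
  have d: "0 < d" "0 < d - q" by (auto simp: d_def)
  have "t * (t * d) \<le> t\<^sup>2 * q" using assms[of t] d by (simp add: t_def)
  then have "t\<^sup>2 * (d - q) \<le> 0" by (simp add: power2_eq_square algebra_simps)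
  moreover have "0 < t\<^sup>2 * (d - q)" using d \<open>p \<noteq> 0\<close> by (simp add: t_def)
  ultimately show False by simp
qed

text \<open>
  Along the line through \<open>u\<^sub>0\<close> in direction \<open>\<phi>\<close>, maximality says that a linear function of the step is
  bounded by a multiple of its square.
\<close>

lemma Euler_Lagrange_quadratic:
  assumes "\<And>t. (\<lambda>x. u0 x + t * \<phi> x) \<in> W012 \<Omega>" and L2: "u0 \<in> L2 \<Omega>" "\<phi> \<in> L2 \<Omega>" "w \<in> L2 \<Omega>"
    and max: "\<And>u. u \<in> W012 \<Omega> \<Longrightarrow> L2_inner \<Omega> u w - P u \<le> L2_inner \<Omega> u0 w - P u0"
    and expand: "\<And>t. P (\<lambda>x. u0 x + t * \<phi> x) = P u0 + t * b + t\<^sup>2 * q"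
  shows "L2_inner \<Omega> \<phi> w = b"
proof -
  have "t * (L2_inner \<Omega> \<phi> w - b) \<le> t\<^sup>2 * q" for t
    using max[OF assms(1), of t] expand[of t] L2_inner_add_left[OF L2(1) L2_scale[OF L2(2), of t] L2(3)]
    by (simp add: L2_inner_scale_left algebra_simps)
  then show ?thesis using linear_le_quadratic_imp_zero by fastforce
qed

section \<open>The polar functionals\<close>

lemma G1star_conjugate: "G1star \<Omega> \<gamma> = conjugate \<Omega> (\<lambda>u. \<gamma> / 2 * dirichlet_integral \<Omega> u)"
  by (simp add: fun_eq_iff G1star_def conjugate_def)

lemma Fstar_conjugate: "Fstar \<Omega> K = conjugate \<Omega> (\<lambda>u. K / 2 * L2_inner \<Omega> u u)"
  by (simp add: fun_eq_iff Fstar_def conjugate_def L2_inner_self)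

lemma dirichlet_coercive:
  assumes "open \<Omega>" "bounded \<Omega>" "0 < \<gamma>"
  obtains c where "0 < c" "\<And>u. u \<in> W012 \<Omega> \<Longrightarrow> c * L2_inner \<Omega> u u \<le> \<gamma> / 2 * dirichlet_integral \<Omega> u"
proof -
  obtain C where C: "C > 0" "\<And>u. u \<in> W012 \<Omega> \<Longrightarrow> L2_inner \<Omega> u u \<le> C * dirichlet_integral \<Omega> u"
    using Poincare[OF assms(1,2)] by blast
  show thesis
  proof (rule that)
    show "0 < \<gamma> / (2 * C)" using assms(3) C(1) by simp
    fix u assume "u \<in> W012 \<Omega>"
    from mult_left_mono[OF C(2)[OF this], of "\<gamma> / (2 * C)"]
    show "\<gamma> / (2 * C) * L2_inner \<Omega> u u \<le> \<gamma> / 2 * dirichlet_integral \<Omega> u"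
      using assms(3) C(1) by simp
  qed
qed

text \<open>
  The distributional Laplacian of \<open>u\<^sub>0\<close> need not be in \<open>L\<^sup>2\<close>. At a test function \<open>\<psi>\<close> the functional has
  the subgradient \<open>- \<gamma> \<Delta>\<psi>\<close> in \<open>L\<^sup>2\<close>, and its use at \<open>u\<^sub>0\<close> instead costs exactly \<open>\<gamma>/2\<close> times the
  Dirichlet integral of \<open>\<psi> - u\<^sub>0\<close>.
\<close>

lemma dirichlet_approximate_subgradient:
  assumes \<Omega>: "open \<Omega>" "bounded \<Omega>" and \<gamma>: "0 < \<gamma>" and u0: "u0 \<in> W012 \<Omega>" and "0 < \<epsilon>"
  shows "\<exists>\<phi>\<in>L2 \<Omega>. \<forall>u\<in>W012 \<Omega>. \<gamma> / 2 * dirichlet_integral \<Omega> u0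
    + (L2_inner \<Omega> u \<phi> - L2_inner \<Omega> u0 \<phi>) - \<epsilon> \<le> \<gamma> / 2 * dirichlet_integral \<Omega> u"
proof -
  obtain \<phi> where \<phi>: "\<And>n. \<phi> n \<in> test_functions \<Omega>"
      "(\<lambda>n. dirichlet_integral \<Omega> (\<lambda>x. \<phi> n x - u0 x)) \<longlonglongrightarrow> 0"
    using u0 by (auto simp: W012_iff)
  have "\<forall>\<^sub>F n in sequentially. dirichlet_integral \<Omega> (\<lambda>x. \<phi> n x - u0 x) < 2 * \<epsilon> / \<gamma>"
    using \<open>0 < \<epsilon>\<close> \<gamma> by (intro order_tendstoD(2)[OF \<phi>(2)]) simp
  then obtain n where n: "dirichlet_integral \<Omega> (\<lambda>x. \<phi> n x - u0 x) < 2 * \<epsilon> / \<gamma>"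
    by (auto simp: eventually_sequentially)
  let ?\<psi> = "\<phi> n" and ?D = "dirichlet_integral \<Omega>"
  have \<psi>: "?\<psi> \<in> W12 \<Omega>" by (rule test_function_W12[OF \<Omega>(1) \<phi>(1)])
  have "?D (\<lambda>x. ?\<psi> x - u0 x) = ?D ?\<psi> - 2 * grad_form \<Omega> u0 ?\<psi> + ?D u0"
    using dirichlet_integral_add_scale[OF \<Omega> \<psi> W012_W12[OF u0], of "-1"]
    by (simp add: grad_form_commute[of \<Omega> ?\<psi>])
  with n \<gamma> have near: "\<gamma> / 2 * (?D ?\<psi> - 2 * grad_form \<Omega> u0 ?\<psi> + ?D u0) \<le> \<epsilon>"
    by (simp add: field_simps)
  have ip: "L2_inner \<Omega> u (\<lambda>x. - \<gamma> * laplacian ?\<psi> x) = \<gamma> * grad_form \<Omega> u ?\<psi>"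
    if "u \<in> W012 \<Omega>" for u
    using grad_form_test_function[OF \<Omega> W012_W12[OF that] \<phi>(1)] by (simp only: L2_inner_scale_right)
  show ?thesis
  proof (intro bexI[of _ "\<lambda>x. - \<gamma> * laplacian ?\<psi> x"] ballI)
    show "(\<lambda>x. - \<gamma> * laplacian ?\<psi> x) \<in> L2 \<Omega>"
      by (rule L2_scale[OF laplacian_L2[OF \<Omega>(1) \<phi>(1)]])
    fix u assume u: "u \<in> W012 \<Omega>"
    have "0 \<le> \<gamma> / 2 * (?D u - 2 * grad_form \<Omega> u ?\<psi> + ?D ?\<psi>)"
      using dirichlet_integral_add_scale[OF \<Omega> W012_W12[OF u] \<psi>, of "-1"]
        dirichlet_integral_nonneg[of \<Omega> "\<lambda>x. u x + (-1) * ?\<psi> x"] \<gamma> by simp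
    with near show "\<gamma> / 2 * ?D u0 + (L2_inner \<Omega> u (\<lambda>x. - \<gamma> * laplacian ?\<psi> x)
        - L2_inner \<Omega> u0 (\<lambda>x. - \<gamma> * laplacian ?\<psi> x)) - \<epsilon> \<le> \<gamma> / 2 * ?D u"
      unfolding ip[OF u] ip[OF u0] by (simp add: algebra_simps)
  qed
qed

lemma L2_square_approximate_subgradient:
  assumes u0: "u0 \<in> L2 \<Omega>" and K: "0 < K" and "0 < \<epsilon>" and H: "H \<subseteq> L2 \<Omega>"
  shows "\<exists>\<phi>\<in>L2 \<Omega>. \<forall>u\<in>H. K / 2 * L2_inner \<Omega> u0 u0
    + (L2_inner \<Omega> u \<phi> - L2_inner \<Omega> u0 \<phi>) - \<epsilon> \<le> K / 2 * L2_inner \<Omega> u u"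
proof (intro bexI[of _ "\<lambda>x. K * u0 x"] ballI)
  fix u assume "u \<in> H"
  then have "u \<in> L2 \<Omega>" using H by blast
  from L2_inner_self_add_scale[OF this u0, of "-1"] L2_inner_self_nonneg[of \<Omega> "\<lambda>x. u x + (-1) * u0 x"] K
  have "0 \<le> K / 2 * (L2_inner \<Omega> u u - 2 * L2_inner \<Omega> u u0 + L2_inner \<Omega> u0 u0)" by simp
  then show "K / 2 * L2_inner \<Omega> u0 u0 + (L2_inner \<Omega> u (\<lambda>x. K * u0 x)
      - L2_inner \<Omega> u0 (\<lambda>x. K * u0 x)) - \<epsilon> \<le> K / 2 * L2_inner \<Omega> u u"
    using \<open>0 < \<epsilon>\<close> by (simp add: L2_inner_scale_right algebra_simps)
qed (rule L2_scale[OF u0])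

text \<open>
  For an unbounded weight \<open>q\<close> the subgradient \<open>2 q u\<^sub>0\<close> need not be in \<open>L\<^sup>2\<close>. Truncating the weight at
  height \<open>m\<close> lowers the functional, and at \<open>u\<^sub>0\<close> only by an amount that tends to zero.
\<close>

lemma weighted_square_approximate_subgradient:
  assumes \<Omega>: "open \<Omega>" "bounded \<Omega>" and q: "q \<in> L2 \<Omega>" "AE x in lebesgue_on \<Omega>. 0 \<le> q x"
    and u0: "u0 \<in> W012 \<Omega>" and "0 < \<epsilon>"
  shows "\<exists>\<phi>\<in>L2 \<Omega>. \<forall>u\<in>W012 \<Omega>. L2_inner \<Omega> q (\<lambda>x. (u0 x)\<^sup>2)
    + (L2_inner \<Omega> u \<phi> - L2_inner \<Omega> u0 \<phi>) - \<epsilon> \<le> L2_inner \<Omega> q (\<lambda>x. (u x)\<^sup>2)"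
proof -
  let ?M = "lebesgue_on \<Omega>"
  define p where "p m x = max 0 (min (q x) (real m))" for m x
  have [measurable]: "q \<in> borel_measurable ?M" "u0 \<in> borel_measurable ?M"
    by (rule L2_measurable[OF q(1)] L2_measurable[OF W012_L2[OF u0]])+
  have pm [measurable]: "p m \<in> borel_measurable ?M" for m
    unfolding p_def[abs_def] by measurable
  have p_bound: "\<bar>p m x\<bar> \<le> real m" for m x by (simp add: p_def)
  have int_q: "integrable ?M (\<lambda>x. q x * (u x)\<^sup>2)" if "u \<in> W012 \<Omega>" for u
    by (rule L2_mult_integrable[OF q(1) W012_square_L2[OF \<Omega> that]])
  have int_p: "integrable ?M (\<lambda>x. p m x * (u0 x)\<^sup>2)" for m
    using L2_mult_integrable[OF L2_bounded_mult[OF W012_L2[OF u0] pm p_bound] W012_L2[OF u0]]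
    by (simp add: power2_eq_square mult.assoc)
  have "(\<lambda>m. \<integral>x. p m x * (u0 x)\<^sup>2 \<partial>?M) \<longlonglongrightarrow> (\<integral>x. q x * (u0 x)\<^sup>2 \<partial>?M)"
  proof (rule integral_dominated_convergence)
    show "integrable ?M (\<lambda>x. \<bar>q x * (u0 x)\<^sup>2\<bar>)" using int_q[OF u0] by simp
    show "AE x in ?M. (\<lambda>m. p m x * (u0 x)\<^sup>2) \<longlonglongrightarrow> q x * (u0 x)\<^sup>2"
    proof (rule eventually_mono[OF q(2)])
      fix x assume "0 \<le> q x"
      have "\<forall>\<^sub>F m in sequentially. p m x * (u0 x)\<^sup>2 = q x * (u0 x)\<^sup>2"
        using eventually_ge_at_top[of "nat \<lceil>q x\<rceil>"]
      proof eventually_elim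
        case (elim m)
        then have "q x \<le> real m" by linarith
        with \<open>0 \<le> q x\<close> show ?case by (simp add: p_def)
      qed
      then show "(\<lambda>m. p m x * (u0 x)\<^sup>2) \<longlonglongrightarrow> q x * (u0 x)\<^sup>2"
        by (rule tendsto_eventually)
    qed
    show "AE x in ?M. norm (p m x * (u0 x)\<^sup>2) \<le> \<bar>q x * (u0 x)\<^sup>2\<bar>" for m
    proof (rule eventually_mono[OF q(2)])
      fix x assume "0 \<le> q x"
      then have "\<bar>p m x\<bar> \<le> \<bar>q x\<bar>" by (simp add: p_def)
      then show "norm (p m x * (u0 x)\<^sup>2) \<le> \<bar>q x * (u0 x)\<^sup>2\<bar>"
        by (simp add: abs_mult mult_right_mono)
    qed
  qed measurable
  then have "\<forall>\<^sub>F m in sequentially. (\<integral>x. q x * (u0 x)\<^sup>2 \<partial>?M) - \<epsilon> < (\<integral>x. p m x * (u0 x)\<^sup>2 \<partial>?M)"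
    using \<open>0 < \<epsilon>\<close> by (intro order_tendstoD(1)) auto
  then obtain m where m: "(\<integral>x. q x * (u0 x)\<^sup>2 \<partial>?M) - \<epsilon> < (\<integral>x. p m x * (u0 x)\<^sup>2 \<partial>?M)"
    by (auto simp: eventually_sequentially)
  let ?\<phi> = "\<lambda>x. 2 * (p m x * u0 x)"
  have \<phi>: "?\<phi> \<in> L2 \<Omega>"
    by (rule L2_scale[OF L2_bounded_mult[OF W012_L2[OF u0] pm p_bound]])
  show ?thesis
  proof (intro bexI[OF _ \<phi>] ballI)
    fix u assume u: "u \<in> W012 \<Omega>"
    have int_\<phi>: "integrable ?M (\<lambda>x. u x * ?\<phi> x)"
      by (rule L2_mult_integrable[OF W012_L2[OF u] \<phi>])
    have "L2_inner \<Omega> u ?\<phi> - (\<integral>x. p m x * (u0 x)\<^sup>2 \<partial>?M) = (\<integral>x. u x * ?\<phi> x - p m x * (u0 x)\<^sup>2 \<partial>?M)"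
      unfolding L2_inner_def by (rule Bochner_Integration.integral_diff[OF int_\<phi> int_p, symmetric])
    also have "\<dots> \<le> (\<integral>x. q x * (u x)\<^sup>2 \<partial>?M)"
    proof (rule integral_mono_AE[OF Bochner_Integration.integrable_diff[OF int_\<phi> int_p] int_q[OF u]])
      show "AE x in ?M. u x * ?\<phi> x - p m x * (u0 x)\<^sup>2 \<le> q x * (u x)\<^sup>2"
      proof (rule eventually_mono[OF q(2)])
        fix x assume "0 \<le> q x"
        then have p: "0 \<le> p m x" "p m x \<le> q x" by (auto simp: p_def)
        have "0 \<le> p m x * (u x - u0 x)\<^sup>2" using p by simp
        moreover have "p m x * (u x)\<^sup>2 \<le> q x * (u x)\<^sup>2" using p by (intro mult_right_mono) auto
        ultimately show "u x * ?\<phi> x - p m x * (u0 x)\<^sup>2 \<le> q x * (u x)\<^sup>2"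
          by (simp add: power2_eq_square algebra_simps)
      qed
    qed
    finally have "L2_inner \<Omega> u ?\<phi> - (\<integral>x. p m x * (u0 x)\<^sup>2 \<partial>?M) \<le> L2_inner \<Omega> q (\<lambda>x. (u x)\<^sup>2)"
      by (simp add: L2_inner_def)
    moreover have "L2_inner \<Omega> u0 ?\<phi> = 2 * (\<integral>x. p m x * (u0 x)\<^sup>2 \<partial>?M)"
      by (simp add: L2_inner_def power2_eq_square mult_ac flip: integral_mult_right_zero)
    ultimately show "L2_inner \<Omega> q (\<lambda>x. (u0 x)\<^sup>2) + (L2_inner \<Omega> u ?\<phi> - L2_inner \<Omega> u0 ?\<phi>) - \<epsilon>
        \<le> L2_inner \<Omega> q (\<lambda>x. (u x)\<^sup>2)"
      using m by (simp add: L2_inner_def)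
  qed
qed

lemma Bstar_D:
  assumes "v0 \<in> Bstar \<Omega> K"
  shows Bstar_L2: "v0 \<in> L2 \<Omega>" and Bstar_AE: "AE x in lebesgue_on \<Omega>. K / 4 \<le> v0 x + K / 2"
  using assms by (auto simp: Bstar_def elim: eventually_mono)

lemma weight_L2:
  assumes "open \<Omega>" "bounded \<Omega>" "v0 \<in> L2 \<Omega>"
  shows "(\<lambda>x. v0 x + K / 2) \<in> L2 \<Omega>"
  by (rule L2_add[OF assms(3) L2_const[OF assms(2,1)]])

lemma weighted_square_coercive:
  assumes \<Omega>: "open \<Omega>" "bounded \<Omega>" and v0: "v0 \<in> Bstar \<Omega> K" and u: "u \<in> W012 \<Omega>"
  shows "K / 4 * L2_inner \<Omega> u u \<le> L2_inner \<Omega> (\<lambda>x. v0 x + K / 2) (\<lambda>x. (u x)\<^sup>2)"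
proof -
  have "(\<integral>x. K / 4 * (u x)\<^sup>2 \<partial>lebesgue_on \<Omega>) \<le> L2_inner \<Omega> (\<lambda>x. v0 x + K / 2) (\<lambda>x. (u x)\<^sup>2)"
    unfolding L2_inner_def
  proof (rule integral_mono_AE)
    show "integrable (lebesgue_on \<Omega>) (\<lambda>x. K / 4 * (u x)\<^sup>2)"
      using L2_integrable_square[OF W012_L2[OF u]] by simp
    show "integrable (lebesgue_on \<Omega>) (\<lambda>x. (v0 x + K / 2) * (u x)\<^sup>2)"
      by (rule L2_mult_integrable[OF weight_L2[OF \<Omega> Bstar_L2[OF v0]] W012_square_L2[OF \<Omega> u]])
    show "AE x in lebesgue_on \<Omega>. K / 4 * (u x)\<^sup>2 \<le> (v0 x + K / 2) * (u x)\<^sup>2"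
      using Bstar_AE[OF v0] by (rule eventually_mono) (rule mult_right_mono, auto)
  qed
  then show ?thesis by (simp add: L2_inner_self)
qed

lemma weighted_square_expand:
  assumes \<Omega>: "open \<Omega>" "bounded \<Omega>" and v0: "v0 \<in> L2 \<Omega>" and u: "u \<in> W012 \<Omega>"
  shows "L2_inner \<Omega> (\<lambda>x. v0 x + K / 2) (\<lambda>x. (u x)\<^sup>2)
    = L2_inner \<Omega> v0 (\<lambda>x. (u x)\<^sup>2) + K / 2 * L2_inner \<Omega> u u"
  unfolding L2_inner_add_left[OF v0 L2_const[OF \<Omega>(2,1)] W012_square_L2[OF \<Omega> u]]
  by (simp add: L2_inner_def power2_eq_square)

text \<open>
  The substitution \<open>s = u\<^sup>2 - \<beta> + v\<close> decouples the two variables of \<open>G\<^sub>2\<close>; the supremum over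
  \<open>s\<close> is attained at \<open>s = v\<^sub>0 / \<alpha>\<close>.
\<close>

lemma G2_substitution:
  assumes \<Omega>: "open \<Omega>" "bounded \<Omega>" and v0: "v0 \<in> L2 \<Omega>" and u: "u \<in> W012 \<Omega>" and s: "s \<in> L2 \<Omega>"
    and v: "\<And>x. v x = (s x - (u x)\<^sup>2) + \<beta>"
  shows "L2_inner \<Omega> u v2 + L2_inner \<Omega> v v0 - G2 \<Omega> \<alpha> \<beta> K u v
    = (L2_inner \<Omega> u v2 - L2_inner \<Omega> (\<lambda>x. v0 x + K / 2) (\<lambda>x. (u x)\<^sup>2))
      + (L2_inner \<Omega> s v0 - \<alpha> / 2 * L2_inner \<Omega> s s) + \<beta> * integral\<^sup>L (lebesgue_on \<Omega>) v0"
proof -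
  note u2 = W012_square_L2[OF \<Omega> u] and const = L2_const[OF \<Omega>(2,1), of \<beta>]
  have "L2_inner \<Omega> v v0 = L2_inner \<Omega> s v0 - L2_inner \<Omega> (\<lambda>x. (u x)\<^sup>2) v0 + L2_inner \<Omega> (\<lambda>x. \<beta>) v0"
    using L2_inner_add_left[OF L2_diff[OF s u2] const v0] L2_inner_diff_left[OF s u2 v0]
    by (simp add: v[abs_def])
  moreover have "L2_inner \<Omega> (\<lambda>x. \<beta>) v0 = \<beta> * integral\<^sup>L (lebesgue_on \<Omega>) v0"
    by (simp add: L2_inner_def)
  moreover have "G2 \<Omega> \<alpha> \<beta> K u v = \<alpha> / 2 * L2_inner \<Omega> s s + K / 2 * L2_inner \<Omega> u u"
    by (simp add: G2_def v L2_inner_self)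
  ultimately show ?thesis
    using weighted_square_expand[OF \<Omega> v0 u, of K] L2_inner_commute[of \<Omega> v0 "\<lambda>x. (u x)\<^sup>2"] by simp
qed

lemma G2star_eq:
  assumes \<Omega>: "open \<Omega>" "bounded \<Omega>" and K: "0 < K" and \<alpha>: "0 < \<alpha>"
    and v2: "v2 \<in> L2 \<Omega>" and v0: "v0 \<in> Bstar \<Omega> K"
  shows G2star_conjugate: "G2star \<Omega> \<alpha> \<beta> K v2 v0
      = conjugate \<Omega> (\<lambda>u. L2_inner \<Omega> (\<lambda>x. v0 x + K / 2) (\<lambda>x. (u x)\<^sup>2)) v2
        + (L2_inner \<Omega> v0 v0 / (2 * \<alpha>) + \<beta> * integral\<^sup>L (lebesgue_on \<Omega>) v0)"
    and G2star_upper: "u \<in> W012 \<Omega> \<Longrightarrow> v \<in> L2 \<Omega> \<Longrightarrow>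
      L2_inner \<Omega> u v2 + L2_inner \<Omega> v v0 - G2 \<Omega> \<alpha> \<beta> K u v \<le> G2star \<Omega> \<alpha> \<beta> K v2 v0"
proof -
  let ?Q = "\<lambda>u. L2_inner \<Omega> (\<lambda>x. v0 x + K / 2) (\<lambda>x. (u x)\<^sup>2)"
  let ?c = "L2_inner \<Omega> v0 v0 / (2 * \<alpha>) + \<beta> * integral\<^sup>L (lebesgue_on \<Omega>) v0"
  let ?E = "\<lambda>(u, v). L2_inner \<Omega> u v2 + L2_inner \<Omega> v v0 - G2 \<Omega> \<alpha> \<beta> K u v"
  note v0L = Bstar_L2[OF v0]
  have K4: "0 < K / 4" using K by simp
  note coercive = weighted_square_coercive[OF \<Omega> v0]
  have upper: "?E (u, v) \<le> conjugate \<Omega> ?Q v2 + ?c" if u: "u \<in> W012 \<Omega>" and v: "v \<in> L2 \<Omega>" for u v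
  proof -
    define s where "s x = ((u x)\<^sup>2 - \<beta>) + v x" for x
    have s: "s \<in> L2 \<Omega>"
      unfolding s_def[abs_def] by (intro L2_add L2_diff W012_square_L2 L2_const \<Omega> u v)
    have "L2_inner \<Omega> s v0 - \<alpha> / 2 * L2_inner \<Omega> s s \<le> L2_inner \<Omega> v0 v0 / (4 * (\<alpha> / 2))"
      using \<alpha> by (intro coercive_bound[OF s v0L]) auto
    moreover have "L2_inner \<Omega> u v2 - ?Q u \<le> conjugate \<Omega> ?Q v2"
      by (rule conjugate_upper[OF v2 K4 coercive u])
    moreover have "v x = (s x - (u x)\<^sup>2) + \<beta>" for x by (simp add: s_def)
    note G2_substitution[OF \<Omega> v0L u s this, of v2 \<alpha> K]
    ultimately show ?thesis by simp
  qed
  then have bdd: "bdd_above (?E ` (W012 \<Omega> \<times> L2 \<Omega>))"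
    by (intro bdd_aboveI2[of _ _ "conjugate \<Omega> ?Q v2 + ?c"]) auto
  show le: "L2_inner \<Omega> u v2 + L2_inner \<Omega> v v0 - G2 \<Omega> \<alpha> \<beta> K u v \<le> G2star \<Omega> \<alpha> \<beta> K v2 v0"
    if "u \<in> W012 \<Omega>" "v \<in> L2 \<Omega>" for u v
    unfolding G2star_def using cSUP_upper[OF _ bdd, of "(u, v)"] that by simp
  have zero: "(\<lambda>x. 0) \<in> W012 \<Omega>" by (rule test_function_W012[OF \<Omega> test_functions_zero])
  show "G2star \<Omega> \<alpha> \<beta> K v2 v0 = conjugate \<Omega> ?Q v2 + ?c"
  proof (rule antisym)
    have "W012 \<Omega> \<times> L2 \<Omega> \<noteq> {}" using zero v2 by blast
    then show "G2star \<Omega> \<alpha> \<beta> K v2 v0 \<le> conjugate \<Omega> ?Q v2 + ?c"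
      unfolding G2star_def using upper by (intro cSUP_least) auto
    have "conjugate \<Omega> ?Q v2 \<le> G2star \<Omega> \<alpha> \<beta> K v2 v0 - ?c"
      unfolding conjugate_def
    proof (rule cSUP_least)
      show "W012 \<Omega> \<noteq> {}" using zero by blast
      fix u assume u: "u \<in> W012 \<Omega>"
      define s where "s x = 1 / \<alpha> * v0 x" for x
      have s: "s \<in> L2 \<Omega>" unfolding s_def[abs_def] by (rule L2_scale[OF v0L])
      have v: "(\<lambda>x. (s x - (u x)\<^sup>2) + \<beta>) \<in> L2 \<Omega>"
        by (intro L2_add L2_diff s W012_square_L2 L2_const \<Omega> u)
      have "L2_inner \<Omega> s v0 - \<alpha> / 2 * L2_inner \<Omega> s s = L2_inner \<Omega> v0 v0 / (2 * \<alpha>)"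
        unfolding s_def L2_inner_scale_left L2_inner_scale_right using \<alpha> by (simp add: field_simps)
      with le[OF u v] G2_substitution[OF \<Omega> v0L u s, of "\<lambda>x. (s x - (u x)\<^sup>2) + \<beta>" \<beta> v2 \<alpha> K]
      show "L2_inner \<Omega> u v2 - ?Q u \<le> G2star \<Omega> \<alpha> \<beta> K v2 v0 - ?c" by simp
    qed
    then show "conjugate \<Omega> ?Q v2 + ?c \<le> G2star \<Omega> \<alpha> \<beta> K v2 v0" by simp
  qed
qed

section \<open>Weak duality\<close>

text \<open>
  Add the Fenchel inequality for \<open>G\<^sub>1\<close> to the one for \<open>G\<^sub>2\<close> at the point \<open>(u, 0)\<close>: on the constraint
  set the pairings with \<open>w\<^sub>1\<close> and \<open>w\<^sub>2\<close> add up to the pairing with \<open>f\<close> in \<open>J\<close>.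
\<close>

lemma weak_duality:
  assumes \<Omega>: "open \<Omega>" "bounded \<Omega>" and pos: "0 < \<alpha>" "0 < \<gamma>" "0 < K"
    and f: "f \<in> L2 \<Omega>" and z: "z \<in> L2 \<Omega>" and w: "(w1, w2, w0) \<in> Astar \<Omega> K f" and u: "u \<in> W012 \<Omega>"
  shows "Jstar \<Omega> \<alpha> \<beta> \<gamma> K w1 w2 w0 z
    \<le> J \<Omega> \<alpha> \<beta> \<gamma> f u + K / 2 * L2_inner \<Omega> u u - L2_inner \<Omega> u z + Fstar \<Omega> K z"
proof -
  have w1: "w1 \<in> L2 \<Omega>" and w2: "w2 \<in> L2 \<Omega>" and w0: "w0 \<in> Bstar \<Omega> K"
    and sum: "AE x in lebesgue_on \<Omega>. w1 x + w2 x = f x"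
    using w by (auto simp: Astar_def elim: eventually_mono)
  note uL = W012_L2[OF u]
  obtain c where c: "0 < c" "\<And>u. u \<in> W012 \<Omega> \<Longrightarrow> c * L2_inner \<Omega> u u \<le> \<gamma> / 2 * dirichlet_integral \<Omega> u"
    using dirichlet_coercive[OF \<Omega> pos(2)] by blast
  have "L2_inner \<Omega> u (\<lambda>x. w1 x + z x) - \<gamma> / 2 * dirichlet_integral \<Omega> u \<le> G1star \<Omega> \<gamma> (\<lambda>x. w1 x + z x)"
    unfolding G1star_conjugate by (rule conjugate_upper[OF L2_add[OF w1 z] c u])
  moreover have "L2_inner \<Omega> u w2 + L2_inner \<Omega> (\<lambda>x. 0) w0 - G2 \<Omega> \<alpha> \<beta> K u (\<lambda>x. 0) \<le> G2star \<Omega> \<alpha> \<beta> K w2 w0"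
    by (rule G2star_upper[OF \<Omega> pos(3,1) w2 w0 u L2_const[OF \<Omega>(2,1)]])
  moreover have "L2_inner \<Omega> u (\<lambda>x. w1 x + w2 x) = L2_inner \<Omega> u f"
    unfolding L2_inner_commute[of \<Omega> u] by (rule L2_inner_cong_AE[OF L2_add[OF w1 w2] f uL sum])
  ultimately show ?thesis
    by (simp add: Jstar_def J_def G2_def L2_inner_add_right[OF w1 z uL] L2_inner_add_right[OF w1 w2 uL]
        L2_inner_self) (simp add: L2_inner_def)
qed

section \<open>Critical points of the dual functional\<close>

lemma first_variation_L2_D:
  assumes "first_variation_vanishes (L2 \<Omega>) F v" "v \<in> L2 \<Omega>" "\<phi> \<in> L2 \<Omega>"
  shows "((\<lambda>t. F (\<lambda>x. v x + t * \<phi> x)) has_real_derivative 0) (at 0)"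
  using assms unfolding first_variation_vanishes_def by (simp add: L2_add L2_scale)

text \<open>The direction is a difference quotient of two elements of the space.\<close>

lemma W012_direction:
  assumes \<Omega>: "open \<Omega>" "bounded \<Omega>" and u: "u \<in> W012 \<Omega>"
    and ev: "\<forall>\<^sub>F t in nhds 0. (\<lambda>x. u x + t * \<phi> x) \<in> W012 \<Omega>"
  shows "\<phi> \<in> W012 \<Omega>"
proof -
  obtain \<delta> where "0 < \<delta>" and \<delta>: "\<And>t. \<bar>t\<bar> < \<delta> \<Longrightarrow> (\<lambda>x. u x + t * \<phi> x) \<in> W012 \<Omega>"
    using ev by (auto simp: eventually_nhds_metric dist_real_def)
  define t where "t = \<delta> / 2"
  have t: "0 < t" "(\<lambda>x. u x + t * \<phi> x) \<in> W012 \<Omega>"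
    using \<open>0 < \<delta>\<close> \<delta>[of t] by (auto simp: t_def)
  have "(\<lambda>x. (u x + t * \<phi> x) + (-1) * u x) \<in> W012 \<Omega>" by (rule W012_add_scale[OF \<Omega> t(2) u])
  from W012_add_scale[OF \<Omega> test_function_W012[OF \<Omega> test_functions_zero] this, of "1 / t"]
  show ?thesis using t(1) by simp
qed

text \<open>The difference from the minorant has a local minimum at \<open>0\<close>.\<close>

lemma derivative_of_touching_minorant:
  fixes M :: "real \<Rightarrow> real"
  assumes M: "(M has_real_derivative d) (at 0)"
    and le: "\<forall>\<^sub>F t in nhds 0. M 0 + t * a + t\<^sup>2 * b \<le> M t"
  shows "d = a"
proof -
  obtain \<delta> where "0 < \<delta>" and \<delta>: "\<And>t. \<bar>t\<bar> < \<delta> \<Longrightarrow> M 0 + t * a + t\<^sup>2 * b \<le> M t"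
    using le by (auto simp: eventually_nhds_metric dist_real_def)
  have "((\<lambda>t. M t - (M 0 + t * a + t\<^sup>2 * b)) has_real_derivative d - a) (at 0)"
    using M by (auto intro!: derivative_eq_intros)
  from DERIV_local_min[OF this \<open>0 < \<delta>\<close>] have "d - a = 0" using \<delta> by simp
  then show ?thesis by simp
qed

locale dual_critical_point =
  fixes \<Omega> :: "(real^3) set" and \<alpha> \<beta> \<gamma> K :: real and f v1 v2 v0 z u0 :: "real^3 \<Rightarrow> real"
  assumes \<Omega>: "open \<Omega>" "bounded \<Omega>" and pos: "0 < \<alpha>" "0 < \<gamma>" "0 < K" and f: "f \<in> L2 \<Omega>"
    and v1: "v1 \<in> L2 \<Omega>" and v2: "v2 \<in> L2 \<Omega>" and v0: "v0 \<in> Bstar \<Omega> K" and z: "z \<in> L2 \<Omega>"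
    and u0: "u0 \<in> W012 \<Omega>"
    and var_v1: "first_variation_vanishes (L2 \<Omega>) (\<lambda>w. J1star \<Omega> \<alpha> \<beta> \<gamma> K f w v2 v0 z u0) v1"
    and var_v2: "first_variation_vanishes (L2 \<Omega>) (\<lambda>w. J1star \<Omega> \<alpha> \<beta> \<gamma> K f v1 w v0 z u0) v2"
    and var_v0: "first_variation_vanishes (Bstar \<Omega> K) (\<lambda>w. J1star \<Omega> \<alpha> \<beta> \<gamma> K f v1 v2 w z u0) v0"
    and var_z: "first_variation_vanishes (L2 \<Omega>) (\<lambda>w. J1star \<Omega> \<alpha> \<beta> \<gamma> K f v1 v2 v0 w u0) z"
    and var_u: "first_variation_vanishes (W012 \<Omega>) (\<lambda>w. J1star \<Omega> \<alpha> \<beta> \<gamma> K f v1 v2 v0 z w) u0"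
begin

abbreviation (input) weight :: "real^3 \<Rightarrow> real" where
  "weight \<equiv> \<lambda>x. v0 x + K / 2"

lemma u0L: "u0 \<in> L2 \<Omega>" by (rule W012_L2[OF u0])
lemma v0L: "v0 \<in> L2 \<Omega>" by (rule Bstar_L2[OF v0])
lemma weightL: "weight \<in> L2 \<Omega>" by (rule weight_L2[OF \<Omega> v0L])
lemma v1z: "(\<lambda>x. v1 x + z x) \<in> L2 \<Omega>" by (rule L2_add[OF v1 z])
lemma u0sq: "(\<lambda>x. (u0 x)\<^sup>2) \<in> L2 \<Omega>" by (rule W012_square_L2[OF \<Omega> u0])

lemma inner_line_right:
  assumes "g \<in> L2 \<Omega>" "\<phi> \<in> L2 \<Omega>" "h \<in> L2 \<Omega>"
  shows "L2_inner \<Omega> h (\<lambda>x. g x + t * \<phi> x) = L2_inner \<Omega> h g + t * L2_inner \<Omega> h \<phi>"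
  using L2_inner_add_right[OF assms(1) L2_scale[OF assms(2)] assms(3)] by (simp add: L2_inner_scale_right)

text \<open>
  The dual functional is affine in \<open>u\<close>, and the residual of the constraint is its slope.
\<close>

lemma constraint: "AE x in lebesgue_on \<Omega>. v1 x + v2 x - f x = 0"
proof (rule fundamental_lemma[OF \<Omega>])
  let ?g = "\<lambda>x. v1 x + v2 x - f x"
  show g: "?g \<in> L2 \<Omega>" by (intro L2_diff L2_add v1 v2 f)
  fix \<phi> assume "\<phi> \<in> test_functions \<Omega>"
  then have \<phi>: "\<phi> \<in> W012 \<Omega>" by (rule test_function_W012[OF \<Omega>])
  have "(\<lambda>x. u0 x + t * \<phi> x) \<in> W012 \<Omega>" for t by (rule W012_add_scale[OF \<Omega> u0 \<phi>])
  then have "((\<lambda>t. J1star \<Omega> \<alpha> \<beta> \<gamma> K f v1 v2 v0 z (\<lambda>x. u0 x + t * \<phi> x)) has_real_derivative 0) (at 0)"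
    using var_u by (simp add: first_variation_vanishes_def)
  moreover have "J1star \<Omega> \<alpha> \<beta> \<gamma> K f v1 v2 v0 z (\<lambda>x. u0 x + t * \<phi> x)
      = Jstar \<Omega> \<alpha> \<beta> \<gamma> K v1 v2 v0 z + (L2_inner \<Omega> ?g u0 + t * L2_inner \<Omega> ?g \<phi>)" for t
    unfolding J1star_def L2_inner_commute[of \<Omega> _ ?g] inner_line_right[OF u0L W012_L2[OF \<phi>] g] ..
  moreover have "((\<lambda>t. Jstar \<Omega> \<alpha> \<beta> \<gamma> K v1 v2 v0 z + (L2_inner \<Omega> ?g u0 + t * L2_inner \<Omega> ?g \<phi>))
      has_real_derivative L2_inner \<Omega> ?g \<phi>) (at 0)"
    by (auto intro!: derivative_eq_intros)
  ultimately show "L2_inner \<Omega> ?g \<phi> = 0" using DERIV_unique by fastforce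
qed

lemma feasible: "(v1, v2, v0) \<in> Astar \<Omega> K f"
  using v1 v2 v0 constraint by (simp add: Astar_def)

lemma inner_constraint:
  assumes "h \<in> L2 \<Omega>"
  shows "L2_inner \<Omega> h v1 + L2_inner \<Omega> h v2 = L2_inner \<Omega> h f"
proof -
  have "AE x in lebesgue_on \<Omega>. v1 x + v2 x = f x"
    using constraint by (rule eventually_mono) simp
  then have "L2_inner \<Omega> (\<lambda>x. v1 x + v2 x) h = L2_inner \<Omega> f h"
    by (rule L2_inner_cong_AE[OF L2_add[OF v1 v2] f assms])
  then show ?thesis
    using L2_inner_add_left[OF v1 v2 assms] by (simp add: L2_inner_commute)
qed

text \<open>
  As a function of \<open>v\<^sub>1\<close> the dual functional is \<open>- G\<^sub>1\<^sup>*\<close> plus an affine function of slope \<open>u\<^sub>0\<close>.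
\<close>

lemma G1star_derivative:
  assumes \<psi>: "\<psi> \<in> L2 \<Omega>"
  shows "((\<lambda>t. G1star \<Omega> \<gamma> (\<lambda>x. (v1 x + z x) + t * \<psi> x)) has_real_derivative L2_inner \<Omega> u0 \<psi>) (at 0)"
proof -
  let ?F = "\<lambda>t. J1star \<Omega> \<alpha> \<beta> \<gamma> K f (\<lambda>x. v1 x + t * \<psi> x) v2 v0 z u0"
  let ?c = "- G2star \<Omega> \<alpha> \<beta> K v2 v0 + Fstar \<Omega> K z + L2_inner \<Omega> u0 (\<lambda>x. v1 x + v2 x - f x)"
  have F: "(?F has_real_derivative 0) (at 0)" by (rule first_variation_L2_D[OF var_v1 v1 \<psi>])
  have shift: "(\<lambda>x. v1 x + t * \<psi> x + v2 x - f x) = (\<lambda>x. (v1 x + v2 x - f x) + t * \<psi> x)"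
    "(\<lambda>x. v1 x + t * \<psi> x + z x) = (\<lambda>x. (v1 x + z x) + t * \<psi> x)" for t
    by (auto simp: fun_eq_iff)
  have g: "(\<lambda>x. v1 x + v2 x - f x) \<in> L2 \<Omega>" by (intro L2_diff L2_add v1 v2 f)
  have eq: "G1star \<Omega> \<gamma> (\<lambda>x. (v1 x + z x) + t * \<psi> x) = ?c + t * L2_inner \<Omega> u0 \<psi> - ?F t" for t
    by (simp add: J1star_def Jstar_def shift inner_line_right[OF g \<psi> u0L])
  have "((\<lambda>t. ?c + t * L2_inner \<Omega> u0 \<psi> - ?F t) has_real_derivative L2_inner \<Omega> u0 \<psi>) (at 0)"
    by (rule derivative_eq_intros F | simp)+
  then show ?thesis unfolding eq .
qed

text \<open>
  The variable \<open>z\<close> occurs only in \<open>F\<^sup>* - G\<^sub>1\<^sup>*\<close>, so \<open>F\<^sup>*\<close> inherits the derivative of \<open>G\<^sub>1\<^sup>*\<close>.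
\<close>

lemma Fstar_derivative:
  assumes \<psi>: "\<psi> \<in> L2 \<Omega>"
  shows "((\<lambda>t. Fstar \<Omega> K (\<lambda>x. z x + t * \<psi> x)) has_real_derivative L2_inner \<Omega> u0 \<psi>) (at 0)"
proof -
  let ?F = "\<lambda>t. J1star \<Omega> \<alpha> \<beta> \<gamma> K f v1 v2 v0 (\<lambda>x. z x + t * \<psi> x) u0"
  let ?G = "\<lambda>t. G1star \<Omega> \<gamma> (\<lambda>x. (v1 x + z x) + t * \<psi> x)"
  let ?c = "G2star \<Omega> \<alpha> \<beta> K v2 v0 - L2_inner \<Omega> u0 (\<lambda>x. v1 x + v2 x - f x)"
  have F: "(?F has_real_derivative 0) (at 0)" by (rule first_variation_L2_D[OF var_z z \<psi>])
  have shift: "(\<lambda>x. v1 x + (z x + t * \<psi> x)) = (\<lambda>x. (v1 x + z x) + t * \<psi> x)" for t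
    by (auto simp: fun_eq_iff)
  have eq: "Fstar \<Omega> K (\<lambda>x. z x + t * \<psi> x) = ?c + ?F t + ?G t" for t
    by (simp add: J1star_def Jstar_def shift)
  have "((\<lambda>t. ?c + ?F t + ?G t) has_real_derivative L2_inner \<Omega> u0 \<psi>) (at 0)"
    by (rule derivative_eq_intros F G1star_derivative[OF \<psi>] | simp)+
  then show ?thesis unfolding eq .
qed

lemma G2star_derivative:
  assumes \<psi>: "\<psi> \<in> L2 \<Omega>"
  shows "((\<lambda>t. G2star \<Omega> \<alpha> \<beta> K (\<lambda>x. v2 x + t * \<psi> x) v0) has_real_derivative L2_inner \<Omega> u0 \<psi>) (at 0)"
proof -
  let ?F = "\<lambda>t. J1star \<Omega> \<alpha> \<beta> \<gamma> K f v1 (\<lambda>x. v2 x + t * \<psi> x) v0 z u0"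
  let ?c = "- G1star \<Omega> \<gamma> (\<lambda>x. v1 x + z x) + Fstar \<Omega> K z + L2_inner \<Omega> u0 (\<lambda>x. v1 x + v2 x - f x)"
  have F: "(?F has_real_derivative 0) (at 0)" by (rule first_variation_L2_D[OF var_v2 v2 \<psi>])
  have shift: "(\<lambda>x. v1 x + (v2 x + t * \<psi> x) - f x) = (\<lambda>x. (v1 x + v2 x - f x) + t * \<psi> x)" for t
    by (auto simp: fun_eq_iff)
  have g: "(\<lambda>x. v1 x + v2 x - f x) \<in> L2 \<Omega>" by (intro L2_diff L2_add v1 v2 f)
  have eq: "G2star \<Omega> \<alpha> \<beta> K (\<lambda>x. v2 x + t * \<psi> x) v0 = ?c + t * L2_inner \<Omega> u0 \<psi> - ?F t" for t
    by (simp add: J1star_def Jstar_def shift inner_line_right[OF g \<psi> u0L])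
  have "((\<lambda>t. ?c + t * L2_inner \<Omega> u0 \<psi> - ?F t) has_real_derivative L2_inner \<Omega> u0 \<psi>) (at 0)"
    by (rule derivative_eq_intros F | simp)+
  then show ?thesis unfolding eq .
qed

text \<open>
  For each conjugate, differentiability gives the value attained at \<open>u\<^sub>0\<close>, and maximality of \<open>u\<^sub>0\<close> gives
  an Euler-Lagrange equation; for \<open>F\<close> the equation holds pointwise.
\<close>

lemma G1star_attained:
  shows G1star_value: "G1star \<Omega> \<gamma> (\<lambda>x. v1 x + z x)
      = L2_inner \<Omega> u0 (\<lambda>x. v1 x + z x) - \<gamma> / 2 * dirichlet_integral \<Omega> u0"
    and G1star_equation: "\<phi> \<in> W012 \<Omega> \<Longrightarrow>
      L2_inner \<Omega> \<phi> v1 + L2_inner \<Omega> \<phi> z = \<gamma> * grad_form \<Omega> u0 \<phi>"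
proof -
  let ?P = "\<lambda>u. \<gamma> / 2 * dirichlet_integral \<Omega> u"
  obtain c where c: "0 < c" "\<And>u. u \<in> W012 \<Omega> \<Longrightarrow> c * L2_inner \<Omega> u u \<le> ?P u"
    using dirichlet_coercive[OF \<Omega> pos(2)] by blast
  have attained: "conjugate \<Omega> ?P (\<lambda>x. v1 x + z x) = L2_inner \<Omega> u0 (\<lambda>x. v1 x + z x) - ?P u0"
    by (rule conjugate_attained_at_derivative[OF \<Omega> u0 v1z c G1star_derivative[unfolded G1star_conjugate]
          dirichlet_approximate_subgradient[OF \<Omega> pos(2) u0]])
  then show "G1star \<Omega> \<gamma> (\<lambda>x. v1 x + z x)
      = L2_inner \<Omega> u0 (\<lambda>x. v1 x + z x) - \<gamma> / 2 * dirichlet_integral \<Omega> u0"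
    by (simp add: G1star_conjugate)
  assume \<phi>: "\<phi> \<in> W012 \<Omega>"
  have "L2_inner \<Omega> \<phi> (\<lambda>x. v1 x + z x) = \<gamma> * grad_form \<Omega> u0 \<phi>"
  proof (rule Euler_Lagrange_quadratic[OF W012_add_scale[OF \<Omega> u0 \<phi>] u0L W012_L2[OF \<phi>] v1z])
    show "L2_inner \<Omega> u (\<lambda>x. v1 x + z x) - ?P u \<le> L2_inner \<Omega> u0 (\<lambda>x. v1 x + z x) - ?P u0"
      if "u \<in> W012 \<Omega>" for u
      unfolding attained[symmetric] by (rule conjugate_upper[OF v1z c that])
    show "?P (\<lambda>x. u0 x + t * \<phi> x) = ?P u0 + t * (\<gamma> * grad_form \<Omega> u0 \<phi>)
        + t\<^sup>2 * (\<gamma> / 2 * dirichlet_integral \<Omega> \<phi>)" for t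
      unfolding dirichlet_integral_add_scale[OF \<Omega> W012_W12[OF u0] W012_W12[OF \<phi>]]
      by (simp add: algebra_simps)
  qed
  then show "L2_inner \<Omega> \<phi> v1 + L2_inner \<Omega> \<phi> z = \<gamma> * grad_form \<Omega> u0 \<phi>"
    by (simp add: L2_inner_add_right[OF v1 z W012_L2[OF \<phi>]])
qed

lemma Fstar_attained:
  shows Fstar_value: "Fstar \<Omega> K z = L2_inner \<Omega> u0 z - K / 2 * L2_inner \<Omega> u0 u0"
    and z_eq: "AE x in lebesgue_on \<Omega>. z x = K * u0 x"
proof -
  let ?P = "\<lambda>u. K / 2 * L2_inner \<Omega> u u"
  have c: "0 < K / 2" "\<And>u. u \<in> W012 \<Omega> \<Longrightarrow> K / 2 * L2_inner \<Omega> u u \<le> ?P u"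
    using pos by auto
  have attained: "conjugate \<Omega> ?P z = L2_inner \<Omega> u0 z - ?P u0"
    by (rule conjugate_attained_at_derivative[OF \<Omega> u0 z c Fstar_derivative[unfolded Fstar_conjugate]
          L2_square_approximate_subgradient[OF u0L pos(3)]])
      (auto intro: W012_L2)
  then show "Fstar \<Omega> K z = L2_inner \<Omega> u0 z - K / 2 * L2_inner \<Omega> u0 u0"
    by (simp add: Fstar_conjugate)
  have Ku0: "(\<lambda>x. K * u0 x) \<in> L2 \<Omega>" by (rule L2_scale[OF u0L])
  have "AE x in lebesgue_on \<Omega>. z x - K * u0 x = 0"
  proof (rule fundamental_lemma[OF \<Omega> L2_diff[OF z Ku0]])
    fix \<phi> assume "\<phi> \<in> test_functions \<Omega>"
    then have \<phi>: "\<phi> \<in> W012 \<Omega>" by (rule test_function_W012[OF \<Omega>])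
    have "L2_inner \<Omega> \<phi> z = K * L2_inner \<Omega> u0 \<phi>"
    proof (rule Euler_Lagrange_quadratic[OF W012_add_scale[OF \<Omega> u0 \<phi>] u0L W012_L2[OF \<phi>] z])
      show "L2_inner \<Omega> u z - ?P u \<le> L2_inner \<Omega> u0 z - ?P u0" if "u \<in> W012 \<Omega>" for u
        unfolding attained[symmetric] by (rule conjugate_upper[OF z c that])
      show "?P (\<lambda>x. u0 x + t * \<phi> x) = ?P u0 + t * (K * L2_inner \<Omega> u0 \<phi>) + t\<^sup>2 * (K / 2 * L2_inner \<Omega> \<phi> \<phi>)" for t
        unfolding L2_inner_self_add_scale[OF u0L W012_L2[OF \<phi>]] by (simp add: algebra_simps)
    qed
    then show "L2_inner \<Omega> (\<lambda>x. z x - K * u0 x) \<phi> = 0"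
      using L2_inner_diff_left[OF z Ku0 W012_L2[OF \<phi>]]
      by (simp add: L2_inner_scale_left L2_inner_commute[of \<Omega> z])
  qed
  then show "AE x in lebesgue_on \<Omega>. z x = K * u0 x" by simp
qed

lemma inner_z:
  assumes "h \<in> L2 \<Omega>"
  shows "L2_inner \<Omega> h z = K * L2_inner \<Omega> h u0"
  using L2_inner_cong_AE[OF z L2_scale[OF u0L] assms z_eq]
  by (simp add: L2_inner_scale_left L2_inner_commute)

lemma G2star_attained:
  shows G2star_value: "G2star \<Omega> \<alpha> \<beta> K v2 v0
      = L2_inner \<Omega> u0 v2 - L2_inner \<Omega> weight (\<lambda>x. (u0 x)\<^sup>2)
        + (L2_inner \<Omega> v0 v0 / (2 * \<alpha>) + \<beta> * integral\<^sup>L (lebesgue_on \<Omega>) v0)"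
    and G2star_equation: "\<phi> \<in> W012 \<Omega> \<Longrightarrow>
      L2_inner \<Omega> \<phi> v2 = 2 * L2_inner \<Omega> weight (\<lambda>x. u0 x * \<phi> x)"
proof -
  let ?Q = "\<lambda>u. L2_inner \<Omega> weight (\<lambda>x. (u x)\<^sup>2)"
  have c: "0 < K / 4" using pos by simp
  note coercive = weighted_square_coercive[OF \<Omega> v0]
  have nonneg: "AE x in lebesgue_on \<Omega>. 0 \<le> weight x"
    using Bstar_AE[OF v0] by (rule eventually_mono) (use pos in auto)
  have attained: "conjugate \<Omega> ?Q v2 = L2_inner \<Omega> u0 v2 - ?Q u0"
  proof (rule conjugate_attained_at_derivative[OF \<Omega> u0 v2 c coercive])
    show "((\<lambda>t. conjugate \<Omega> ?Q (\<lambda>x. v2 x + t * \<psi> x)) has_real_derivative L2_inner \<Omega> u0 \<psi>) (at 0)"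
      if \<psi>: "\<psi> \<in> L2 \<Omega>" for \<psi>
    proof -
      let ?c = "L2_inner \<Omega> v0 v0 / (2 * \<alpha>) + \<beta> * integral\<^sup>L (lebesgue_on \<Omega>) v0"
      have "((\<lambda>t. G2star \<Omega> \<alpha> \<beta> K (\<lambda>x. v2 x + t * \<psi> x) v0 - ?c) has_real_derivative L2_inner \<Omega> u0 \<psi> - 0) (at 0)"
        by (intro DERIV_diff G2star_derivative[OF \<psi>] DERIV_const)
      moreover have "G2star \<Omega> \<alpha> \<beta> K (\<lambda>x. v2 x + t * \<psi> x) v0 - ?c = conjugate \<Omega> ?Q (\<lambda>x. v2 x + t * \<psi> x)" for t
        using G2star_conjugate[OF \<Omega> pos(3,1) L2_add[OF v2 L2_scale[OF \<psi>]] v0] by simp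
      ultimately show ?thesis by simp
    qed
    show "\<exists>\<phi>\<in>L2 \<Omega>. \<forall>u\<in>W012 \<Omega>. ?Q u0 + (L2_inner \<Omega> u \<phi> - L2_inner \<Omega> u0 \<phi>) - \<epsilon> \<le> ?Q u"
      if "0 < \<epsilon>" for \<epsilon>
      by (rule weighted_square_approximate_subgradient[OF \<Omega> weightL nonneg u0 that])
  qed
  then show "G2star \<Omega> \<alpha> \<beta> K v2 v0 = L2_inner \<Omega> u0 v2 - ?Q u0
      + (L2_inner \<Omega> v0 v0 / (2 * \<alpha>) + \<beta> * integral\<^sup>L (lebesgue_on \<Omega>) v0)"
    using G2star_conjugate[OF \<Omega> pos(3,1) v2 v0] by simp
  assume \<phi>: "\<phi> \<in> W012 \<Omega>"
  show "L2_inner \<Omega> \<phi> v2 = 2 * L2_inner \<Omega> weight (\<lambda>x. u0 x * \<phi> x)"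
  proof (rule Euler_Lagrange_quadratic[OF W012_add_scale[OF \<Omega> u0 \<phi>] u0L W012_L2[OF \<phi>] v2])
    show "L2_inner \<Omega> u v2 - ?Q u \<le> L2_inner \<Omega> u0 v2 - ?Q u0" if "u \<in> W012 \<Omega>" for u
      unfolding attained[symmetric] by (rule conjugate_upper[OF v2 c coercive that])
    fix t
    have "(\<lambda>x. (u0 x + t * \<phi> x)\<^sup>2) = (\<lambda>x. ((u0 x)\<^sup>2 + (2 * t) * (u0 x * \<phi> x)) + t\<^sup>2 * (\<phi> x)\<^sup>2)"
      by (simp add: fun_eq_iff power2_eq_square algebra_simps)
    then show "?Q (\<lambda>x. u0 x + t * \<phi> x) = ?Q u0 + t * (2 * L2_inner \<Omega> weight (\<lambda>x. u0 x * \<phi> x))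
        + t\<^sup>2 * L2_inner \<Omega> weight (\<lambda>x. (\<phi> x)\<^sup>2)"
      using inner_line_right[OF L2_add[OF u0sq L2_scale[OF W012_mult_L2[OF \<Omega> u0 \<phi>]]] W012_square_L2[OF \<Omega> \<phi>] weightL]
        inner_line_right[OF u0sq W012_mult_L2[OF \<Omega> u0 \<phi>] weightL] by simp
  qed
qed

text \<open>
  Keeping \<open>u\<^sub>0\<close> as a competitor bounds \<open>G\<^sub>2\<^sup>*\<close> below by a quadratic polynomial along every line in the
  variable \<open>v\<^sub>0\<close>, with equality at the critical point. Stationarity thus makes the slope of this
  polynomial vanish, which is the orthogonality of \<open>d = v\<^sub>0/\<alpha> + \<beta> - u\<^sub>0\<^sup>2\<close> to the direction. Only
  directions along which \<open>v\<^sub>0\<close> stays in the constraint set on both sides may be used; the factor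
  \<open>min 1 (v\<^sub>0 + K/4)\<close>, which is positive almost everywhere, makes the sign of \<open>d\<close> admissible.
\<close>

lemma v0_eq: "AE x in lebesgue_on \<Omega>. v0 x = \<alpha> * ((u0 x)\<^sup>2 - \<beta>)"
proof -
  let ?M = "lebesgue_on \<Omega>"
  define d where "d x = (1 / \<alpha> * v0 x + \<beta>) - (u0 x)\<^sup>2" for x
  define m where "m x = max 0 (min 1 (v0 x + K / 4))" for x
  define \<phi> where "\<phi> x = sgn (d x) * m x" for x
  have dL: "d \<in> L2 \<Omega>"
    unfolding d_def[abs_def] by (intro L2_diff L2_add L2_scale L2_const \<Omega> v0L u0sq)
  have [measurable]: "v0 \<in> borel_measurable ?M" "d \<in> borel_measurable ?M"
    using L2_measurable[OF v0L] L2_measurable[OF dL] by auto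
  have \<phi>_le: "\<bar>\<phi> x\<bar> \<le> m x" and m_le: "m x \<le> 1" for x
    by (auto simp: \<phi>_def m_def abs_mult sgn_if)
  have "(\<lambda>x. \<phi> x * 1) \<in> L2 \<Omega>"
  proof (rule L2_bounded_mult[OF L2_const[OF \<Omega>(2,1)]])
    show "\<phi> \<in> borel_measurable ?M" unfolding \<phi>_def[abs_def] m_def[abs_def] sgn_if by measurable
    show "\<bar>\<phi> x\<bar> \<le> 1" for x using \<phi>_le[of x] m_le[of x] by linarith
  qed
  then have \<phi>L: "\<phi> \<in> L2 \<Omega>" by simp
  have strict: "AE x in ?M. 0 < v0 x + K / 4"
    using v0 by (auto simp: Bstar_def elim!: eventually_mono)
  have admissible: "(\<lambda>x. v0 x + t * \<phi> x) \<in> Bstar \<Omega> K" if "\<bar>t\<bar> < 1" for t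
  proof -
    have "AE x in ?M. 2 * (v0 x + t * \<phi> x) + K > K / 2"
      using strict
    proof (rule eventually_mono)
      fix x assume x: "0 < v0 x + K / 4"
      have "\<bar>t * \<phi> x\<bar> \<le> \<bar>t\<bar> * m x" using \<phi>_le by (simp add: abs_mult mult_left_mono)
      also have "\<dots> \<le> \<bar>t\<bar> * (v0 x + K / 4)" using x by (intro mult_left_mono) (auto simp: m_def)
      also have "\<dots> < 1 * (v0 x + K / 4)" using x that by (intro mult_strict_right_mono) auto
      finally show "2 * (v0 x + t * \<phi> x) + K > K / 2"
        using abs_ge_minus_self[of "t * \<phi> x"] by simp
    qed
    moreover have "(\<lambda>x. v0 x + t * \<phi> x) \<in> L2 \<Omega>" by (intro L2_add L2_scale v0L \<phi>L)
    ultimately show ?thesis by (simp add: Bstar_def)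
  qed
  let ?G = "\<lambda>t. G2star \<Omega> \<alpha> \<beta> K v2 (\<lambda>x. v0 x + t * \<phi> x)"
  let ?int = "\<lambda>v. integral\<^sup>L ?M v"
  have near: "\<forall>\<^sub>F t in nhds 0. \<bar>t\<bar> < (1::real)"
    by (auto simp: eventually_nhds_metric dist_real_def intro!: exI[of _ 1])
  have "((\<lambda>t. J1star \<Omega> \<alpha> \<beta> \<gamma> K f v1 v2 (\<lambda>x. v0 x + t * \<phi> x) z u0) has_real_derivative 0) (at 0)"
    using var_v0 eventually_mono[OF near admissible] by (simp add: first_variation_vanishes_def)
  then have F: "((\<lambda>t. (- G1star \<Omega> \<gamma> (\<lambda>x. v1 x + z x) + Fstar \<Omega> K z + L2_inner \<Omega> u0 (\<lambda>x. v1 x + v2 x - f x))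
      - J1star \<Omega> \<alpha> \<beta> \<gamma> K f v1 v2 (\<lambda>x. v0 x + t * \<phi> x) z u0) has_real_derivative 0 - 0) (at 0)"
    by (intro DERIV_diff DERIV_const)
  have G: "(?G has_real_derivative 0) (at 0)"
    using F by (simp add: J1star_def Jstar_def)
  let ?a = "L2_inner \<Omega> v0 \<phi> / \<alpha> + \<beta> * ?int \<phi> - L2_inner \<Omega> \<phi> (\<lambda>x. (u0 x)\<^sup>2)"
  have minorant: "?G 0 + t * ?a + t\<^sup>2 * (L2_inner \<Omega> \<phi> \<phi> / (2 * \<alpha>)) \<le> ?G t" if "\<bar>t\<bar> < 1" for t
  proof -
    let ?v = "\<lambda>x. v0 x + t * \<phi> x"
    note v = admissible[OF that]
    have K4: "0 < K / 4" using pos by simp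
    have "L2_inner \<Omega> u0 v2 - L2_inner \<Omega> (\<lambda>x. ?v x + K / 2) (\<lambda>x. (u0 x)\<^sup>2)
        \<le> conjugate \<Omega> (\<lambda>u. L2_inner \<Omega> (\<lambda>x. ?v x + K / 2) (\<lambda>x. (u x)\<^sup>2)) v2"
      by (rule conjugate_upper[OF v2 K4 weighted_square_coercive[OF \<Omega> v] u0])
    moreover have "L2_inner \<Omega> (\<lambda>x. ?v x + K / 2) (\<lambda>x. (u0 x)\<^sup>2)
        = L2_inner \<Omega> weight (\<lambda>x. (u0 x)\<^sup>2) + t * L2_inner \<Omega> \<phi> (\<lambda>x. (u0 x)\<^sup>2)"
      using L2_inner_add_left[OF weightL L2_scale[OF \<phi>L, of t] u0sq]
      by (simp add: L2_inner_scale_left add_ac)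
    moreover have "?int ?v = ?int v0 + t * ?int \<phi>"
      using L2_integrable[OF \<Omega>(2,1) v0L] L2_integrable[OF \<Omega>(2,1) \<phi>L] by simp
    moreover have "L2_inner \<Omega> ?v ?v / (2 * \<alpha>) = L2_inner \<Omega> v0 v0 / (2 * \<alpha>) + t * (L2_inner \<Omega> v0 \<phi> / \<alpha>)
        + t\<^sup>2 * (L2_inner \<Omega> \<phi> \<phi> / (2 * \<alpha>))"
      unfolding L2_inner_self_add_scale[OF v0L \<phi>L] by (simp add: add_divide_distrib)
    ultimately show ?thesis
      using G2star_conjugate[OF \<Omega> pos(3,1) v2 v, of \<beta>] G2star_value by (simp add: algebra_simps)
  qed
  have "0 = ?a"
    by (rule derivative_of_touching_minorant[OF G eventually_mono[OF near minorant]])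
  moreover have "L2_inner \<Omega> d \<phi> = ?a"
  proof -
    note const = L2_const[OF \<Omega>(2,1), of \<beta>]
    have "L2_inner \<Omega> d \<phi> = L2_inner \<Omega> (\<lambda>x. 1 / \<alpha> * v0 x) \<phi> + L2_inner \<Omega> (\<lambda>x. \<beta>) \<phi> - L2_inner \<Omega> (\<lambda>x. (u0 x)\<^sup>2) \<phi>"
      unfolding d_def[abs_def] L2_inner_diff_left[OF L2_add[OF L2_scale[OF v0L] const] u0sq \<phi>L]
        L2_inner_add_left[OF L2_scale[OF v0L] const \<phi>L] ..
    then show ?thesis
      unfolding L2_inner_scale_left L2_inner_commute[of \<Omega> \<phi>] by (simp add: L2_inner_def)
  qed
  ultimately have "(\<integral>x. \<bar>d x\<bar> * m x \<partial>?M) = 0"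
    by (simp add: L2_inner_def \<phi>_def abs_sgn mult_ac)
  moreover have "integrable ?M (\<lambda>x. \<bar>d x\<bar> * m x)"
    using L2_mult_integrable[OF dL \<phi>L] by (simp add: \<phi>_def abs_sgn mult_ac)
  ultimately have "AE x in ?M. \<bar>d x\<bar> * m x = 0"
    by (subst (asm) integral_nonneg_eq_0_iff_AE) (auto simp: m_def)
  with strict show ?thesis
  proof eventually_elim
    case (elim x)
    then have "d x = 0" by (auto simp: m_def)
    then show ?case using pos(1) by (simp add: d_def field_simps)
  qed
qed

abbreviation (input) s0 :: "real^3 \<Rightarrow> real" where
  "s0 \<equiv> \<lambda>x. (u0 x)\<^sup>2 - \<beta>"

lemma s0L: "s0 \<in> L2 \<Omega>" by (rule L2_diff[OF u0sq L2_const[OF \<Omega>(2,1)]])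

lemma inner_v0:
  assumes "h \<in> L2 \<Omega>"
  shows "L2_inner \<Omega> v0 h = \<alpha> * L2_inner \<Omega> s0 h"
  using L2_inner_cong_AE[OF v0L L2_scale[OF s0L] assms v0_eq] by (simp add: L2_inner_scale_left)

text \<open>
  The slope of \<open>J\<close> along a line is the sum of the Euler-Lagrange equations for \<open>G\<^sub>1\<close> and \<open>G\<^sub>2\<close>: the term
  \<open>K \<langle>u\<^sub>0, \<phi>\<rangle>\<close> of the former, which comes from \<open>z = K u\<^sub>0\<close>, cancels the one in the weight of the
  latter.
\<close>

lemma primal_criticality: "first_variation_vanishes (W012 \<Omega>) (J \<Omega> \<alpha> \<beta> \<gamma> f) u0"
  unfolding first_variation_vanishes_def
proof (intro allI impI)
  fix \<phi> assume "\<forall>\<^sub>F t in nhds 0. (\<lambda>x. u0 x + t * \<phi> x) \<in> W012 \<Omega>"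
  then have \<phi>: "\<phi> \<in> W012 \<Omega>" by (rule W012_direction[OF \<Omega> u0])
  note \<phi>L = W012_L2[OF \<phi>] and \<phi>sq = W012_square_L2[OF \<Omega> \<phi>] and u\<phi> = W012_mult_L2[OF \<Omega> u0 \<phi>]
  let ?b = "\<lambda>x. 2 * (u0 x * \<phi> x)" and ?c = "\<lambda>x. (\<phi> x)\<^sup>2"
  note bL = L2_scale[OF u\<phi>, of 2]
  let ?r = "\<lambda>t. L2_inner \<Omega> ?b ?b + 2 * t * L2_inner \<Omega> ?b ?c + t\<^sup>2 * L2_inner \<Omega> ?c ?c"
  have quartic: "(\<integral>x. ((u0 x + t * \<phi> x)\<^sup>2 - \<beta>)\<^sup>2 \<partial>lebesgue_on \<Omega>)
      = L2_inner \<Omega> s0 s0 + 2 * t * (L2_inner \<Omega> s0 ?b + t * L2_inner \<Omega> s0 ?c) + t\<^sup>2 * ?r t" for t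
  proof -
    have "(u0 x + t * \<phi> x)\<^sup>2 - \<beta> = s0 x + t * (?b x + t * ?c x)" for x
      by (simp add: power2_eq_square algebra_simps)
    then have "(\<integral>x. ((u0 x + t * \<phi> x)\<^sup>2 - \<beta>)\<^sup>2 \<partial>lebesgue_on \<Omega>)
        = L2_inner \<Omega> (\<lambda>x. s0 x + t * (?b x + t * ?c x)) (\<lambda>x. s0 x + t * (?b x + t * ?c x))"
      by (simp only: L2_inner_self)
    also have "\<dots> = L2_inner \<Omega> s0 s0 + 2 * t * L2_inner \<Omega> s0 (\<lambda>x. ?b x + t * ?c x)
        + t\<^sup>2 * L2_inner \<Omega> (\<lambda>x. ?b x + t * ?c x) (\<lambda>x. ?b x + t * ?c x)"
      by (rule L2_inner_self_add_scale[OF s0L L2_add[OF bL L2_scale[OF \<phi>sq]]])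
    also have "L2_inner \<Omega> s0 (\<lambda>x. ?b x + t * ?c x) = L2_inner \<Omega> s0 ?b + t * L2_inner \<Omega> s0 ?c"
      by (rule inner_line_right[OF bL \<phi>sq s0L])
    also have "L2_inner \<Omega> (\<lambda>x. ?b x + t * ?c x) (\<lambda>x. ?b x + t * ?c x) = ?r t"
      by (rule L2_inner_self_add_scale[OF bL \<phi>sq])
    finally show ?thesis .
  qed
  have linear: "L2_inner \<Omega> (\<lambda>x. u0 x + t * \<phi> x) f = L2_inner \<Omega> u0 f + t * L2_inner \<Omega> \<phi> f" for t
    using inner_line_right[OF u0L \<phi>L f, of t] by (simp add: L2_inner_commute[of \<Omega> f])
  have Jt: "J \<Omega> \<alpha> \<beta> \<gamma> f (\<lambda>x. u0 x + t * \<phi> x)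
      = \<gamma> / 2 * (dirichlet_integral \<Omega> u0 + 2 * t * grad_form \<Omega> u0 \<phi> + t\<^sup>2 * dirichlet_integral \<Omega> \<phi>)
        + \<alpha> / 2 * (L2_inner \<Omega> s0 s0 + 2 * t * (L2_inner \<Omega> s0 ?b + t * L2_inner \<Omega> s0 ?c) + t\<^sup>2 * ?r t)
        - (L2_inner \<Omega> u0 f + t * L2_inner \<Omega> \<phi> f)" for t
    unfolding J_def quartic linear
      dirichlet_integral_add_scale[OF \<Omega> W012_W12[OF u0] W012_W12[OF \<phi>]] ..
  have "\<gamma> * grad_form \<Omega> u0 \<phi> + \<alpha> * L2_inner \<Omega> s0 ?b - L2_inner \<Omega> \<phi> f = 0"
  proof -
    have "L2_inner \<Omega> weight (\<lambda>x. u0 x * \<phi> x) = L2_inner \<Omega> v0 (\<lambda>x. u0 x * \<phi> x) + K / 2 * L2_inner \<Omega> \<phi> u0"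
      unfolding L2_inner_add_left[OF v0L L2_const[OF \<Omega>(2,1)] u\<phi>] by (simp add: L2_inner_def mult_ac)
    then show ?thesis
      using G1star_equation[OF \<phi>] G2star_equation[OF \<phi>] inner_constraint[OF \<phi>L] inner_z[OF \<phi>L]
        inner_v0[OF u\<phi>]
      unfolding L2_inner_scale_right by simp
  qed
  then show "((\<lambda>t. J \<Omega> \<alpha> \<beta> \<gamma> f (\<lambda>x. u0 x + t * \<phi> x)) has_real_derivative 0) (at 0)"
    unfolding Jt by (auto intro!: derivative_eq_intros simp: algebra_simps)
qed

text \<open>
  In the sum of the three attained values the terms with \<open>K\<close> cancel, and \<open>v\<^sub>0 = \<alpha> (u\<^sub>0\<^sup>2 - \<beta>)\<close> makes the
  Fenchel-Young inequality between \<open>v\<^sub>0\<close> and \<open>u\<^sub>0\<^sup>2 - \<beta>\<close> an equality.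
\<close>

lemma no_duality_gap: "J \<Omega> \<alpha> \<beta> \<gamma> f u0 = Jstar \<Omega> \<alpha> \<beta> \<gamma> K v1 v2 v0 z"
proof -
  have "L2_inner \<Omega> v0 (\<lambda>x. (u0 x)\<^sup>2) - \<beta> * integral\<^sup>L (lebesgue_on \<Omega>) v0 = L2_inner \<Omega> v0 s0"
    unfolding L2_inner_diff_right[OF u0sq L2_const[OF \<Omega>(2,1)] v0L] by (simp add: L2_inner_def)
  moreover have "L2_inner \<Omega> v0 s0 = \<alpha> * L2_inner \<Omega> s0 s0" by (rule inner_v0[OF s0L])
  moreover have "L2_inner \<Omega> v0 v0 = \<alpha> * (\<alpha> * L2_inner \<Omega> s0 s0)"
    using inner_v0[OF v0L] inner_v0[OF s0L] by (simp add: L2_inner_commute[of \<Omega> s0 v0])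
  then have "L2_inner \<Omega> v0 v0 / (2 * \<alpha>) = \<alpha> / 2 * L2_inner \<Omega> s0 s0" using pos(1) by simp
  moreover have "J \<Omega> \<alpha> \<beta> \<gamma> f u0 = \<gamma> / 2 * dirichlet_integral \<Omega> u0 + \<alpha> / 2 * L2_inner \<Omega> s0 s0 - L2_inner \<Omega> u0 f"
    by (simp add: J_def L2_inner_self)
  ultimately show ?thesis
    unfolding Jstar_def G1star_value G2star_value Fstar_value
      L2_inner_add_right[OF v1 z u0L] weighted_square_expand[OF \<Omega> v0L u0]
    using inner_constraint[OF u0L] by linarith
qed

text \<open>
  Since \<open>z = K u\<^sub>0\<close>, the terms of weak duality that depend on \<open>z\<close> complete the square.
\<close>

lemma Jstar_le_proximal:
  assumes "(w1, w2, w0) \<in> Astar \<Omega> K f" and u: "u \<in> W012 \<Omega>"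
  shows "Jstar \<Omega> \<alpha> \<beta> \<gamma> K w1 w2 w0 z
    \<le> J \<Omega> \<alpha> \<beta> \<gamma> f u + K / 2 * (\<integral>x. \<bar>u x - u0 x\<bar>\<^sup>2 \<partial>lebesgue_on \<Omega>)"
proof -
  have "(\<integral>x. \<bar>u x - u0 x\<bar>\<^sup>2 \<partial>lebesgue_on \<Omega>) = L2_inner \<Omega> (\<lambda>x. u x + (-1) * u0 x) (\<lambda>x. u x + (-1) * u0 x)"
    by (simp add: L2_inner_self)
  also have "\<dots> = L2_inner \<Omega> u u - 2 * L2_inner \<Omega> u u0 + L2_inner \<Omega> u0 u0"
    unfolding L2_inner_self_add_scale[OF W012_L2[OF u] u0L] by simp
  finally have eq: "(\<integral>x. \<bar>u x - u0 x\<bar>\<^sup>2 \<partial>lebesgue_on \<Omega>)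
      = L2_inner \<Omega> u u - 2 * L2_inner \<Omega> u u0 + L2_inner \<Omega> u0 u0" .
  have "K / 2 * (\<integral>x. \<bar>u x - u0 x\<bar>\<^sup>2 \<partial>lebesgue_on \<Omega>)
      = K / 2 * L2_inner \<Omega> u u - K * L2_inner \<Omega> u u0 + K / 2 * L2_inner \<Omega> u0 u0"
    unfolding eq by (simp add: algebra_simps)
  then show ?thesis
    using weak_duality[OF \<Omega> pos(1,2,3) f z assms, of \<beta>] inner_z[OF W012_L2[OF u]] inner_z[OF u0L] Fstar_value
    by linarith
qed

end

theorem theorem2p1:
  fixes \<Omega> :: "(real^3) set"
    and \<alpha> \<beta> \<gamma> K :: real
    and f v1 v2 v0 z u0 :: "real^3 \<Rightarrow> real"
  assumes "open \<Omega>" and "bounded \<Omega>" and "connected \<Omega>" and "lipschitz_boundary \<Omega>"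
    and "\<alpha> > 0" and "\<beta> > 0" and "\<gamma> > 0" and "K > 0" and "K > \<gamma>"
    and "f \<in> L2 \<Omega>"
    and "v1 \<in> L2 \<Omega>" and "v2 \<in> L2 \<Omega>" and "v0 \<in> Bstar \<Omega> K" and "z \<in> L2 \<Omega>" and "u0 \<in> W012 \<Omega>"
    and "first_variation_vanishes (L2 \<Omega>) (\<lambda>w. J1star \<Omega> \<alpha> \<beta> \<gamma> K f w v2 v0 z u0) v1"
    and "first_variation_vanishes (L2 \<Omega>) (\<lambda>w. J1star \<Omega> \<alpha> \<beta> \<gamma> K f v1 w v0 z u0) v2"
    and "first_variation_vanishes (Bstar \<Omega> K) (\<lambda>w. J1star \<Omega> \<alpha> \<beta> \<gamma> K f v1 v2 w z u0) v0"
    and "first_variation_vanishes (L2 \<Omega>) (\<lambda>w. J1star \<Omega> \<alpha> \<beta> \<gamma> K f v1 v2 v0 w u0) z"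
    and "first_variation_vanishes (W012 \<Omega>) (\<lambda>w. J1star \<Omega> \<alpha> \<beta> \<gamma> K f v1 v2 v0 z w) u0"
  shows "first_variation_vanishes (W012 \<Omega>) (J \<Omega> \<alpha> \<beta> \<gamma> f) u0 \<and>
    (v1, v2, v0) \<in> Astar \<Omega> K f \<and>
    ereal (J \<Omega> \<alpha> \<beta> \<gamma> f u0) =
      (INF u\<in>W012 \<Omega>. ereal (J \<Omega> \<alpha> \<beta> \<gamma> f u
         + K / 2 * (\<integral>x. \<bar>u x - u0 x\<bar>\<^sup>2 \<partial>lebesgue_on \<Omega>))) \<and>
    J \<Omega> \<alpha> \<beta> \<gamma> f u0 = Jstar \<Omega> \<alpha> \<beta> \<gamma> K v1 v2 v0 z \<and>
    ereal (Jstar \<Omega> \<alpha> \<beta> \<gamma> K v1 v2 v0 z) =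
      (SUP (w1, w2, w0)\<in>Astar \<Omega> K f. ereal (Jstar \<Omega> \<alpha> \<beta> \<gamma> K w1 w2 w0 z))"
proof -
  interpret dual_critical_point \<Omega> \<alpha> \<beta> \<gamma> K f v1 v2 v0 z u0
    using assms by unfold_locales
  let ?prox = "\<lambda>u. J \<Omega> \<alpha> \<beta> \<gamma> f u + K / 2 * (\<integral>x. \<bar>u x - u0 x\<bar>\<^sup>2 \<partial>lebesgue_on \<Omega>)"
  have inf: "ereal (J \<Omega> \<alpha> \<beta> \<gamma> f u0) = (INF u\<in>W012 \<Omega>. ereal (?prox u))"
  proof (rule antisym)
    show "ereal (J \<Omega> \<alpha> \<beta> \<gamma> f u0) \<le> (INF u\<in>W012 \<Omega>. ereal (?prox u))"
      using Jstar_le_proximal[OF feasible] by (intro INF_greatest) (simp add: no_duality_gap)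
    show "(INF u\<in>W012 \<Omega>. ereal (?prox u)) \<le> ereal (J \<Omega> \<alpha> \<beta> \<gamma> f u0)"
      by (rule INF_lower2[OF u0]) simp
  qed
  have sup: "ereal (Jstar \<Omega> \<alpha> \<beta> \<gamma> K v1 v2 v0 z)
      = (SUP (w1, w2, w0)\<in>Astar \<Omega> K f. ereal (Jstar \<Omega> \<alpha> \<beta> \<gamma> K w1 w2 w0 z))"
  proof (rule antisym)
    show "ereal (Jstar \<Omega> \<alpha> \<beta> \<gamma> K v1 v2 v0 z)
        \<le> (SUP (w1, w2, w0)\<in>Astar \<Omega> K f. ereal (Jstar \<Omega> \<alpha> \<beta> \<gamma> K w1 w2 w0 z))"
      by (rule SUP_upper2[OF feasible]) simp
    show "(SUP (w1, w2, w0)\<in>Astar \<Omega> K f. ereal (Jstar \<Omega> \<alpha> \<beta> \<gamma> K w1 w2 w0 z))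
        \<le> ereal (Jstar \<Omega> \<alpha> \<beta> \<gamma> K v1 v2 v0 z)"
      using Jstar_le_proximal[OF _ u0] by (intro SUP_least) (auto simp: no_duality_gap[symmetric])
  qed
  show ?thesis using primal_criticality feasible inf no_duality_gap sup by blast
qed

end
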